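(* Let $\Phi(z)=\sum_{n\ge0}z^{2^n}$. Then, for all positive odd integers $m$, we have, modulo $64$, \begin{align*} 1+\sum_{\lambda\ge1}f_\lambda^{(3)}(m)\,z^\lambda ={}&32z^9+48z^7+32z^6+(16m+8)z^5+(16m+8)z^4+(2m^2+34)z^3\\ &+(4m^2-4m+24)z^2+(5m^2+12)z+1\\ &+\left(48z^4+24z^3+12z^2+60z+40\right)\Phi(z)\\ &+\left(16z^5+(16m+32)z^4+(4m^2-32m+68)z^3+36z^2+22z+12+\tfrac{12}{z}\right)\Phi^2(z)\\ &+\left(32z^5+32z^4+(16m-16)z^3+40z^2+4z+52+\tfrac{28}{z}\right)\Phi^3(z)\\ &+\Big(32z^7+32z^5+32z^4+(16m+24)z^3+(16m+40)z^2\\ &\qquad+(2m^2+16m+38)z+24+\tfrac{35}{z}\Big)\Phi^4(z)\\ &+\left(32z^3+16z^2+(16m-8)z+44\right)\Phi^5(z)\\ &+\left(16z^3+16mz^2+(4m^2-16m+20)z+44+\tfrac{50}{z}\right)\Phi^6(z)\\ &+\left(32z^3+32z^2+(16m+16)z+40+\tfrac{4}{z}\right)\Phi^7(z). \end{align*}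
   Context: For a positive integer $m$, let $\Gamma_m(3)=\langle x,y\mid x^{2m}=y^{3m}=1,\ x^2=y^3\rangle=C_{2m}\underset{C_m}{\ast}C_{3m}$; $f_\lambda^{(3)}(m)$ is the number of free subgroups of index $6m\lambda$ in $\Gamma_m(3)$. For formal Laurent series with integer coefficients, an equality "modulo $M$" means that coefficients of equal powers of $z$ agree modulo $M$. $\Phi^i(z)$ denotes $(\Phi(z))^i$. *)

theory Defs
  imports
    "HOL-Algebra.Coset"
    "HOL-Computational_Algebra.Formal_Laurent_Series"
begin

text \<open>
  The letter \<open>(a, False)\<close> stands for the generator \<open>a\<close> and \<open>(a, True)\<close> for its inverse.
  A relation \<open>u = v\<close> between words is the pair \<open>(u, v)\<close>.
\<close>

type_synonym 'a word = "('a \<times> bool) list"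

definition words :: "'a set \<Rightarrow> 'a word set" where
  "words S = lists (S \<times> UNIV)"

inductive_set word_cong :: "'a set \<Rightarrow> ('a word \<times> 'a word) set \<Rightarrow> ('a word \<times> 'a word) set"
  for S :: "'a set" and R :: "('a word \<times> 'a word) set" where
  rel: "(u, v) \<in> R \<Longrightarrow> (u, v) \<in> word_cong S R"
| cancel: "a \<in> S \<Longrightarrow> ([(a, e), (a, \<not> e)], []) \<in> word_cong S R"
| refl: "u \<in> words S \<Longrightarrow> (u, u) \<in> word_cong S R"
| sym: "(u, v) \<in> word_cong S R \<Longrightarrow> (v, u) \<in> word_cong S R"
| trans: "(u, v) \<in> word_cong S R \<Longrightarrow> (v, w) \<in> word_cong S R \<Longrightarrow> (u, w) \<in> word_cong S R"
| append: "(u, v) \<in> word_cong S R \<Longrightarrow> (u', v') \<in> word_cong S R \<Longrightarrow> (u @ u', v @ v') \<in> word_cong S R"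

text \<open>
  The group \<open>\<langle>S | R\<rangle>\<close>; it is meaningful only if both sides of each relation are words over \<open>S\<close>.
\<close>

definition presented_group :: "'a set \<Rightarrow> ('a word \<times> 'a word) set \<Rightarrow> 'a word set monoid" where
  "presented_group S R =
    \<lparr>carrier = words S // word_cong S R,
     monoid.mult = (\<lambda>A B. \<Union>u\<in>A. \<Union>v\<in>B. word_cong S R `` {u @ v}),
     monoid.one = word_cong S R `` {[]}\<rparr>"

abbreviation free_group_on :: "'a set \<Rightarrow> 'a word set monoid" where
  "free_group_on X \<equiv> presented_group X {}"

text \<open>
  Looking for bases only inside the element type of \<open>G\<close> loses nothing, since a free group
  contains its bases. The basis may be empty or infinite.
\<close>

definition is_free_group :: "('a, 'b) monoid_scheme \<Rightarrow> bool" where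
  "is_free_group G \<longleftrightarrow> group G \<and> (\<exists>X :: 'a set. G \<cong> free_group_on X)"

lemma words_append [simp]: "u @ v \<in> words S \<longleftrightarrow> u \<in> words S \<and> v \<in> words S"
  by (simp add: words_def)

lemma Nil_words [simp]: "[] \<in> words S"
  by (simp add: words_def)

lemma word_cong_words:
  assumes "(u, v) \<in> word_cong S R" "R \<subseteq> words S \<times> words S"
  shows "u \<in> words S \<and> v \<in> words S"
  using assms by (induction rule: word_cong.induct) (auto simp: words_def)

lemma equiv_word_cong:
  assumes "R \<subseteq> words S \<times> words S"
  shows "equiv (words S) (word_cong S R)"
proof (rule equivI)
  show "word_cong S R \<subseteq> words S \<times> words S"
    using word_cong_words[OF _ assms] by auto
  show "refl_on (words S) (word_cong S R)"
    by (auto simp: refl_on_def intro: word_cong.refl)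
  show "sym (word_cong S R)"
    by (auto intro: symI word_cong.sym)
  show "trans (word_cong S R)"
    by (auto intro: transI word_cong.trans)
qed

lemma presented_group_mult:
  assumes R: "R \<subseteq> words S \<times> words S" and "u \<in> words S" "v \<in> words S"
  shows "word_cong S R `` {u} \<otimes>\<^bsub>presented_group S R\<^esub> word_cong S R `` {v} = word_cong S R `` {u @ v}"
proof -
  let ?c = "\<lambda>w. word_cong S R `` {w}"
  have *: "?c (u' @ v') = ?c (u @ v)" if "u' \<in> ?c u" "v' \<in> ?c v" for u' v'
  proof -
    have "(u @ v, u' @ v') \<in> word_cong S R"
      using that by (intro word_cong.append) auto
    from equiv_class_eq[OF equiv_word_cong[OF R] this] show ?thesis ..
  qed
  have "u \<in> ?c u" "v \<in> ?c v"
    using assms by (auto intro: word_cong.refl)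
  then have "(\<Union>u'\<in>?c u. \<Union>v'\<in>?c v. ?c (u @ v)) = ?c (u @ v)"
    by blast
  moreover have "(\<Union>u'\<in>?c u. \<Union>v'\<in>?c v. ?c (u' @ v')) = (\<Union>u'\<in>?c u. \<Union>v'\<in>?c v. ?c (u @ v))"
    by (rule SUP_cong[OF HOL.refl SUP_cong[OF HOL.refl *]])
  ultimately show ?thesis
    by (simp only: presented_group_def monoid.simps)
qed

lemma word_cong_left_inverse:
  assumes "u \<in> words S"
  shows "(rev (map (\<lambda>(a, e). (a, \<not> e)) u) @ u, []) \<in> word_cong S R"
  using assms
proof (induction u)
  case Nil
  then show ?case by (simp add: word_cong.refl)
next
  case (Cons l u)
  obtain a e where l: "l = (a, e)" by (cases l)
  let ?i = "rev (map (\<lambda>(a, e). (a, \<not> e)) u)"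
  have a: "a \<in> S" and u: "u \<in> words S"
    using Cons.prems by (auto simp: l words_def)
  have i: "?i \<in> words S"
    using u by (auto simp: words_def in_lists_conv_set split: prod.splits)
  have "([(a, \<not> e), (a, e)], []) \<in> word_cong S R"
    using word_cong.cancel[OF a, of "\<not> e"] by simp
  then have "(?i @ [(a, \<not> e), (a, e)] @ u, ?i @ [] @ u) \<in> word_cong S R"
    using i u by (intro word_cong.append word_cong.refl)
  then show ?case
    using Cons.IH[OF u] by (auto simp: l intro: word_cong.trans)
qed

lemma group_presented_group:
  assumes R: "R \<subseteq> words S \<times> words S"
  shows "group (presented_group S R)"
proof (rule groupI)
  let ?G = "presented_group S R"
  have carrier: "\<exists>u\<in>words S. A = word_cong S R `` {u}" if "A \<in> carrier ?G" for A
    using that by (auto simp: presented_group_def elim: quotientE)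
  have in_carrier: "word_cong S R `` {u} \<in> carrier ?G" if "u \<in> words S" for u
    using that by (auto simp: presented_group_def intro: quotientI)
  have one: "\<one>\<^bsub>?G\<^esub> = word_cong S R `` {[]}"
    by (simp add: presented_group_def)
  note m = presented_group_mult[OF R]
  show "A \<otimes>\<^bsub>?G\<^esub> B \<in> carrier ?G" if AB: "A \<in> carrier ?G" "B \<in> carrier ?G" for A B
  proof -
    obtain u v where "u \<in> words S" "v \<in> words S" "A = word_cong S R `` {u}" "B = word_cong S R `` {v}"
      using carrier[OF AB(1)] carrier[OF AB(2)] by blast
    then show ?thesis using in_carrier[of "u @ v"] by (simp add: m)
  qed
  show "\<one>\<^bsub>?G\<^esub> \<in> carrier ?G"
    using in_carrier one by simp
  show "A \<otimes>\<^bsub>?G\<^esub> B \<otimes>\<^bsub>?G\<^esub> C = A \<otimes>\<^bsub>?G\<^esub> (B \<otimes>\<^bsub>?G\<^esub> C)"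
    if ABC: "A \<in> carrier ?G" "B \<in> carrier ?G" "C \<in> carrier ?G" for A B C
  proof -
    obtain u v w where "u \<in> words S" "v \<in> words S" "w \<in> words S" "A = word_cong S R `` {u}"
      "B = word_cong S R `` {v}" "C = word_cong S R `` {w}"
      using carrier[OF ABC(1)] carrier[OF ABC(2)] carrier[OF ABC(3)] by blast
    then show ?thesis by (simp add: m)
  qed
  show "\<one>\<^bsub>?G\<^esub> \<otimes>\<^bsub>?G\<^esub> A = A" if A: "A \<in> carrier ?G" for A
    using carrier[OF A] m[OF Nil_words] one by auto
  show "\<exists>B\<in>carrier ?G. B \<otimes>\<^bsub>?G\<^esub> A = \<one>\<^bsub>?G\<^esub>" if A: "A \<in> carrier ?G" for A
  proof -
    obtain u where u: "u \<in> words S" "A = word_cong S R `` {u}"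
      using carrier[OF A] by blast
    let ?i = "rev (map (\<lambda>(a, e). (a, \<not> e)) u)"
    have i: "?i \<in> words S"
      using u by (auto simp: words_def in_lists_conv_set split: prod.splits)
    have "word_cong S R `` {?i} \<otimes>\<^bsub>?G\<^esub> A = \<one>\<^bsub>?G\<^esub>"
      unfolding u(2) m[OF i u(1)] one
      by (rule equiv_class_eq[OF equiv_word_cong[OF R] word_cong_left_inverse[OF u(1)]])
    then show ?thesis
      using in_carrier[OF i] by blast
  qed
qed

datatype gen = gx | gy

abbreviation gen_power :: "gen \<Rightarrow> nat \<Rightarrow> gen word" where
  "gen_power a k \<equiv> replicate k (a, False)"

definition Gamma3_relations :: "nat \<Rightarrow> (gen word \<times> gen word) set" where
  "Gamma3_relations m =
    {(gen_power gx (2 * m), []), (gen_power gy (3 * m), []), (gen_power gx 2, gen_power gy 3)}"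

definition Gamma3 :: "nat \<Rightarrow> gen word set monoid" where
  "Gamma3 m = presented_group UNIV (Gamma3_relations m)"

lemma group_Gamma3: "group (Gamma3 m)"
  unfolding Gamma3_def by (rule group_presented_group) (auto simp: words_def)

text \<open>
  For \<open>m, l \<ge> 1\<close> the set below is finite, because \<open>Gamma3 m\<close> is finitely generated and the index
  is finite; so \<open>card\<close> is the true number of such subgroups.
\<close>

definition free_subgroup_number :: "nat \<Rightarrow> nat \<Rightarrow> nat" where
  "free_subgroup_number m l =
    card {H. subgroup H (Gamma3 m) \<and> card (rcosets\<^bsub>Gamma3 m\<^esub> H) = 6 * m * l \<and>
             is_free_group ((Gamma3 m)\<lparr>carrier := H\<rparr>)}"

definition free_subgroup_series :: "nat \<Rightarrow> int fls" where
  "free_subgroup_series m =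
    1 + fps_to_fls (Abs_fps (\<lambda>l. if l \<ge> 1 then int (free_subgroup_number m l) else 0))"

definition Phi :: "int fls" where
  "Phi = fps_to_fls (Abs_fps (\<lambda>k. if \<exists>n. k = 2 ^ n then 1 else 0))"

definition fls_cong :: "int fls \<Rightarrow> int fls \<Rightarrow> int \<Rightarrow> bool" where
  "fls_cong F G M \<longleftrightarrow> (\<forall>k. fls_nth F k mod M = fls_nth G k mod M)"

end

theory Submission
  imports Defs "HOL-Combinatorics.Cycles"
begin

text \<open>
  A subgroup of \<open>\<Gamma> = \<Gamma>\<^sub>m(3)\<close> is free iff it is torsion-free, that is, iff \<open>x\<close> and \<open>y\<close> act on its cosets with
  all cycles of length \<open>2m\<close> and \<open>3m\<close>. For the nontrivial direction one chooses a spanning tree in the graph of groups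
  of the action and lets \<open>\<Gamma>\<close> act on the covering whose group is free on the remaining edges. So
  \<open>f\<^sub>\<lambda>\<close> counts transitive pairs of such permutations up to relabelling. All such pairs can be counted explicitly: the
  number for \<open>6m\<lambda>\<close> points, divided by \<open>(6m\<lambda>)!\<close>, is \<open>a\<^sub>\<lambda> = m^\<lambda> (6\<lambda>)! / (72^\<lambda> (3\<lambda>)! (2\<lambda>)!)\<close>, and splitting off the
  orbit of one point gives \<open>6m\<lambda> a\<^sub>\<lambda> = \<Sum> f\<^sub>i a\<^bsub>\<lambda>-i\<^esub>\<close>. The hypergeometric recurrence of \<open>a\<^sub>\<lambda>\<close> then turns into the
  Riccati equation \<open>f = z (f^2 + 6 m z f' + 6 m f + 5 m^2)\<close> for \<open>f = \<Sum> f\<^sub>\<lambda> z^\<lambda>\<close>, which has a unique power series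
  solution also modulo 64. It remains to check the claimed expression in this equation. Since \<open>g(z)^2 = g(z^2)\<close>
  modulo 2 for every integer power series \<open>g\<close> and \<open>\<Phi>(z^2) = \<Phi>(z) - z\<close>, there are power series \<open>H\<close> and \<open>K\<close> with
  \<open>\<Phi>^2 = \<Phi> - z + 2 H\<close> and \<open>H^2 = H - z \<Phi> + z^2 + 2 K\<close>, and these two relations suffice.
\<close>

section \<open>Words acting on sets\<close>

text \<open>The tree on which \<Gamma> acts never appears. That a stabiliser is free is shown by two
  explicit maps. Every point \<omega> gets two coset representatives, \<open>tr gx \<omega>\<close>
  and \<open>tr gy \<omega>\<close>, one for each side of the edge through \<omega>; the quotients
  \<open>cross \<omega>\<close> other than 1 form the basis. The homomorphism from the free group
  inserts these elements, and its inverse records the sheet of the covering that is reached.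

  The count is explicit because \<Gamma> amalgamates cyclic groups: an action is a permutation with
  all cycles of length \<open>m\<close> together with a square root and a cube root of it, chosen
  independently. All such permutations are conjugate and so have equally many roots.

  If \<open>A\<close> is the generating function of the \<open>a\<close>, then
  \<open>f = 6 m z A' / A\<close>. Being a logarithmic derivative, \<open>f\<close> inherits a
  Riccati equation from the linear second-order equation of \<open>A\<close>. The final check is
  made for \<open>z (1 + f)\<close>, which clears the terms with \<open>1/z\<close>. That
  \<open>m\<close> is odd enters through \<open>m^2 = 1 + 8 t\<close> in the reduction modulo
  64.\<close>

definition wact :: "('a \<Rightarrow> 'b \<Rightarrow> 'b) \<Rightarrow> ('a \<Rightarrow> 'b \<Rightarrow> 'b) \<Rightarrow> 'a word \<Rightarrow> 'b \<Rightarrow> 'b" where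
  "wact p q w = fold (\<lambda>(a, e). if e then q a else p a) w"

lemma wact_simps [simp]:
  "wact p q [] b = b"
  "wact p q ((a, e) # w) b = wact p q w (if e then q a b else p a b)"
  "wact p q (u @ v) b = wact p q v (wact p q u b)"
  by (auto simp: wact_def)

lemma wact_replicate [simp]: "wact p q (replicate n (a, False)) b = (p a ^^ n) b"
  by (induction n arbitrary: b) (simp_all add: funpow_swap1)

lemma words_Cons [simp]: "(a, e) # w \<in> words S \<longleftrightarrow> a \<in> S \<and> w \<in> words S"
  by (simp add: words_def)

lemma wact_closed:
  assumes "w \<in> words G" "b \<in> S"
    and "\<And>a b. a \<in> G \<Longrightarrow> b \<in> S \<Longrightarrow> p a b \<in> S \<and> q a b \<in> S"
  shows "wact p q w b \<in> S"
  using assms(1,2)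
proof (induction w arbitrary: b)
  case (Cons l w)
  then show ?case using assms(3) by (cases l) auto
qed simp

text \<open>Inverse letters act by a separate map \<open>q\<close>, because \<open>p a\<close> and
  \<open>q a\<close> have to be inverse to each other only on \<open>S\<close>: right
  multiplications are so on the carrier of a group, and the lifted maps of the covering on
  \<open>A \<times> carrier FB\<close>.\<close>

lemma wact_cong:
  assumes "(u, v) \<in> word_cong G R" "b \<in> S"
    and R: "R \<subseteq> words G \<times> words G"
    and pq: "\<And>a b. a \<in> G \<Longrightarrow> b \<in> S \<Longrightarrow> p a b \<in> S \<and> q a b \<in> S \<and> q a (p a b) = b \<and> p a (q a b) = b"
    and rel: "\<And>u v b. (u, v) \<in> R \<Longrightarrow> b \<in> S \<Longrightarrow> wact p q u b = wact p q v b"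
  shows "wact p q u b = wact p q v b"
  using assms(1,2)
proof (induction arbitrary: b rule: word_cong.induct)
  case (append u v u' v')
  have "u \<in> words G"
    using word_cong_words[OF append.hyps(1) R] by simp
  then have "wact p q u b \<in> S"
    by (rule wact_closed) (use append.prems pq in auto)
  then show ?case
    using append.IH append.prems by simp
next
  case (rel u v)
  then show ?case using assms(5) by blast
next
  case (cancel a e)
  then show ?case using pq by (cases e) auto
qed auto

abbreviation cls :: "'a set \<Rightarrow> ('a word \<times> 'a word) set \<Rightarrow> 'a word \<Rightarrow> 'a word set" where
  "cls G R w \<equiv> word_cong G R `` {w}"

lemma cls_eq_iff:
  assumes "R \<subseteq> words G \<times> words G" "u \<in> words G" "v \<in> words G"
  shows "cls G R u = cls G R v \<longleftrightarrow> (u, v) \<in> word_cong G R"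
  using eq_equiv_class_iff[OF equiv_word_cong[OF assms(1)] assms(2,3)] .

lemma carrier_presented_group:
  "carrier (presented_group G R) = cls G R ` words G"
  by (auto simp: presented_group_def quotient_def)

lemma one_presented_group: "\<one>\<^bsub>presented_group G R\<^esub> = cls G R []"
  by (simp add: presented_group_def)

lemma cls_pow:
  assumes R: "R \<subseteq> words G \<times> words G" and w: "w \<in> words G"
  shows "cls G R w [^]\<^bsub>presented_group G R\<^esub> (n::nat) = cls G R (concat (replicate n w))"
proof (induction n)
  case 0
  then show ?case by (simp add: one_presented_group)
next
  case (Suc n)
  have "concat (replicate n w) \<in> words G"
    using w by (induction n) auto
  moreover have "concat (replicate n w) @ w = concat (replicate (Suc n) w)"
    by (induction n) auto
  ultimately show ?case
    using Suc presented_group_mult[OF R _ w] by simp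
qed

text \<open>Von Dyck's theorem. The image of a class is the place to which one of its words takes
  the unit of \<open>K\<close> when letters act by right multiplication; \<open>wact_cong\<close>
  makes this independent of the word.\<close>

lemma presented_group_hom:
  assumes R: "R \<subseteq> words G \<times> words G" and K: "group K"
    and f: "\<And>a. a \<in> G \<Longrightarrow> f a \<in> carrier K"
    and rel: "\<And>u v k. (u, v) \<in> R \<Longrightarrow> k \<in> carrier K \<Longrightarrow>
      wact (\<lambda>a k. k \<otimes>\<^bsub>K\<^esub> f a) (\<lambda>a k. k \<otimes>\<^bsub>K\<^esub> inv\<^bsub>K\<^esub> f a) u k = wact (\<lambda>a k. k \<otimes>\<^bsub>K\<^esub> f a) (\<lambda>a k. k \<otimes>\<^bsub>K\<^esub> inv\<^bsub>K\<^esub> f a) v k"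
  obtains h where "h \<in> hom (presented_group G R) K" "\<And>a. a \<in> G \<Longrightarrow> h (cls G R [(a, False)]) = f a"
proof -
  interpret K: group K by fact
  let ?act = "wact (\<lambda>a k. k \<otimes>\<^bsub>K\<^esub> f a) (\<lambda>a k. k \<otimes>\<^bsub>K\<^esub> inv\<^bsub>K\<^esub> f a)"
  define h where "h A = ?act (SOME w. w \<in> A) \<one>\<^bsub>K\<^esub>" for A
  have act_eq: "?act u k = ?act v k" if "(u, v) \<in> word_cong G R" "k \<in> carrier K" for u v k
  proof (rule wact_cong[OF that R])
    show "?act u k = ?act v k" if "(u, v) \<in> R" "k \<in> carrier K" for u v k
      using that by (rule rel)
  qed (use f in \<open>auto simp: K.m_assoc\<close>)
  \<comment> \<open>Left and right multiplications commute, so the effect of a word on any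
    \<open>k\<close> is read off at the unit.\<close>
  have act_mult: "?act w k \<in> carrier K \<and> ?act w k = k \<otimes>\<^bsub>K\<^esub> ?act w \<one>\<^bsub>K\<^esub>"
    if "w \<in> words G" "k \<in> carrier K" for w k
    using that
  proof (induction w arbitrary: k)
    case (Cons l w)
    obtain a e where l: "l = (a, e)" by (cases l)
    have a: "a \<in> G" "w \<in> words G" "f a \<in> carrier K" using Cons.prems f by (auto simp: l)
    show ?case
    proof (cases e)
      case True
      have "?act w (inv\<^bsub>K\<^esub> f a) = inv\<^bsub>K\<^esub> f a \<otimes>\<^bsub>K\<^esub> ?act w \<one>\<^bsub>K\<^esub>"
        "?act w (k \<otimes>\<^bsub>K\<^esub> inv\<^bsub>K\<^esub> f a) = (k \<otimes>\<^bsub>K\<^esub> inv\<^bsub>K\<^esub> f a) \<otimes>\<^bsub>K\<^esub> ?act w \<one>\<^bsub>K\<^esub>" "?act w \<one>\<^bsub>K\<^esub> \<in> carrier K"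
        using Cons.IH[of "inv\<^bsub>K\<^esub> f a"] Cons.IH[of "k \<otimes>\<^bsub>K\<^esub> inv\<^bsub>K\<^esub> f a"] Cons.IH[of "\<one>\<^bsub>K\<^esub>"] a Cons.prems by auto
      then show ?thesis using True a Cons.prems by (simp add: l K.m_assoc)
    next
      case False
      have "?act w (f a) = f a \<otimes>\<^bsub>K\<^esub> ?act w \<one>\<^bsub>K\<^esub>"
        "?act w (k \<otimes>\<^bsub>K\<^esub> f a) = (k \<otimes>\<^bsub>K\<^esub> f a) \<otimes>\<^bsub>K\<^esub> ?act w \<one>\<^bsub>K\<^esub>" "?act w \<one>\<^bsub>K\<^esub> \<in> carrier K"
        using Cons.IH[of "f a"] Cons.IH[of "k \<otimes>\<^bsub>K\<^esub> f a"] Cons.IH[of "\<one>\<^bsub>K\<^esub>"] a Cons.prems by auto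
      then show ?thesis using False a Cons.prems by (simp add: l K.m_assoc)
    qed
  qed simp
  have h_cls: "h (cls G R w) = ?act w \<one>\<^bsub>K\<^esub>" if "w \<in> words G" for w
  proof -
    have "w \<in> cls G R w" using that by (auto intro: word_cong.refl)
    then have "(SOME v. v \<in> cls G R w) \<in> cls G R w" by (rule someI)
    then have "(w, SOME v. v \<in> cls G R w) \<in> word_cong G R" by simp
    from act_eq[OF this] show ?thesis by (simp add: h_def)
  qed
  show ?thesis
  proof (rule that)
    show "h (cls G R [(a, False)]) = f a" if "a \<in> G" for a
      using that f by (simp add: h_cls)
    show "h \<in> hom (presented_group G R) K"
    proof (rule homI)
      fix x assume "x \<in> carrier (presented_group G R)"
      then show "h x \<in> carrier K"
        using act_mult[THEN conjunct1] by (auto simp: carrier_presented_group h_cls)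
    next
      fix x y assume "x \<in> carrier (presented_group G R)" "y \<in> carrier (presented_group G R)"
      then obtain u v where xy: "x = cls G R u" "y = cls G R v" "u \<in> words G" "v \<in> words G"
        by (auto simp: carrier_presented_group)
      have "?act v (?act u \<one>\<^bsub>K\<^esub>) = ?act u \<one>\<^bsub>K\<^esub> \<otimes>\<^bsub>K\<^esub> ?act v \<one>\<^bsub>K\<^esub>"
        using act_mult[OF xy(3) K.one_closed] act_mult[OF xy(4)] by blast
      then show "h (x \<otimes>\<^bsub>presented_group G R\<^esub> y) = h x \<otimes>\<^bsub>K\<^esub> h y"
        by (simp add: presented_group_mult[OF R] h_cls xy)
    qed
  qed
qed

section \<open>Free groups are torsion-free\<close>

definition flip :: "'a \<times> bool \<Rightarrow> 'a \<times> bool" where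
  "flip l = (fst l, \<not> snd l)"

lemma flip_flip [simp]: "flip (flip l) = l" "flip l \<noteq> l" "l \<noteq> flip l"
  by (auto simp: flip_def prod_eq_iff)

definition reduced :: "'a word \<Rightarrow> bool" where
  "reduced = successively (\<lambda>l l'. l' \<noteq> flip l)"

text \<open>The stack of a word holds its free reduction in reversed order.\<close>

fun push :: "'a \<times> bool \<Rightarrow> 'a word \<Rightarrow> 'a word" where
  "push l [] = [l]"
| "push l (l' # st) = (if l' = flip l then st else l # l' # st)"

lemma reduced_push: "reduced st \<Longrightarrow> reduced (push l st)"
  by (cases st; cases "tl st") (auto simp: reduced_def)

lemma push_push_flip: "reduced st \<Longrightarrow> push (flip l) (push l st) = st"
  by (cases st; cases "tl st") (auto simp: reduced_def)

lemma fold_push_reduced: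
  assumes "reduced (rev w @ st)"
  shows "fold push w st = rev w @ st"
  using assms
proof (induction w arbitrary: st)
  case (Cons l w)
  have "push l st = l # st"
  proof (cases st)
    case (Cons l' st')
    have "l' \<noteq> flip l"
      using \<open>reduced (rev (l # w) @ st)\<close> by (simp add: Cons reduced_def successively_append_iff)
    then show ?thesis by (simp add: Cons)
  qed simp
  then show ?case using Cons by simp
qed simp

lemma reduced_rev: "reduced (rev w) \<longleftrightarrow> reduced w"
proof -
  have "(l' \<noteq> flip l) = (l \<noteq> flip l')" for l l' :: "'a \<times> bool"
    by (metis flip_flip(1))
  then show ?thesis
    by (simp add: reduced_def)
qed

text \<open>Van der Waerden's argument: \<open>push\<close> lets the letters act as permutations of
  the reduced stacks. Congruent words then take the empty stack to the same stack, while a reduced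
  word takes it to its own reversal.\<close>

lemma reduced_eq_Nil:
  assumes "(w, []) \<in> word_cong X {}" "reduced w"
  shows "w = []"
proof -
  let ?p = "\<lambda>a. push (a, False)" and ?q = "\<lambda>a. push (a, True)"
  have wact: "wact ?p ?q v st = fold push v st" for v st
    unfolding wact_def by (rule fold_cong) auto
  have "wact ?p ?q w [] = wact ?p ?q [] []"
  proof (rule wact_cong[OF assms(1), where S = "{st. reduced st}"])
    fix a :: 'a and st :: "'a word" assume "st \<in> {st. reduced st}"
    then show "?p a st \<in> {st. reduced st} \<and> ?q a st \<in> {st. reduced st} \<and> ?q a (?p a st) = st \<and> ?p a (?q a st) = st"
      using push_push_flip[of st "(a, False)"] push_push_flip[of st "(a, True)"]
      by (simp add: reduced_push flip_def)
  qed (auto simp: reduced_def)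
  then show ?thesis
    using fold_push_reduced[of w "[]"] assms(2) by (simp add: wact reduced_rev)
qed

lemma not_reduced_split:
  assumes "\<not> reduced w"
  obtains u l v where "w = u @ [l, flip l] @ v"
  using assms
proof (induction w arbitrary: thesis)
  case (Cons l w)
  show ?case
  proof (cases "reduced w")
    case True
    then obtain v where "w = flip l # v"
      using Cons.prems(2) by (cases w) (auto simp: reduced_def)
    then show ?thesis using Cons.prems(1)[of "[]"] by simp
  next
    case False
    then obtain u l' v where "w = u @ [l', flip l'] @ v" using Cons.IH by blast
    then show ?thesis using Cons.prems(1)[of "l # u"] by simp
  qed
qed (simp add: reduced_def)

lemma reduced_concat_replicate:
  assumes "reduced w" "w \<noteq> []" "hd w \<noteq> flip (last w)"
  shows "reduced (concat (replicate n w))"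
proof (induction n)
  case (Suc n)
  then show ?case
    using assms by (cases n) (auto simp: reduced_def successively_append_iff)
qed (simp add: reduced_def)

lemma word_cong_cancel_flip:
  assumes "fst l \<in> X"
  shows "([l, flip l], []) \<in> word_cong X R"
  using word_cong.cancel[OF assms, of "snd l"] by (simp add: flip_def)

text \<open>Induction on the length. A word that is not reduced can be shortened, and a reduced word
  whose ends are inverse to each other is conjugate to a shorter one. Any other nonempty word has
  reduced, hence nontrivial, powers.\<close>

lemma free_group_torsion_free:
  assumes w: "w \<in> words X" and n: "n > 0" and tor: "(concat (replicate n w), []) \<in> word_cong X {}"
  shows "(w, []) \<in> word_cong X {}"
  using w tor
proof (induction w rule: length_induct)
  case (1 w)
  let ?C = "word_cong X {} :: ('a word \<times> 'a word) set"
  note ra = word_cong.append[OF word_cong.refl]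
  note ar = word_cong.append[OF _ word_cong.refl]
  have pow: "(concat (replicate k u), concat (replicate k v)) \<in> ?C" if "(u, v) \<in> ?C" for u v k
    using that by (induction k) (auto intro: word_cong.refl word_cong.append)
  have pow_words: "concat (replicate k u) \<in> words X" if "u \<in> words X" for u k
    using that by (induction k) auto
  show ?case
  proof (cases "reduced w")
    case False
    then obtain u l v where uv: "w = u @ [l, flip l] @ v" by (rule not_reduced_split)
    have words: "u \<in> words X" "v \<in> words X" "fst l \<in> X"
      using 1(2) by (cases l; auto simp: uv flip_def)+
    have c: "(w, u @ [] @ v) \<in> ?C"
      unfolding uv using words by (intro word_cong.append word_cong.refl word_cong_cancel_flip)
    have "(u @ v, []) \<in> ?C"
    proof (rule 1(1)[rule_format])
      show "length (u @ v) < length w" by (simp add: uv)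
      show "u @ v \<in> words X" using words by simp
      show "(concat (replicate n (u @ v)), []) \<in> ?C"
        using word_cong.trans[OF word_cong.sym[OF pow[OF c]] 1(3)] by simp
    qed
    with c show ?thesis by (simp add: word_cong.trans)
  next
    case red: True
    show ?thesis
    proof (cases "w = []")
      case False
      have "hd w = flip (last w)"
      proof (rule ccontr)
        assume "hd w \<noteq> flip (last w)"
        then have "reduced (concat (replicate n w))" using red False by (intro reduced_concat_replicate)
        then have "concat (replicate n w) = []" using 1(3) reduced_eq_Nil by blast
        then show False using False n by simp
      qed
      then obtain l v where w: "w = flip l # v @ [l]"
        using False by (cases w; cases "tl w" rule: rev_cases) auto
      have words: "v \<in> words X" "fst l \<in> X"
        using 1(2) by (cases l; auto simp: w flip_def)+
      then have lw: "[l] \<in> words X" "[flip l] \<in> words X" by (cases l; auto simp: flip_def)+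
      \<comment> \<open>Conjugation by \<open>l\<close> telescopes only up to the pairs
        \<open>l\<close>, \<open>flip l\<close> between the factors; \<open>vll\<close> removes
        them.\<close>
      have shift: "concat (replicate k w) @ [flip l] = flip l # concat (replicate k (v @ [l] @ [flip l]))" for k
        by (induction k) (auto simp: w)
      have vll: "(v @ [l] @ [flip l], v) \<in> ?C"
        using word_cong.append[OF word_cong.refl[OF words(1)] word_cong_cancel_flip[OF words(2)], of "{}"] by simp
      have "([flip l] @ concat (replicate n v), [flip l] @ concat (replicate n (v @ [l] @ [flip l]))) \<in> ?C"
        by (rule ra[OF lw(2) word_cong.sym[OF pow[OF vll]]])
      then have "([flip l] @ concat (replicate n v), concat (replicate n w) @ [flip l]) \<in> ?C"
        by (simp only: shift append.simps)
      moreover have "(concat (replicate n w) @ [flip l], [] @ [flip l]) \<in> ?C"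
        by (rule ar[OF 1(3) lw(2)])
      ultimately have "([flip l] @ concat (replicate n v), [flip l]) \<in> ?C"
        by (metis append_Nil word_cong.trans)
      then have a: "([l] @ [flip l] @ concat (replicate n v), [l] @ [flip l]) \<in> ?C"
        by (rule ra[OF lw(1)])
      have b: "([l, flip l] @ concat (replicate n v), [] @ concat (replicate n v)) \<in> ?C"
        using words pow_words by (intro word_cong.append word_cong_cancel_flip word_cong.refl)
      have c: "([l, flip l], []) \<in> ?C" using words by (intro word_cong_cancel_flip)
      have "(concat (replicate n v), []) \<in> ?C"
        using a b c by (metis append_Cons append_Nil word_cong.trans word_cong.sym)
      then have "(v, []) \<in> ?C"
        using 1(1)[rule_format, of v] words(1) by (simp add: w)
      then have "([flip l] @ v @ [l], [flip l] @ [] @ [l]) \<in> ?C"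
        by (rule ra[OF lw(2) ar[OF _ lw(1)]])
      moreover have "([flip l, flip (flip l)], []) \<in> ?C"
        using words by (intro word_cong_cancel_flip) (simp add: flip_def)
      ultimately show ?thesis
        by (simp add: w word_cong.trans)
    qed (simp add: word_cong.refl)
  qed
qed

section \<open>Right actions of a presented group\<close>

locale word_action =
  fixes G :: "'a set" and R :: "('a word \<times> 'a word) set" and S :: "'b set"
    and p q :: "'a \<Rightarrow> 'b \<Rightarrow> 'b"
  assumes R: "R \<subseteq> words G \<times> words G"
    and pq: "a \<in> G \<Longrightarrow> b \<in> S \<Longrightarrow> p a b \<in> S \<and> q a b \<in> S \<and> q a (p a b) = b \<and> p a (q a b) = b"
    and rel: "(u, v) \<in> R \<Longrightarrow> b \<in> S \<Longrightarrow> wact p q u b = wact p q v b"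
begin

definition ea :: "'a word set \<Rightarrow> 'b \<Rightarrow> 'b" where
  "ea g = wact p q (SOME w. w \<in> g)"

abbreviation "PG \<equiv> presented_group G R"

lemma wact_S: "w \<in> words G \<Longrightarrow> b \<in> S \<Longrightarrow> wact p q w b \<in> S"
  by (rule wact_closed) (use pq in auto)

lemma ea_cls:
  assumes "w \<in> words G" "b \<in> S"
  shows "ea (cls G R w) b = wact p q w b"
proof -
  have "w \<in> cls G R w" using assms by (auto intro: word_cong.refl)
  then have "(SOME v. v \<in> cls G R w) \<in> cls G R w" by (rule someI)
  then have "(w, SOME v. v \<in> cls G R w) \<in> word_cong G R" by simp
  then have "wact p q w b = wact p q (SOME v. v \<in> cls G R w) b"
    by (rule wact_cong[OF _ assms(2) R]) (use pq rel in blast)+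
  then show ?thesis by (simp add: ea_def)
qed

lemma ea_closed: "g \<in> carrier PG \<Longrightarrow> b \<in> S \<Longrightarrow> ea g b \<in> S"
  by (auto simp: carrier_presented_group ea_cls wact_S)

lemma ea_mult:
  "g \<in> carrier PG \<Longrightarrow> h \<in> carrier PG \<Longrightarrow> b \<in> S \<Longrightarrow> ea (g \<otimes>\<^bsub>PG\<^esub> h) b = ea h (ea g b)"
  by (auto simp: carrier_presented_group presented_group_mult[OF R] ea_cls wact_S)

lemma ea_one: "b \<in> S \<Longrightarrow> ea \<one>\<^bsub>PG\<^esub> b = b"
  by (simp add: one_presented_group ea_cls)

lemma ea_inv:
  assumes "g \<in> carrier PG" "b \<in> S"
  shows "ea (inv\<^bsub>PG\<^esub> g) (ea g b) = b"
proof -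
  interpret PG: group PG by (rule group_presented_group[OF R])
  show ?thesis using ea_mult[of g "inv\<^bsub>PG\<^esub> g" b] assms by (simp add: ea_one)
qed

end

lemma presented_group_hom_unique:
  assumes R: "R \<subseteq> words G \<times> words G" and K: "group K"
    and h: "h \<in> hom (presented_group G R) K" "h' \<in> hom (presented_group G R) K"
    and gens: "\<And>a. a \<in> G \<Longrightarrow> h (cls G R [(a, False)]) = h' (cls G R [(a, False)])"
    and g: "g \<in> carrier (presented_group G R)"
  shows "h g = h' g"
proof -
  let ?G = "presented_group G R"
  interpret K: group K by fact
  interpret G: group ?G by (rule group_presented_group[OF R])
  interpret h: group_hom ?G K h by unfold_locales fact
  interpret h': group_hom ?G K h' by unfold_locales fact
  have cl: "cls G R w \<in> carrier ?G" if "w \<in> words G" for w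
    using that by (auto simp: carrier_presented_group)
  have neg: "cls G R [(a, True)] = inv\<^bsub>?G\<^esub> cls G R [(a, False)]" if "a \<in> G" for a
  proof (rule G.inv_equality[symmetric])
    have "([(a, True), (a, False)], []) \<in> word_cong G R"
      using word_cong.cancel[OF that, of True] by simp
    then show "cls G R [(a, True)] \<otimes>\<^bsub>?G\<^esub> cls G R [(a, False)] = \<one>\<^bsub>?G\<^esub>"
      using that R by (simp add: presented_group_mult one_presented_group cls_eq_iff)
  qed (use that cl in auto)
  have "h (cls G R w) = h' (cls G R w)" if "w \<in> words G" for w
    using that
  proof (induction w)
    case Nil
    then show ?case using h.hom_one h'.hom_one by (simp add: one_presented_group)
  next
    case (Cons l w)
    obtain a e where l: "l = (a, e)" by (cases l)
    have a: "a \<in> G" "w \<in> words G" using Cons.prems by (auto simp: l)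
    have "h (cls G R [l]) = h' (cls G R [l])"
    proof (cases e)
      case True
      then show ?thesis using a cl[of "[(a, False)]"] by (simp add: l neg gens)
    qed (use gens a in \<open>simp add: l\<close>)
    moreover have "cls G R (l # w) = cls G R [l] \<otimes>\<^bsub>?G\<^esub> cls G R w"
      using a R by (simp add: l presented_group_mult)
    ultimately show ?case
      using Cons.IH a cl by (simp add: l)
  qed
  then show ?thesis using g by (auto simp: carrier_presented_group)
qed

section \<open>The orders of the generators of \<Gamma>\<close>

lemma words_UNIV [simp]: "words UNIV = UNIV"
  by (auto simp: words_def)

definition gord :: "nat \<Rightarrow> gen \<Rightarrow> nat" where
  "gord m a = (case a of gx \<Rightarrow> 2 * m | gy \<Rightarrow> 3 * m)"

abbreviation gcls :: "nat \<Rightarrow> gen word \<Rightarrow> gen word set" where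
  "gcls m w \<equiv> cls UNIV (Gamma3_relations m) w"

abbreviation ge :: "nat \<Rightarrow> gen \<Rightarrow> gen word set" where
  "ge m a \<equiv> gcls m [(a, False)]"

lemma gcls_eqI: "(u, v) \<in> Gamma3_relations m \<Longrightarrow> gcls m u = gcls m v"
  by (simp add: cls_eq_iff word_cong.rel)

lemma gcls_mult: "gcls m u \<otimes>\<^bsub>Gamma3 m\<^esub> gcls m v = gcls m (u @ v)"
  by (simp add: Gamma3_def presented_group_mult)

lemma carrier_Gamma3: "carrier (Gamma3 m) = range (gcls m)"
  by (simp add: Gamma3_def carrier_presented_group)

lemma one_Gamma3: "\<one>\<^bsub>Gamma3 m\<^esub> = gcls m []"
  by (simp add: Gamma3_def one_presented_group)

lemma concat_replicate_singleton [simp]: "concat (replicate n [a]) = replicate n a"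
  by (induction n) auto

lemma ge_pow: "ge m a [^]\<^bsub>Gamma3 m\<^esub> (n::nat) = gcls m (gen_power a n)"
  by (simp add: Gamma3_def cls_pow)

lemma ge_pow_gord: "ge m a [^]\<^bsub>Gamma3 m\<^esub> gord m a = \<one>\<^bsub>Gamma3 m\<^esub>"
  unfolding ge_pow one_Gamma3
  by (rule gcls_eqI) (auto simp: Gamma3_relations_def gord_def split: gen.split)

lemma ge_square_cube: "ge m gx [^]\<^bsub>Gamma3 m\<^esub> (2::nat) = ge m gy [^]\<^bsub>Gamma3 m\<^esub> (3::nat)"
  unfolding ge_pow by (rule gcls_eqI) (auto simp: Gamma3_relations_def)

lemma ge_pow_eq_one_iff:
  assumes "m > 0"
  shows "ge m a [^]\<^bsub>Gamma3 m\<^esub> (n::nat) = \<one>\<^bsub>Gamma3 m\<^esub> \<longleftrightarrow> gord m a dvd n"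
proof
  interpret group "Gamma3 m" by (rule group_Gamma3)
  assume "gord m a dvd n"
  then obtain k where "n = gord m a * k" ..
  then show "ge m a [^]\<^bsub>Gamma3 m\<^esub> n = \<one>\<^bsub>Gamma3 m\<^esub>"
    using nat_pow_pow[of "ge m a" "gord m a" k] by (simp add: ge_pow_gord carrier_Gamma3)
next
  txt \<open>The orders are read off in the quotient \<open>\<int>/6m\<close>, where \<open>x\<close> is 3 and \<open>y\<close> is 2.\<close>
  define wt :: "gen \<Rightarrow> int" where "wt a = (case a of gx \<Rightarrow> 3 | gy \<Rightarrow> 2)" for a
  define p where "p a b = (b + wt a) mod (6 * int m)" for a b
  define q where "q a b = (b - wt a) mod (6 * int m)" for a b
  have pow: "(p a ^^ k) b = (b + int k * wt a) mod (6 * int m)" if "b \<in> {0..<6 * int m}" for a b k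
    using that by (induction k) (auto simp: p_def mod_simps algebra_simps)
  interpret word_action UNIV "Gamma3_relations m" "{0..<6 * int m}" p q
  proof
    fix u v b assume "(u, v) \<in> Gamma3_relations m" "b \<in> {0..<6 * int m}"
    then show "wact p q u b = wact p q v b"
      by (auto simp: Gamma3_relations_def pow wt_def)
  qed (use assms in \<open>auto simp: p_def q_def mod_simps\<close>)
  assume *: "ge m a [^]\<^bsub>Gamma3 m\<^esub> n = \<one>\<^bsub>Gamma3 m\<^esub>"
  have "gcls m (gen_power a n) = gcls m []"
    using * unfolding ge_pow one_Gamma3 .
  then have "wact p q (gen_power a n) 0 = wact p q [] 0"
    using assms by (metis ea_cls UNIV_I words_UNIV atLeastLessThan_iff order.refl of_nat_0_less_iff zero_less_mult_iff zero_less_numeral)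
  then have "(int n * wt a) mod (6 * int m) = 0"
    using assms by (simp add: pow)
  then have "6 * int m dvd int n * wt a" by auto
  then have "int (gord m a) dvd int n"
    by (cases a) (auto simp: gord_def wt_def algebra_simps elim!: dvdE)
  then show "gord m a dvd n" by simp
qed

section \<open>Actions on a finite set and the graph of groups\<close>

abbreviation iv :: "('a \<Rightarrow> 'b) \<Rightarrow> 'b \<Rightarrow> 'a" where
  "iv \<equiv> inv_into UNIV"

primrec oth :: "gen \<Rightarrow> gen" where
  "oth gx = gy"
| "oth gy = gx"

lemma oth_oth [simp]: "oth (oth a) = a" "oth a \<noteq> a" "a \<noteq> oth a"
  by (cases a; simp)+

lemma neq_oth: "a \<noteq> b \<longleftrightarrow> b = oth a"
  by (cases a; cases b) auto

text \<open>A pointed transitive action whose point stabilisers meet the cyclic subgroups of both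
  generators trivially: by \<open>semireg\<close> every cycle of \<open>p a\<close> has length
  \<open>gord m a\<close>, the order of \<open>a\<close> in \<open>Gamma3 m\<close>.\<close>

locale gamma_action =
  fixes m :: nat and A :: "'b set" and p :: "gen \<Rightarrow> 'b \<Rightarrow> 'b" and w0 :: 'b
  assumes m: "m > 0"
    and perm: "p a permutes A"
    and semireg: "\<omega> \<in> A \<Longrightarrow> (p a ^^ i) \<omega> = \<omega> \<longleftrightarrow> gord m a dvd i"
    and square_cube: "\<omega> \<in> A \<Longrightarrow> (p gx ^^ 2) \<omega> = (p gy ^^ 3) \<omega>"
    and w0: "w0 \<in> A"
    and transitive: "\<omega> \<in> A \<Longrightarrow> \<exists>w. wact p (\<lambda>a. iv (p a)) w w0 = \<omega>"
begin

abbreviation "\<Gamma> \<equiv> Gamma3 m"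

sublocale group \<Gamma> by (rule group_Gamma3)

sublocale word_action UNIV "Gamma3_relations m" A p "\<lambda>a. iv (p a)"
proof
  fix u v \<omega> assume "(u, v) \<in> Gamma3_relations m" "\<omega> \<in> A"
  then show "wact p (\<lambda>a. iv (p a)) u \<omega> = wact p (\<lambda>a. iv (p a)) v \<omega>"
    using semireg[where a = gx and i = "2 * m" and \<omega> = \<omega>] semireg[where a = gy and i = "3 * m" and \<omega> = \<omega>] square_cube[of \<omega>]
    by (auto simp: Gamma3_relations_def gord_def simp del: funpow.simps wact_replicate
      simp flip: wact_replicate[of p "\<lambda>a. iv (p a)"])
qed (use permutes_inverses[OF perm] permutes_in_image[OF perm] permutes_in_image[OF permutes_inv[OF perm]] in auto)

lemma gord_pos: "gord m a > 0"
  using m by (cases a) (auto simp: gord_def)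

lemma p_in [simp]: "p a \<omega> \<in> A \<longleftrightarrow> \<omega> \<in> A"
  using perm permutes_in_image by metis

lemma pow_in [simp]: "(p a ^^ i) \<omega> \<in> A \<longleftrightarrow> \<omega> \<in> A"
  by (induction i) auto

lemma pow_gord: "\<omega> \<in> A \<Longrightarrow> (p a ^^ gord m a) \<omega> = \<omega>"
  using semireg by auto

text \<open>By semiregularity the cyclic group of \<open>a\<close> acts freely on each of its
  orbits. Hence the powers with exponent \<open>ix\<close>, which is chosen arbitrarily, are
  well-defined elements of \<Gamma>.\<close>

lemma pow_eq_cong:
  assumes "\<omega> \<in> A" "(p a ^^ i) \<omega> = (p a ^^ j) \<omega>"
  shows "ge m a [^]\<^bsub>\<Gamma>\<^esub> i = ge m a [^]\<^bsub>\<Gamma>\<^esub> j"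
  using assms(2)
proof (induction i j rule: linorder_wlog)
  case (le i j)
  have "(p a ^^ i) ((p a ^^ (j - i)) \<omega>) = (p a ^^ i) \<omega>"
    using le by (metis comp_apply funpow_add le_add_diff_inverse)
  moreover have "inj (p a ^^ i)"
    using permutes_inj[OF perm] by (rule inj_fn)
  ultimately have "(p a ^^ (j - i)) \<omega> = \<omega>"
    by (simp add: inj_eq)
  then have "gord m a dvd j - i" using semireg assms(1) by simp
  then have "ge m a [^]\<^bsub>\<Gamma>\<^esub> (j - i) = \<one>\<^bsub>\<Gamma>\<^esub>"
    using ge_pow_eq_one_iff[OF m] by simp
  then show ?case
    using nat_pow_mult[of "ge m a" i "j - i"] le by (simp add: carrier_Gamma3 ge_pow gcls_mult one_Gamma3)
qed simp

definition orb :: "gen \<Rightarrow> 'b \<Rightarrow> 'b set" where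
  "orb a \<omega> = range (\<lambda>i. (p a ^^ i) \<omega>)"

lemma orb_self: "\<omega> \<in> orb a \<omega>"
  by (auto simp: orb_def intro: range_eqI[where x = 0])

lemma orb_p [simp]:
  assumes "\<omega> \<in> A"
  shows "orb a (p a \<omega>) = orb a \<omega>"
proof
  show "orb a (p a \<omega>) \<subseteq> orb a \<omega>"
    by (auto simp: orb_def simp flip: funpow_swap1 intro: range_eqI[where x = "Suc _"])
  show "orb a \<omega> \<subseteq> orb a (p a \<omega>)"
  proof
    fix \<omega>' assume "\<omega>' \<in> orb a \<omega>"
    then obtain i where "\<omega>' = (p a ^^ i) \<omega>" by (auto simp: orb_def)
    \<comment> \<open>The full cycle brings \<omega> back, so \<open>gord m a - 1\<close> further
      steps forward undo one step.\<close>
    then have "\<omega>' = (p a ^^ i) ((p a ^^ Suc (gord m a - 1)) \<omega>)"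
      using gord_pos[of a] by (simp add: pow_gord assms del: funpow.simps)
    then have "\<omega>' = (p a ^^ (i + (gord m a - 1))) (p a \<omega>)"
      by (simp add: funpow_add funpow_swap1)
    then show "\<omega>' \<in> orb a (p a \<omega>)" by (auto simp: orb_def)
  qed
qed

lemma orb_eq: "\<omega> \<in> A \<Longrightarrow> \<omega>' \<in> orb a \<omega> \<Longrightarrow> orb a \<omega>' = orb a \<omega>"
proof -
  have "orb a ((p a ^^ i) \<omega>) = orb a \<omega>" if "\<omega> \<in> A" for i
    using that by (induction i) auto
  then show "\<omega> \<in> A \<Longrightarrow> \<omega>' \<in> orb a \<omega> \<Longrightarrow> orb a \<omega>' = orb a \<omega>"
    by (auto simp: orb_def)
qed

lemma orb_in: "\<omega> \<in> A \<Longrightarrow> \<omega>' \<in> orb a \<omega> \<Longrightarrow> \<omega>' \<in> A"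
  by (auto simp: orb_def)

definition ix :: "gen \<Rightarrow> 'b \<Rightarrow> 'b \<Rightarrow> nat" where
  "ix a \<omega> \<omega>' = (SOME i. (p a ^^ i) \<omega> = \<omega>')"

lemma ix: "\<omega>' \<in> orb a \<omega> \<Longrightarrow> (p a ^^ ix a \<omega> \<omega>') \<omega> = \<omega>'"
  unfolding ix_def orb_def by (rule someI_ex) auto

text \<open>
  The graph of groups: the vertices are the orbits of the two generators, and two of them are
  joined if they meet.
\<close>

definition edges :: "((gen \<times> 'b set) \<times> (gen \<times> 'b set)) set" where
  "edges = {((a, orb a \<omega>), (oth a, orb (oth a) \<omega>)) | a \<omega>. \<omega> \<in> A}"

definition depth :: "gen \<times> 'b set \<Rightarrow> nat" where
  "depth v = (LEAST n. ((gy, orb gy w0), v) \<in> edges ^^ n)"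

text \<open>Connectedness of the graph comes from transitivity: a letter \<open>b\<close> keeps a
  point inside its \<open>b\<close>-orbit, and the orbit of the other generator through the new
  point is adjacent to that one.\<close>

lemma reachable:
  assumes "\<omega> \<in> A"
  shows "((gy, orb gy w0), (a, orb a \<omega>)) \<in> edges\<^sup>*"
proof -
  let ?r = "(gy, orb gy w0)"
  let ?q = "\<lambda>a. iv (p a)"
  have step: "(?r, (oth b, orb (oth b) \<omega>)) \<in> edges\<^sup>*"
    if "(?r, (b, orb b \<omega>)) \<in> edges\<^sup>*" "\<omega> \<in> A" for b \<omega>
    by (rule rtrancl_into_rtrancl[OF that(1)]) (use that(2) in \<open>auto simp: edges_def\<close>)
  have all: "\<forall>a. (?r, (a, orb a \<omega>)) \<in> edges\<^sup>*" if "(?r, (b, orb b \<omega>)) \<in> edges\<^sup>*" "\<omega> \<in> A" for b \<omega>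
  proof
    fix a
    show "(?r, (a, orb a \<omega>)) \<in> edges\<^sup>*"
      using that(1) step[OF that] by (cases "a = b") (simp_all add: neq_oth[of b a, THEN iffD1])
  qed
  have "\<forall>a. (?r, (a, orb a (wact p ?q w w0))) \<in> edges\<^sup>*" for w
  proof (induction w rule: rev_induct)
    case Nil
    show ?case using all[of gy w0] w0 by simp
  next
    case (snoc l w)
    let ?\<omega> = "wact p ?q w w0"
    obtain b e where l: "l = (b, e)" by (cases l)
    have A: "?\<omega> \<in> A" using wact_S w0 by simp
    have in_A: "iv (p b) ?\<omega> \<in> A" using pq A by auto
    have "orb b (iv (p b) ?\<omega>) = orb b ?\<omega>"
      using orb_p[OF in_A, of b] permutes_inverses(1)[OF perm] by simp
    then have "orb b (wact p ?q (w @ [l]) w0) = orb b ?\<omega>"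
      using A by (simp add: l)
    then have "(?r, (b, orb b (wact p ?q (w @ [l]) w0))) \<in> edges\<^sup>*"
      using snoc.IH by simp
    then show ?case
      by (rule all) (use wact_S w0 in simp)
  qed
  then show ?thesis using transitive[OF assms] by metis
qed

text \<open>The last edge of a shortest walk from the root comes from a vertex one level closer to
  it. The point \<omega>' lies in both orbits and is the place where this edge is crossed.\<close>

lemma depth_step:
  assumes "\<omega> \<in> A" "(a, orb a \<omega>) \<noteq> (gy, orb gy w0)"
  shows "\<exists>\<omega>'. \<omega>' \<in> orb a \<omega> \<and> depth (a, orb a \<omega>) = Suc (depth (oth a, orb (oth a) \<omega>'))"
proof -
  let ?r = "(gy, orb gy w0)"
  let ?v = "(a, orb a \<omega>)"
  have "\<exists>n. (?r, ?v) \<in> edges ^^ n"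
    using reachable[OF assms(1)] by (simp add: rtrancl_power)
  then have dv: "(?r, ?v) \<in> edges ^^ depth ?v"
    unfolding depth_def by (rule LeastI_ex)
  with assms(2) obtain n where n: "depth ?v = Suc n" by (cases "depth ?v") auto
  with dv obtain u where u: "(?r, u) \<in> edges ^^ n" "(u, ?v) \<in> edges" by auto
  then obtain \<omega>' where \<omega>': "u = (oth a, orb (oth a) \<omega>')" "orb a \<omega> = orb a \<omega>'"
    by (auto simp: edges_def)
  have "depth u = n"
  proof (rule antisym)
    show "depth u \<le> n" unfolding depth_def by (rule Least_le) (fact u)
    have "(?r, u) \<in> edges ^^ depth u" unfolding depth_def by (rule LeastI) (fact u)
    then have "(?r, ?v) \<in> edges ^^ Suc (depth u)" using u(2) by auto
    then have "depth ?v \<le> Suc (depth u)" unfolding depth_def by (rule Least_le)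
    then show "n \<le> depth u" using n by simp
  qed
  then show ?thesis using \<omega>' n orb_self by metis
qed

lemma depth_root: "depth (gy, orb gy w0) = 0"
  unfolding depth_def by (rule Least_eq_0) simp

text \<open>Choosing \<open>entry\<close> amounts to choosing the spanning tree: the edge through
  this point leads to the parent of the vertex. The root is entered at the base point.\<close>

definition entry :: "gen \<times> 'b set \<Rightarrow> 'b" where
  "entry v = (if v = (gy, orb gy w0) then w0
    else SOME \<omega>. \<omega> \<in> snd v \<and> depth v = Suc (depth (oth (fst v), orb (oth (fst v)) \<omega>)))"

lemma entry:
  assumes "\<omega> \<in> A"
  shows "entry (a, orb a \<omega>) \<in> orb a \<omega>"
    and "(a, orb a \<omega>) \<noteq> (gy, orb gy w0) \<Longrightarrow>
      depth (a, orb a \<omega>) = Suc (depth (oth a, orb (oth a) (entry (a, orb a \<omega>))))"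
proof -
  let ?P = "\<lambda>\<omega>'. \<omega>' \<in> orb a \<omega> \<and> depth (a, orb a \<omega>) = Suc (depth (oth a, orb (oth a) \<omega>'))"
  have *: "?P (entry (a, orb a \<omega>))" if ne: "(a, orb a \<omega>) \<noteq> (gy, orb gy w0)"
  proof -
    have "entry (a, orb a \<omega>) = (SOME \<omega>'. ?P \<omega>')"
      using ne by (simp only: entry_def if_False fst_conv snd_conv)
    then show ?thesis using someI_ex[OF depth_step[OF assms ne]] by simp
  qed
  show "entry (a, orb a \<omega>) \<in> orb a \<omega>"
  proof (cases "(a, orb a \<omega>) = (gy, orb gy w0)")
    case True
    then show ?thesis using orb_self[of w0 gy] by (auto simp: entry_def)
  qed (use * in blast)
  show "(a, orb a \<omega>) \<noteq> (gy, orb gy w0) \<Longrightarrow>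
      depth (a, orb a \<omega>) = Suc (depth (oth a, orb (oth a) (entry (a, orb a \<omega>))))"
    using * by blast
qed

text \<open>The element of \<Gamma> that follows the tree path from \<open>w0\<close> to
  \<open>entry v\<close>. The first argument only bounds the recursion; \<open>tr\<close> supplies
  \<open>depth v\<close>.\<close>

primrec path_elt :: "nat \<Rightarrow> gen \<times> 'b set \<Rightarrow> gen word set" where
  "path_elt 0 v = \<one>\<^bsub>\<Gamma>\<^esub>"
| "path_elt (Suc n) v =
    (let b = oth (fst v); u = (b, orb b (entry v))
     in path_elt n u \<otimes>\<^bsub>\<Gamma>\<^esub> ge m b [^]\<^bsub>\<Gamma>\<^esub> ix b (entry u) (entry v))"

text \<open>Two transversals of the stabiliser of \<open>w0\<close>: follow the tree to the
  \<open>a\<close>-orbit of \<omega>, then move inside this orbit. That \<open>tr a \<omega>\<close>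
  really takes \<open>w0\<close> to \<omega> is \<open>act_tr\<close>.\<close>

definition tr :: "gen \<Rightarrow> 'b \<Rightarrow> gen word set" where
  "tr a \<omega> = (let v = (a, orb a \<omega>) in path_elt (depth v) v \<otimes>\<^bsub>\<Gamma>\<^esub> ge m a [^]\<^bsub>\<Gamma>\<^esub> ix a (entry v) \<omega>)"

lemma ge_closed [simp]: "ge m a \<in> carrier \<Gamma>"
  by (simp add: carrier_Gamma3)

lemma path_elt_closed [simp]: "path_elt n v \<in> carrier \<Gamma>"
  by (induction n arbitrary: v) (auto simp: Let_def)

lemma tr_closed [simp]: "tr a \<omega> \<in> carrier \<Gamma>"
  by (simp add: tr_def Let_def)

lemma orb_sym: "\<omega> \<in> A \<Longrightarrow> \<omega>' \<in> orb a \<omega> \<Longrightarrow> \<omega> \<in> orb a \<omega>'"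
  using orb_eq orb_self by metis

lemma ix_self: "\<omega> \<in> A \<Longrightarrow> ge m a [^]\<^bsub>\<Gamma>\<^esub> ix a \<omega> \<omega> = \<one>\<^bsub>\<Gamma>\<^esub>"
  using pow_eq_cong[where a = a and i = "ix a \<omega> \<omega>" and j = 0] ix[OF orb_self] by simp

lemma tr_w0: "tr gy w0 = \<one>\<^bsub>\<Gamma>\<^esub>"
  using ix_self[OF w0] by (simp add: tr_def depth_root entry_def)

lemma tr_p:
  assumes "\<omega> \<in> A"
  shows "tr a (p a \<omega>) = tr a \<omega> \<otimes>\<^bsub>\<Gamma>\<^esub> ge m a"
proof -
  define v where "v = (a, orb a \<omega>)"
  have e: "entry v \<in> A" "\<omega> \<in> orb a (entry v)" "p a \<omega> \<in> orb a (entry v)"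
    using entry(1)[OF assms, of a] assms orb_in orb_sym orb_eq orb_p orb_self unfolding v_def by metis+
  have "ge m a [^]\<^bsub>\<Gamma>\<^esub> ix a (entry v) (p a \<omega>) = ge m a [^]\<^bsub>\<Gamma>\<^esub> Suc (ix a (entry v) \<omega>)"
    by (rule pow_eq_cong[OF e(1)]) (use e in \<open>simp add: ix\<close>)
  then show ?thesis
    using assms by (simp add: tr_def Let_def v_def m_assoc)
qed

text \<open>The path to a child extends the path to its parent, so the two transversals agree at the
  point where a tree edge is crossed. This is the inductive step in \<open>lift_tr\<close>.\<close>

lemma tr_entry:
  assumes "\<omega> \<in> A" "(a, orb a \<omega>) \<noteq> (gy, orb gy w0)"
  shows "\<exists>\<omega>'\<in>orb a \<omega>. tr a \<omega>' = tr (oth a) \<omega>' \<and> depth (oth a, orb (oth a) \<omega>') < depth (a, orb a \<omega>)"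
proof
  define v where "v = (a, orb a \<omega>)"
  define u where "u = (oth a, orb (oth a) (entry v))"
  have d: "depth v = Suc (depth u)"
    using entry(2)[OF assms] by (simp add: v_def u_def)
  have e: "entry v \<in> orb a \<omega>" "entry v \<in> A"
    using entry(1)[OF assms(1)] orb_in[OF assms(1)] by (auto simp: v_def)
  then have v: "orb a (entry v) = orb a \<omega>" using orb_eq assms(1) by blast
  have "tr a (entry v) = path_elt (depth v) v"
    using e by (simp add: tr_def v ix_self flip: v_def)
  also have "\<dots> = tr (oth a) (entry v)"
    unfolding tr_def Let_def d path_elt.simps using v by (simp add: v_def u_def)
  finally show "tr a (entry v) = tr (oth a) (entry v) \<and> depth (oth a, orb (oth a) (entry v)) < depth (a, orb a \<omega>)"
    using d by (simp add: u_def flip: v_def)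
  show "entry v \<in> orb a \<omega>" by fact
qed

end

section \<open>Subgroups acting freely on the tree are free\<close>

context gamma_action
begin

definition stab :: "gen word set set" where
  "stab = {g \<in> carrier \<Gamma>. ea g w0 = w0}"

lemma PG_eq: "PG = \<Gamma>"
  by (simp add: Gamma3_def)

lemmas act_closed = ea_closed[unfolded PG_eq]
  and act_mult = ea_mult[unfolded PG_eq]
  and act_one = ea_one[unfolded PG_eq]
  and act_inv = ea_inv[unfolded PG_eq]

lemma act_ge: "\<omega> \<in> A \<Longrightarrow> ea (ge m a) \<omega> = p a \<omega>"
  by (simp add: ea_cls)

lemma subgroup_stab: "subgroup stab \<Gamma>"
proof
  show "stab \<subseteq> carrier \<Gamma>" "\<one>\<^bsub>\<Gamma>\<^esub> \<in> stab"
    by (auto simp: stab_def act_one w0)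
  show "g \<otimes>\<^bsub>\<Gamma>\<^esub> h \<in> stab" if "g \<in> stab" "h \<in> stab" for g h
    using that by (auto simp: stab_def act_mult w0)
  show "inv\<^bsub>\<Gamma>\<^esub> g \<in> stab" if "g \<in> stab" for g
    using that act_inv[of g w0] by (auto simp: stab_def w0)
qed

text \<open>The generator that belongs to the edge through \<omega>: out along its
  \<open>y\<close>-side and back along its \<open>x\<close>-side. On tree edges it is
  trivial.\<close>

definition cross :: "'b \<Rightarrow> gen word set" where
  "cross \<omega> = tr gy \<omega> \<otimes>\<^bsub>\<Gamma>\<^esub> inv\<^bsub>\<Gamma>\<^esub> tr gx \<omega>"

text \<open>The basis consists of elements of \<Gamma> instead of edges, since
  \<open>is_free_group\<close> looks for it in the element type. Edges with equal
  \<open>cross\<close> thus share one letter, in agreement with \<alpha>, which depends on \<omega>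
  only through \<open>cross \<omega>\<close>.\<close>

definition basis :: "gen word set set" where
  "basis = cross ` A - {\<one>\<^bsub>\<Gamma>\<^esub>}"

abbreviation "FB \<equiv> free_group_on basis"

lemma group_FB: "group FB"
  by (rule group_presented_group) simp

definition \<alpha> :: "'b \<Rightarrow> gen word set word set" where
  "\<alpha> \<omega> = (if cross \<omega> = \<one>\<^bsub>\<Gamma>\<^esub> then \<one>\<^bsub>FB\<^esub> else cls basis {} [(cross \<omega>, False)])"

lemma cross_closed [simp]: "cross \<omega> \<in> carrier \<Gamma>"
  by (simp add: cross_def)

lemma \<alpha>_closed [simp]:
  assumes "\<omega> \<in> A"
  shows "\<alpha> \<omega> \<in> carrier FB"
proof -
  interpret F: group FB by (rule group_FB)
  show ?thesis
  proof (cases "cross \<omega> = \<one>\<^bsub>\<Gamma>\<^esub>")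
    case False
    then have "[(cross \<omega>, False)] \<in> words basis" using assms by (simp add: basis_def)
    then show ?thesis using False by (simp add: \<alpha>_def carrier_presented_group)
  qed (simp add: \<alpha>_def)
qed

lemma tr_pow: "\<omega> \<in> A \<Longrightarrow> tr a ((p a ^^ i) \<omega>) = tr a \<omega> \<otimes>\<^bsub>\<Gamma>\<^esub> ge m a [^]\<^bsub>\<Gamma>\<^esub> i"
  by (induction i) (simp_all add: tr_p m_assoc)

text \<open>An edge is an orbit of \<open>x^2 = y^3\<close>. Along it both transversals pick up the
  same right factor, which cancels in the quotient.\<close>

lemma cross_square: "\<omega> \<in> A \<Longrightarrow> cross ((p gx ^^ 2) \<omega>) = cross \<omega>"
proof -
  assume \<omega>: "\<omega> \<in> A"
  have "tr gy ((p gx ^^ 2) \<omega>) = tr gy \<omega> \<otimes>\<^bsub>\<Gamma>\<^esub> ge m gx [^]\<^bsub>\<Gamma>\<^esub> (2::nat)"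
    unfolding square_cube[OF \<omega>] tr_pow[OF \<omega>] ge_square_cube ..
  then show ?thesis
    using \<omega> unfolding cross_def tr_pow[OF \<omega>]
    by (simp add: inv_mult_group m_assoc) (simp add: inv_solve_left m_assoc flip: m_assoc)
qed

text \<open>
  The action of \<open>\<Gamma>\<close> on the covering of \<open>A\<close> with group the free group on the edges outside the
  spanning tree; \<open>y\<close> moves along its orbits without changing the sheet.
\<close>

definition lift_p :: "gen \<Rightarrow> 'b \<times> gen word set word set \<Rightarrow> 'b \<times> gen word set word set" where
  "lift_p a = (\<lambda>(\<omega>, f). (p a \<omega>, case a of gx \<Rightarrow> f \<otimes>\<^bsub>FB\<^esub> \<alpha> \<omega> \<otimes>\<^bsub>FB\<^esub> inv\<^bsub>FB\<^esub> \<alpha> (p a \<omega>) | gy \<Rightarrow> f))"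

definition lift_q :: "gen \<Rightarrow> 'b \<times> gen word set word set \<Rightarrow> 'b \<times> gen word set word set" where
  "lift_q a = (\<lambda>(\<omega>, f). (iv (p a) \<omega>, case a of gx \<Rightarrow> f \<otimes>\<^bsub>FB\<^esub> \<alpha> \<omega> \<otimes>\<^bsub>FB\<^esub> inv\<^bsub>FB\<^esub> \<alpha> (iv (p a) \<omega>) | gy \<Rightarrow> f))"

lemma iv_in [simp]: "iv (p a) \<omega> \<in> A \<longleftrightarrow> \<omega> \<in> A"
  using permutes_in_image[OF permutes_inv[OF perm]] .

lemma lift_gy_pow: "(lift_p gy ^^ i) (\<omega>, f) = ((p gy ^^ i) \<omega>, f)"
  by (induction i) (auto simp: lift_p_def)

text \<open>Sheets are labelled as seen from the \<open>y\<close>-side. A move by \<open>x\<close>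
  passes to the \<open>x\<close>-side with \<alpha> and returns with the inverse of \<alpha> at the
  new point, so in a power the inner factors telescope.\<close>

lemma lift_gx_pow:
  assumes "\<omega> \<in> A" "f \<in> carrier FB"
  shows "(lift_p gx ^^ i) (\<omega>, f) = ((p gx ^^ i) \<omega>, f \<otimes>\<^bsub>FB\<^esub> \<alpha> \<omega> \<otimes>\<^bsub>FB\<^esub> inv\<^bsub>FB\<^esub> \<alpha> ((p gx ^^ i) \<omega>))"
proof -
  interpret F: group FB by (rule group_FB)
  show ?thesis
  proof (induction i)
    case (Suc i)
    have "inv\<^bsub>FB\<^esub> \<alpha> ((p gx ^^ i) \<omega>) \<otimes>\<^bsub>FB\<^esub> (\<alpha> ((p gx ^^ i) \<omega>) \<otimes>\<^bsub>FB\<^esub> z) = z" if "z \<in> carrier FB" for z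
      using that assms by (simp flip: F.m_assoc)
    then show ?case
      using Suc assms by (simp add: lift_p_def F.m_assoc)
  qed (use assms in \<open>simp add: F.m_assoc\<close>)
qed

text \<open>The relations survive the lift because \<open>x^2\<close> does not change the sheet
  either: \<alpha> is constant along \<open>x^2\<close> by \<open>cross_square\<close>.\<close>

sublocale lift: word_action UNIV "Gamma3_relations m" "A \<times> carrier FB" lift_p lift_q
proof
  interpret F: group FB by (rule group_FB)
  fix a b assume b: "b \<in> A \<times> carrier FB"
  obtain \<omega> f where b_def: "b = (\<omega>, f)" by (cases b)
  have can: "inv\<^bsub>FB\<^esub> \<alpha> \<omega>' \<otimes>\<^bsub>FB\<^esub> (\<alpha> \<omega>' \<otimes>\<^bsub>FB\<^esub> z) = z" if "z \<in> carrier FB" "\<omega>' \<in> A" for z \<omega>'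
    using that by (simp flip: F.m_assoc)
  show "lift_p a b \<in> A \<times> carrier FB \<and> lift_q a b \<in> A \<times> carrier FB \<and> lift_q a (lift_p a b) = b \<and> lift_p a (lift_q a b) = b"
    using b by (cases a) (simp_all add: b_def lift_p_def lift_q_def permutes_inverses[OF perm] F.m_assoc can)
next
  interpret F: group FB by (rule group_FB)
  fix u v b assume uv: "(u, v) \<in> Gamma3_relations m" and b: "b \<in> A \<times> carrier FB"
  obtain \<omega> f where b_def: "b = (\<omega>, f)" "\<omega> \<in> A" "f \<in> carrier FB" using b by auto
  have x: "(p gx ^^ (2 * m)) \<omega> = \<omega>" and y: "(p gy ^^ (3 * m)) \<omega> = \<omega>"
    using pow_gord[OF b_def(2), of gx] pow_gord[OF b_def(2), of gy] by (simp_all add: gord_def)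
  have "\<alpha> ((p gx ^^ 2) \<omega>) = \<alpha> \<omega>"
    using cross_square[OF b_def(2)] by (simp only: \<alpha>_def)
  then have "(lift_p gx ^^ 2) b = (lift_p gy ^^ 3) b"
    unfolding b_def lift_gx_pow[OF b_def(2,3)] lift_gy_pow using square_cube[OF b_def(2)] b_def(2,3)
    by (simp only: F.m_assoc F.r_inv F.r_one F.inv_closed \<alpha>_closed)
  moreover have "(lift_p gx ^^ (2 * m)) b = b" "(lift_p gy ^^ (3 * m)) b = b"
    unfolding b_def lift_gx_pow[OF b_def(2,3)] lift_gy_pow x y using b_def(2,3)
    by (simp_all add: F.m_assoc)
  ultimately show "wact lift_p lift_q u b = wact lift_p lift_q v b"
    using uv by (auto simp: Gamma3_relations_def simp del: funpow.simps wact_replicate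
      simp flip: wact_replicate[of lift_p lift_q])
qed (auto simp: words_def)

lemmas lift_closed = lift.ea_closed[unfolded PG_eq]
  and lift_mult = lift.ea_mult[unfolded PG_eq]
  and lift_one = lift.ea_one[unfolded PG_eq]
  and lift_inv = lift.ea_inv[unfolded PG_eq]

lemma lift_ge: "\<omega> \<in> A \<Longrightarrow> f \<in> carrier FB \<Longrightarrow> lift.ea (ge m a) (\<omega>, f) = lift_p a (\<omega>, f)"
  by (simp add: lift.ea_cls)

definition shift :: "gen word set word set \<Rightarrow> 'b \<times> gen word set word set \<Rightarrow> 'b \<times> gen word set word set" where
  "shift f' = (\<lambda>(\<omega>, f). (\<omega>, f' \<otimes>\<^bsub>FB\<^esub> f))"

text \<open>Deck transformations multiply the sheet from the left, the lifted generators from the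
  right.\<close>

lemma lift_shift:
  assumes "g \<in> carrier \<Gamma>" "b \<in> A \<times> carrier FB" "f \<in> carrier FB"
  shows "lift.ea g (shift f b) = shift f (lift.ea g b)"
proof -
  interpret F: group FB by (rule group_FB)
  obtain w where w: "g = gcls m w" using assms(1) by (auto simp: carrier_Gamma3)
  have sh: "shift f b \<in> A \<times> carrier FB" if "b \<in> A \<times> carrier FB" for b
    using that assms(3) by (auto simp: shift_def)
  have "wact lift_p lift_q w (shift f b) = shift f (wact lift_p lift_q w b)"
    using assms(2)
  proof (induction w arbitrary: b)
    case (Cons l w)
    obtain a e where l: "l = (a, e)" by (cases l)
    have "lift_p a (shift f b) = shift f (lift_p a b)" "lift_q a (shift f b) = shift f (lift_q a b)"
      using Cons.prems assms(3) by (cases a; auto simp: shift_def lift_p_def lift_q_def F.m_assoc)+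
    then show ?case
      using Cons lift.pq by (auto simp: l)
  qed simp
  then show ?thesis
    using lift.ea_cls assms(2) sh by (simp add: w)
qed

lemma fst_lift:
  assumes "g \<in> carrier \<Gamma>" "\<omega> \<in> A" "f \<in> carrier FB"
  shows "fst (lift.ea g (\<omega>, f)) = ea g \<omega>"
proof -
  obtain w where w: "g = gcls m w" using assms(1) by (auto simp: carrier_Gamma3)
  have "fst (wact lift_p lift_q w b) = wact p (\<lambda>a. iv (p a)) w (fst b)" for b
  proof (induction w arbitrary: b)
    case (Cons l w)
    then show ?case by (cases l; cases b) (auto simp: lift_p_def lift_q_def)
  qed simp
  then show ?thesis
    using lift.ea_cls assms(2,3) by (simp add: w ea_cls)
qed

text \<open>Tree paths never leave the unit sheet, because \<alpha> is 1 wherever they cross an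
  edge. The inverse of \<alpha> in the case \<open>gx\<close> only translates an arrival on the
  \<open>x\<close>-side into the labelling from the \<open>y\<close>-side.\<close>

lemma lift_tr:
  assumes "\<omega> \<in> A"
  shows "lift.ea (tr a \<omega>) (w0, \<one>\<^bsub>FB\<^esub>) = (\<omega>, case a of gx \<Rightarrow> inv\<^bsub>FB\<^esub> \<alpha> \<omega> | gy \<Rightarrow> \<one>\<^bsub>FB\<^esub>)"
  using assms
proof (induction "depth (a, orb a \<omega>)" arbitrary: a \<omega> rule: less_induct)
  case less
  interpret F: group FB by (rule group_FB)
  let ?b = "\<lambda>a \<omega>. (\<omega>, case a of gx \<Rightarrow> inv\<^bsub>FB\<^esub> \<alpha> \<omega> | gy \<Rightarrow> \<one>\<^bsub>FB\<^esub>)"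
  have start: "\<exists>\<omega>'\<in>orb a \<omega>. lift.ea (tr a \<omega>') (w0, \<one>\<^bsub>FB\<^esub>) = ?b a \<omega>'"
  proof (cases "(a, orb a \<omega>) = (gy, orb gy w0)")
    case True
    then show ?thesis
      using w0 orb_self[of w0 gy] by (intro bexI[of _ w0]) (auto simp: tr_w0 lift_one)
  next
    case False
    then obtain \<omega>' where \<omega>': "\<omega>' \<in> orb a \<omega>" "tr a \<omega>' = tr (oth a) \<omega>'"
      "depth (oth a, orb (oth a) \<omega>') < depth (a, orb a \<omega>)"
      using tr_entry less.prems by blast
    have A: "\<omega>' \<in> A" using \<omega>'(1) orb_in less.prems by blast
    have "tr gy \<omega>' = tr gx \<omega>'" using \<omega>'(2) by (cases a) auto
    then have "cross \<omega>' = \<one>\<^bsub>\<Gamma>\<^esub>" by (simp add: cross_def)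
    then have "\<alpha> \<omega>' = \<one>\<^bsub>FB\<^esub>" by (simp add: \<alpha>_def)
    then have "?b (oth a) \<omega>' = ?b a \<omega>'" by (simp split: gen.split)
    then show ?thesis
      using less.hyps[OF \<omega>'(3) A] \<omega>'(1,2) by (intro bexI[of _ \<omega>']) simp_all
  qed
  have step: "lift.ea (tr a (p a \<omega>')) (w0, \<one>\<^bsub>FB\<^esub>) = ?b a (p a \<omega>')"
    if "lift.ea (tr a \<omega>') (w0, \<one>\<^bsub>FB\<^esub>) = ?b a \<omega>'" "\<omega>' \<in> A" for \<omega>'
    using that w0 by (cases a) (simp_all add: tr_p lift_mult lift_ge lift_p_def)
  from start obtain \<omega>' where \<omega>': "\<omega>' \<in> orb a \<omega>" "lift.ea (tr a \<omega>') (w0, \<one>\<^bsub>FB\<^esub>) = ?b a \<omega>'" by blast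
  have A: "\<omega>' \<in> A" using \<omega>'(1) orb_in less.prems by blast
  have "lift.ea (tr a ((p a ^^ i) \<omega>')) (w0, \<one>\<^bsub>FB\<^esub>) = ?b a ((p a ^^ i) \<omega>')" for i
  proof (induction i)
    case (Suc i)
    then show ?case using step[OF Suc] A by (cases a) simp_all
  qed (use \<omega>'(2) in \<open>cases a; simp\<close>)
  then show ?case
    using orb_sym[OF less.prems \<omega>'(1)] by (auto simp: orb_def)
qed

lemma act_tr:
  assumes "\<omega> \<in> A"
  shows "ea (tr a \<omega>) w0 = \<omega>"
proof -
  interpret F: group FB by (rule group_FB)
  show ?thesis using fst_lift[of "tr a \<omega>" w0 "\<one>\<^bsub>FB\<^esub>"] lift_tr[OF assms, of a] w0 by simp
qed

lemma cross_stab: "\<omega> \<in> A \<Longrightarrow> cross \<omega> \<in> stab"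
  using act_inv[of "tr gx \<omega>" w0] w0 by (simp add: stab_def cross_def act_mult act_tr)

text \<open>\<phi> inserts the basis elements into words, and \<psi> reads off the sheet to which an
  element takes \<open>(w0, 1)\<close>. One composition is settled by the equivariant map
  \<open>?E\<close>, the other on the generators of \<open>FB\<close>.\<close>

theorem stab_free: "is_free_group (\<Gamma>\<lparr>carrier := stab\<rparr>)"
proof -
  let ?H = "\<Gamma>\<lparr>carrier := stab\<rparr>"
  interpret F: group FB by (rule group_FB)
  have gH: "group ?H" by (rule subgroup.subgroup_is_group[OF subgroup_stab group_axioms])
  have basis_H: "h \<in> carrier ?H" if "h \<in> basis" for h
    using that cross_stab by (auto simp: basis_def)
  obtain \<phi> where \<phi>: "\<phi> \<in> hom FB ?H" and \<phi>_basis: "\<And>h. h \<in> basis \<Longrightarrow> \<phi> (cls basis {} [(h, False)]) = h"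
  proof (rule presented_group_hom[of "{}" basis ?H "\<lambda>h. h", OF empty_subsetI gH basis_H], assumption, erule emptyE)
    fix \<phi> assume *: "\<phi> \<in> hom FB ?H" "\<And>h. h \<in> basis \<Longrightarrow> \<phi> (cls basis {} [(h, False)]) = h"
    show thesis by (rule that[OF *])
  qed
  have \<phi>_stab: "\<phi> f \<in> stab" if "f \<in> carrier FB" for f
    using hom_in_carrier[OF \<phi> that] by simp
  have "\<phi> \<in> hom FB \<Gamma>"
  proof (rule homI)
    show "\<phi> f \<in> carrier \<Gamma>" if "f \<in> carrier FB" for f
      using \<phi>_stab[OF that] by (simp add: stab_def)
    show "\<phi> (f \<otimes>\<^bsub>FB\<^esub> f') = \<phi> f \<otimes>\<^bsub>\<Gamma>\<^esub> \<phi> f'" if "f \<in> carrier FB" "f' \<in> carrier FB" for f f'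
      using hom_mult[OF \<phi> that] by simp
  qed
  then interpret \<phi>: group_hom FB \<Gamma> \<phi>
    by (intro group_hom.intro group_hom_axioms.intro group_FB group_axioms)
  have \<phi>_\<alpha>: "\<phi> (\<alpha> \<omega>) = cross \<omega>" if "\<omega> \<in> A" for \<omega>
  proof (cases "cross \<omega> = \<one>\<^bsub>\<Gamma>\<^esub>")
    case False
    then have "cross \<omega> \<in> basis" using that by (simp add: basis_def)
    then show ?thesis using False \<phi>_basis by (simp add: \<alpha>_def)
  qed (simp add: \<alpha>_def)
  \<comment> \<open>Compares the covering with \<Gamma> acting on itself by right multiplication.
    The point \<open>(w0, 1)\<close> goes to the unit, so \<open>?E\<close> recovers an element from
    the point to which it leads.\<close>
  let ?E = "\<lambda>b. \<phi> (snd b) \<otimes>\<^bsub>\<Gamma>\<^esub> tr gy (fst b)"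
  have E_closed: "?E b \<in> carrier \<Gamma>" if "b \<in> A \<times> carrier FB" for b
    using that by auto
  have E_p: "?E (lift_p a b) = ?E b \<otimes>\<^bsub>\<Gamma>\<^esub> ge m a" if "b \<in> A \<times> carrier FB" for a b
  proof -
    obtain \<omega> f where b: "b = (\<omega>, f)" "\<omega> \<in> A" "f \<in> carrier FB" using \<open>b \<in> _\<close> by auto
    show ?thesis
    proof (cases a)
      case gx
      have *: "x \<otimes>\<^bsub>\<Gamma>\<^esub> (inv\<^bsub>\<Gamma>\<^esub> x \<otimes>\<^bsub>\<Gamma>\<^esub> z) = z" "inv\<^bsub>\<Gamma>\<^esub> x \<otimes>\<^bsub>\<Gamma>\<^esub> (x \<otimes>\<^bsub>\<Gamma>\<^esub> z) = z"
        if "x \<in> carrier \<Gamma>" "z \<in> carrier \<Gamma>" for x z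
        using that by (simp_all flip: m_assoc)
      have "\<phi> (\<alpha> \<omega>) \<otimes>\<^bsub>\<Gamma>\<^esub> inv\<^bsub>\<Gamma>\<^esub> \<phi> (\<alpha> (p gx \<omega>)) \<otimes>\<^bsub>\<Gamma>\<^esub> tr gy (p gx \<omega>) = tr gy \<omega> \<otimes>\<^bsub>\<Gamma>\<^esub> ge m gx"
        using b by (simp add: \<phi>_\<alpha> cross_def inv_mult_group m_assoc * tr_p[of \<omega> gx])
      then show ?thesis
        using b by (simp add: gx lift_p_def m_assoc)
    next
      case gy
      then show ?thesis using b by (simp add: lift_p_def tr_p m_assoc)
    qed
  qed
  have E_q: "?E (lift_q a b) = ?E b \<otimes>\<^bsub>\<Gamma>\<^esub> gcls m [(a, True)]" if b: "b \<in> A \<times> carrier FB" for a b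
  proof -
    have "ge m a \<otimes>\<^bsub>\<Gamma>\<^esub> gcls m [(a, True)] = \<one>\<^bsub>\<Gamma>\<^esub>"
      using word_cong.cancel[of a UNIV False] by (simp add: gcls_mult one_Gamma3 cls_eq_iff)
    moreover have "gcls m [(a, True)] \<in> carrier \<Gamma>" by (simp add: carrier_Gamma3)
    moreover have "?E b = ?E (lift_q a b) \<otimes>\<^bsub>\<Gamma>\<^esub> ge m a"
      using E_p[of "lift_q a b" a] lift.pq b by auto
    ultimately show ?thesis
      using E_closed[of "lift_q a b"] lift.pq[of a b] b by (simp add: m_assoc)
  qed
  have E_wact: "?E (wact lift_p lift_q w b) = ?E b \<otimes>\<^bsub>\<Gamma>\<^esub> gcls m w" if "b \<in> A \<times> carrier FB" for w b
    using that
  proof (induction w arbitrary: b)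
    case Nil
    then have "?E b \<in> carrier \<Gamma>" by (rule E_closed)
    then show ?case by (simp flip: one_Gamma3)
  next
    case (Cons l w)
    obtain a e where l: "l = (a, e)" by (cases l)
    let ?b = "if e then lift_q a b else lift_p a b"
    have b: "?b \<in> A \<times> carrier FB" using lift.pq Cons.prems by auto
    have c: "gcls m [l] \<in> carrier \<Gamma>" "gcls m w \<in> carrier \<Gamma>" by (auto simp: carrier_Gamma3)
    have "?E (wact lift_p lift_q (l # w) b) = ?E ?b \<otimes>\<^bsub>\<Gamma>\<^esub> gcls m w"
      using Cons.IH[OF b] by (simp add: l)
    also have "?E ?b = ?E b \<otimes>\<^bsub>\<Gamma>\<^esub> gcls m [l]"
      using E_p[OF Cons.prems] E_q[OF Cons.prems] by (simp add: l)
    also have "\<dots> \<otimes>\<^bsub>\<Gamma>\<^esub> gcls m w = ?E b \<otimes>\<^bsub>\<Gamma>\<^esub> gcls m (l # w)"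
      using c E_closed[OF Cons.prems] m_assoc by (simp add: gcls_mult)
    finally show ?case .
  qed
  define \<psi> where "\<psi> h = snd (lift.ea h (w0, \<one>\<^bsub>FB\<^esub>))" for h
  have \<psi>: "\<psi> h \<in> carrier FB" "lift.ea h (w0, \<one>\<^bsub>FB\<^esub>) = (w0, \<psi> h)" if "h \<in> stab" for h
    using that lift_closed[of h "(w0, \<one>\<^bsub>FB\<^esub>)"] fst_lift[of h w0 "\<one>\<^bsub>FB\<^esub>"] w0
    by (auto simp: \<psi>_def stab_def prod_eq_iff mem_Times_iff)
  have \<psi>_hom: "\<psi> \<in> hom ?H FB"
  proof (rule homI)
    fix g h assume "g \<in> carrier ?H" "h \<in> carrier ?H"
    then have gh: "g \<in> stab" "h \<in> stab" by auto
    then have c: "g \<in> carrier \<Gamma>" "h \<in> carrier \<Gamma>" by (auto simp: stab_def)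
    \<comment> \<open>In the sheet \<open>\<psi> g\<close> the element \<open>h\<close> moves as in
      the unit sheet, up to the deck transformation by \<open>\<psi> g\<close>.\<close>
    have "lift.ea (g \<otimes>\<^bsub>\<Gamma>\<^esub> h) (w0, \<one>\<^bsub>FB\<^esub>) = lift.ea h (shift (\<psi> g) (w0, \<one>\<^bsub>FB\<^esub>))"
      using \<psi>[OF gh(1)] c w0 by (simp add: lift_mult shift_def)
    also have "\<dots> = (w0, \<psi> g \<otimes>\<^bsub>FB\<^esub> \<psi> h)"
      using \<psi>[OF gh(1)] \<psi>[OF gh(2)] c w0 by (simp add: lift_shift) (simp add: shift_def)
    finally show "\<psi> (g \<otimes>\<^bsub>?H\<^esub> h) = \<psi> g \<otimes>\<^bsub>FB\<^esub> \<psi> h"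
      by (simp add: \<psi>_def)
  qed (use \<psi> in auto)
  have \<phi>\<psi>: "\<phi> (\<psi> h) = h" if h: "h \<in> stab" for h
  proof -
    obtain w where w: "h = gcls m w" using h by (auto simp: stab_def carrier_Gamma3)
    have "wact lift_p lift_q w (w0, \<one>\<^bsub>FB\<^esub>) = (w0, \<psi> h)"
      using \<psi>(2)[OF h] w0 by (simp add: w lift.ea_cls)
    then show ?thesis
      using E_wact[of "(w0, \<one>\<^bsub>FB\<^esub>)" w] w0 \<psi>(1)[OF h] h by (simp add: tr_w0 w[symmetric] stab_def)
  qed
  have \<psi>_cross: "\<psi> (cross \<omega>) = \<alpha> \<omega>" if \<omega>: "\<omega> \<in> A" for \<omega>
  proof -
    let ?i = "inv\<^bsub>\<Gamma>\<^esub> tr gx \<omega>"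
    \<comment> \<open>The path on the \<open>x\<close>-side ends in the sheet inverse to \<alpha>
      \<omega>. The deck transformation by \<alpha> \<omega> moves this end to the unit sheet, where
      the path on the \<open>y\<close>-side arrives.\<close>
    have "lift.ea ?i (\<omega>, inv\<^bsub>FB\<^esub> \<alpha> \<omega>) = (w0, \<one>\<^bsub>FB\<^esub>)"
      using lift_inv[of "tr gx \<omega>" "(w0, \<one>\<^bsub>FB\<^esub>)"] lift_tr[OF \<omega>, of gx] w0 by simp
    moreover have "(\<omega>, \<one>\<^bsub>FB\<^esub>) = shift (\<alpha> \<omega>) (\<omega>, inv\<^bsub>FB\<^esub> \<alpha> \<omega>)"
      using \<omega> by (simp add: shift_def)
    ultimately have "lift.ea ?i (\<omega>, \<one>\<^bsub>FB\<^esub>) = shift (\<alpha> \<omega>) (w0, \<one>\<^bsub>FB\<^esub>)"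
      using \<omega> by (simp add: lift_shift)
    then show ?thesis
      using lift_tr[OF \<omega>, of gy] w0 \<omega> by (simp add: \<psi>_def cross_def lift_mult shift_def)
  qed
  have "\<psi> (\<phi> f) = f" if f: "f \<in> carrier FB" for f
  proof -
    have "(\<psi> \<circ> \<phi>) f = (\<lambda>x. x) f"
    proof (rule presented_group_hom_unique[of "{}" basis FB])
      show "\<psi> \<circ> \<phi> \<in> hom FB FB"
        using \<phi> \<psi>_hom by (rule Group.hom_compose)
      show "(\<lambda>x. x) \<in> hom FB FB" by (auto simp: hom_def)
      show "(\<psi> \<circ> \<phi>) (cls basis {} [(h, False)]) = cls basis {} [(h, False)]" if "h \<in> basis" for h
      proof -
        obtain \<omega> where "\<omega> \<in> A" "h = cross \<omega>" "h \<noteq> \<one>\<^bsub>\<Gamma>\<^esub>"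
          using \<open>h \<in> basis\<close> unfolding basis_def by blast
        then show ?thesis
          using \<phi>_basis[OF that] \<psi>_cross by (simp add: \<alpha>_def)
      qed
    qed (use f group_FB in auto)
    then show ?thesis by simp
  qed
  then have "bij_betw \<psi> (carrier ?H) (carrier FB)"
    using \<phi>\<psi> \<phi>_stab \<psi>(1) by (intro bij_betw_byWitness[where f' = \<phi>]) auto
  then have "?H \<cong> FB"
    using \<psi>_hom by (auto simp: is_iso_def iso_def)
  then show ?thesis
    using gH by (auto simp: is_free_group_def)
qed

end

section \<open>Free subgroups and transitive actions\<close>

lemma is_free_group_torsion_free:
  fixes K :: "('a, 'b) monoid_scheme"
  assumes K: "is_free_group K" and g: "g \<in> carrier K" "g [^]\<^bsub>K\<^esub> (n::nat) = \<one>\<^bsub>K\<^esub>" and n: "n > 0"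
  shows "g = \<one>\<^bsub>K\<^esub>"
proof -
  obtain X :: "'a set" and h where "group K" and h: "h \<in> iso K (free_group_on X)"
    using K by (auto simp: is_free_group_def is_iso_def)
  let ?F = "free_group_on X"
  interpret h: group_hom K ?F h
    by (intro group_hom.intro group_hom_axioms.intro \<open>group K\<close> group_presented_group)
      (use h in \<open>auto simp: iso_def\<close>)
  obtain w where w: "w \<in> words X" "h g = cls X {} w"
    using h.hom_closed[OF g(1)] by (auto simp: carrier_presented_group)
  have pow: "concat (replicate n w) \<in> words X"
    using w(1) by (induction n) auto
  have "h g [^]\<^bsub>?F\<^esub> n = \<one>\<^bsub>?F\<^esub>"
    using h.hom_nat_pow[OF g(1), of n] g(2) h.hom_one by simp
  then have "(concat (replicate n w), []) \<in> word_cong X {}"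
    using w pow by (simp add: cls_pow one_presented_group cls_eq_iff)
  then have "(w, []) \<in> word_cong X {}"
    using free_group_torsion_free w(1) n by blast
  then have "h g = h \<one>\<^bsub>K\<^esub>"
    using w h.hom_one by (simp add: one_presented_group cls_eq_iff)
  moreover have "inj_on h (carrier K)"
    using h by (auto simp: iso_def bij_betw_def)
  ultimately show ?thesis
    using g(1) h.G.one_closed by (meson inj_onD)
qed

context gamma_action
begin

lemma gcls_stab: "gcls m w \<in> stab \<longleftrightarrow> wact p (\<lambda>a. iv (p a)) w w0 = w0"
  by (simp add: stab_def ea_cls w0 carrier_Gamma3)

lemma act_eq_iff_stab:
  assumes g: "g \<in> carrier \<Gamma>" and h: "h \<in> carrier \<Gamma>"
  shows "ea g w0 = ea h w0 \<longleftrightarrow> g \<otimes>\<^bsub>\<Gamma>\<^esub> inv\<^bsub>\<Gamma>\<^esub> h \<in> stab"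
proof
  assume "ea g w0 = ea h w0"
  then show "g \<otimes>\<^bsub>\<Gamma>\<^esub> inv\<^bsub>\<Gamma>\<^esub> h \<in> stab"
    using assms act_inv[of h w0] w0 by (simp add: stab_def act_mult)
next
  assume "g \<otimes>\<^bsub>\<Gamma>\<^esub> inv\<^bsub>\<Gamma>\<^esub> h \<in> stab"
  then have "ea h (ea (g \<otimes>\<^bsub>\<Gamma>\<^esub> inv\<^bsub>\<Gamma>\<^esub> h) w0) = ea h w0" by (simp add: stab_def)
  moreover have "ea h (ea (g \<otimes>\<^bsub>\<Gamma>\<^esub> inv\<^bsub>\<Gamma>\<^esub> h) w0) = ea (g \<otimes>\<^bsub>\<Gamma>\<^esub> inv\<^bsub>\<Gamma>\<^esub> h \<otimes>\<^bsub>\<Gamma>\<^esub> h) w0"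
    using assms w0 act_mult by simp
  ultimately show "ea g w0 = ea h w0"
    using assms by (simp add: m_assoc)
qed

lemma card_rcosets_stab: "card (rcosets\<^bsub>\<Gamma>\<^esub> stab) = card A"
proof -
  have "bij_betw (\<lambda>\<omega>. stab #>\<^bsub>\<Gamma>\<^esub> tr gx \<omega>) A (rcosets\<^bsub>\<Gamma>\<^esub> stab)"
  proof (rule bij_betwI')
    fix \<omega> \<omega>' assume \<omega>: "\<omega> \<in> A" "\<omega>' \<in> A"
    have "\<omega> = \<omega>'" if "stab #>\<^bsub>\<Gamma>\<^esub> tr gx \<omega> = stab #>\<^bsub>\<Gamma>\<^esub> tr gx \<omega>'"
    proof -
      have "tr gx \<omega> \<in> stab #>\<^bsub>\<Gamma>\<^esub> tr gx \<omega>'"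
        using rcos_self[OF tr_closed subgroup_stab, of gx \<omega>] that by simp
      then obtain h where "h \<in> stab" "tr gx \<omega> = h \<otimes>\<^bsub>\<Gamma>\<^esub> tr gx \<omega>'"
        by (auto simp: r_coset_def)
      then have "ea (tr gx \<omega>) w0 = ea (tr gx \<omega>') w0"
        using w0 by (simp add: act_mult stab_def)
      then show ?thesis using \<omega> by (simp add: act_tr)
    qed
    then show "(stab #>\<^bsub>\<Gamma>\<^esub> tr gx \<omega> = stab #>\<^bsub>\<Gamma>\<^esub> tr gx \<omega>') = (\<omega> = \<omega>')" by blast
  next
    fix \<omega> assume "\<omega> \<in> A"
    then show "stab #>\<^bsub>\<Gamma>\<^esub> tr gx \<omega> \<in> rcosets\<^bsub>\<Gamma>\<^esub> stab"
      using rcosetsI[OF subgroup.subset[OF subgroup_stab]] by simp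
  next
    fix C assume "C \<in> rcosets\<^bsub>\<Gamma>\<^esub> stab"
    then obtain g where g: "g \<in> carrier \<Gamma>" "C = stab #>\<^bsub>\<Gamma>\<^esub> g" by (auto simp: RCOSETS_def)
    have A: "ea g w0 \<in> A" using g(1) w0 act_closed by blast
    have "g \<otimes>\<^bsub>\<Gamma>\<^esub> inv\<^bsub>\<Gamma>\<^esub> tr gx (ea g w0) \<in> stab"
      using act_eq_iff_stab[OF g(1) tr_closed, of gx "ea g w0"] A by (simp add: act_tr)
    then have "g \<in> stab #>\<^bsub>\<Gamma>\<^esub> tr gx (ea g w0)"
      using g(1) by (auto simp: r_coset_def m_assoc intro!: bexI)
    then have "C = stab #>\<^bsub>\<Gamma>\<^esub> tr gx (ea g w0)"
      using repr_independence[OF _ tr_closed subgroup_stab] g(2) by auto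
    then show "\<exists>\<omega>\<in>A. C = stab #>\<^bsub>\<Gamma>\<^esub> tr gx \<omega>" using A by blast
  qed
  then show ?thesis by (simp add: bij_betw_same_card)
qed

end

definition free_subgroups :: "nat \<Rightarrow> nat \<Rightarrow> gen word set set set" where
  "free_subgroups m k = {H. subgroup H (Gamma3 m) \<and> card (rcosets\<^bsub>Gamma3 m\<^esub> H) = k \<and>
    is_free_group ((Gamma3 m)\<lparr>carrier := H\<rparr>)}"

text \<open>A conjugate of a power of a generator has finite order, and a free group contains only
  the trivial element of finite order.\<close>

lemma free_subgroup_conj_pow:
  assumes m: "m > 0" and H: "subgroup H (Gamma3 m)" "is_free_group ((Gamma3 m)\<lparr>carrier := H\<rparr>)"
    and g: "g \<in> carrier (Gamma3 m)"
    and in_H: "g \<otimes>\<^bsub>Gamma3 m\<^esub> ge m a [^]\<^bsub>Gamma3 m\<^esub> (i::nat) \<otimes>\<^bsub>Gamma3 m\<^esub> inv\<^bsub>Gamma3 m\<^esub> g \<in> H"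
  shows "gord m a dvd i"
proof -
  interpret group "Gamma3 m" by (rule group_Gamma3)
  let ?e = "ge m a [^]\<^bsub>Gamma3 m\<^esub> i" and ?n = "gord m a"
  have e: "?e \<in> carrier (Gamma3 m)" unfolding ge_pow carrier_Gamma3 by simp
  let ?c = "g \<otimes>\<^bsub>Gamma3 m\<^esub> ?e \<otimes>\<^bsub>Gamma3 m\<^esub> inv\<^bsub>Gamma3 m\<^esub> g"
  have "?c [^]\<^bsub>Gamma3 m\<^esub> n = g \<otimes>\<^bsub>Gamma3 m\<^esub> ?e [^]\<^bsub>Gamma3 m\<^esub> n \<otimes>\<^bsub>Gamma3 m\<^esub> inv\<^bsub>Gamma3 m\<^esub> g" for n :: nat
  proof (induction n)
    case (Suc n)
    have can: "inv\<^bsub>Gamma3 m\<^esub> g \<otimes>\<^bsub>Gamma3 m\<^esub> (g \<otimes>\<^bsub>Gamma3 m\<^esub> z) = z" if "z \<in> carrier (Gamma3 m)" for z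
      using that g by (simp flip: m_assoc)
    show ?case using Suc g e by (simp add: m_assoc can)
  qed (use g in simp)
  moreover have "?e [^]\<^bsub>Gamma3 m\<^esub> ?n = \<one>\<^bsub>Gamma3 m\<^esub>"
    using ge_pow_eq_one_iff[OF m, of a "i * ?n"] nat_pow_pow[of "ge m a" i ?n] by (simp add: carrier_Gamma3)
  ultimately have "?c [^]\<^bsub>Gamma3 m\<^esub> ?n = \<one>\<^bsub>Gamma3 m\<^esub>" using g by simp
  then have "?c [^]\<^bsub>(Gamma3 m)\<lparr>carrier := H\<rparr>\<^esub> ?n = \<one>\<^bsub>(Gamma3 m)\<lparr>carrier := H\<rparr>\<^esub>"
    using nat_pow_consistent by simp
  moreover have "?n > 0" using m by (cases a) (auto simp: gord_def)
  ultimately have "?c = \<one>\<^bsub>(Gamma3 m)\<lparr>carrier := H\<rparr>\<^esub>"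
    using is_free_group_torsion_free[OF H(2), of ?c ?n] in_H by simp
  then have "?c = \<one>\<^bsub>Gamma3 m\<^esub>" by simp
  then have "?e = \<one>\<^bsub>Gamma3 m\<^esub>"
    using g e by (metis inv_closed inv_inv inv_equality l_cancel_one' m_closed r_inv inv_solve_right' l_one)
  then show ?thesis using ge_pow_eq_one_iff[OF m] by simp
qed

text \<open>Right multiplication on the cosets, numbered by \<open>{..<k}\<close>. An element
  \<open>g\<close> fixes the coset of \<open>h\<close> iff its conjugate by \<open>h\<close> lies in
  \<open>H\<close>, so semiregularity is \<open>free_subgroup_conj_pow\<close>.\<close>

lemma gamma_action_of_subgroup:
  assumes m: "m > 0" and k: "k > 0" and H: "H \<in> free_subgroups m k"
  shows "\<exists>p. gamma_action m {..<k} p 0 \<and> gamma_action.stab m p 0 = H"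
proof -
  interpret group "Gamma3 m" by (rule group_Gamma3)
  let ?\<Gamma> = "Gamma3 m"
  have sub: "subgroup H ?\<Gamma>" and card: "card (rcosets\<^bsub>?\<Gamma>\<^esub> H) = k"
    and free: "is_free_group (?\<Gamma>\<lparr>carrier := H\<rparr>)"
    using H by (auto simp: free_subgroups_def)
  have HG: "H \<subseteq> carrier ?\<Gamma>" using sub by (rule subgroup.subset)
  have fin: "finite (rcosets\<^bsub>?\<Gamma>\<^esub> H)" using card k card_ge_0_finite by blast
  have gc: "gcls m w \<in> carrier ?\<Gamma>" for w by (simp add: carrier_Gamma3)
  obtain c0 where c0: "bij_betw c0 {..<k} (rcosets\<^bsub>?\<Gamma>\<^esub> H)"
    using ex_bij_betw_nat_finite[OF fin] card by (auto simp: atLeast0LessThan)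
  have H_coset: "H \<in> rcosets\<^bsub>?\<Gamma>\<^esub> H"
    using rcosetsI[OF HG one_closed] coset_mult_one[OF HG] by simp
  then obtain j where j: "j < k" "c0 j = H"
    using c0 unfolding bij_betw_def by (metis imageE lessThan_iff)
  \<comment> \<open>Renumbers the cosets so that \<open>H\<close> itself becomes the base point
    0.\<close>
  define c where "c = c0 \<circ> Transposition.transpose 0 j"
  have c: "bij_betw c {..<k} (rcosets\<^bsub>?\<Gamma>\<^esub> H)"
    unfolding c_def using c0 j k
    by (intro bij_betw_trans[OF _ c0] permutes_imp_bij permutes_swap_id) auto
  have c_0: "c 0 = H" using j by (simp add: c_def)
  have ex_g: "\<exists>g. g \<in> carrier ?\<Gamma> \<and> c \<omega> = H #>\<^bsub>?\<Gamma>\<^esub> g" if "\<omega> < k" for \<omega>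
  proof -
    have "c \<omega> \<in> rcosets\<^bsub>?\<Gamma>\<^esub> H" using bij_betwE[OF c] that by simp
    then show ?thesis by (auto simp: RCOSETS_def)
  qed
  have mult_coset: "c \<omega> #>\<^bsub>?\<Gamma>\<^esub> g \<in> rcosets\<^bsub>?\<Gamma>\<^esub> H" if "\<omega> < k" "g \<in> carrier ?\<Gamma>" for \<omega> g
  proof -
    obtain h where h: "h \<in> carrier ?\<Gamma>" "c \<omega> = H #>\<^bsub>?\<Gamma>\<^esub> h" using ex_g[OF \<open>\<omega> < k\<close>] by blast
    then have "c \<omega> #>\<^bsub>?\<Gamma>\<^esub> g = H #>\<^bsub>?\<Gamma>\<^esub> (h \<otimes>\<^bsub>?\<Gamma>\<^esub> g)"
      using that(2) coset_mult_assoc[OF HG] by simp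
    then show ?thesis using rcosetsI[OF HG] h(1) that(2) by simp
  qed
  have mult_mult: "c \<omega> #>\<^bsub>?\<Gamma>\<^esub> g #>\<^bsub>?\<Gamma>\<^esub> h = c \<omega> #>\<^bsub>?\<Gamma>\<^esub> (g \<otimes>\<^bsub>?\<Gamma>\<^esub> h)"
    if "\<omega> < k" "g \<in> carrier ?\<Gamma>" "h \<in> carrier ?\<Gamma>" for \<omega> g h
    using ex_g[OF that(1)] that(2,3) by (auto simp: coset_mult_assoc[OF HG] m_assoc)
  have mult_one: "c \<omega> #>\<^bsub>?\<Gamma>\<^esub> \<one>\<^bsub>?\<Gamma>\<^esub> = c \<omega>" if "\<omega> < k" for \<omega>
  proof -
    obtain h where h: "h \<in> carrier ?\<Gamma>" "c \<omega> = H #>\<^bsub>?\<Gamma>\<^esub> h" using ex_g[OF \<open>\<omega> < k\<close>] by blast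
    then show ?thesis using coset_mult_assoc[OF HG h(1) one_closed] by simp
  qed
  define act where "act g \<omega> = inv_into {..<k} c (c \<omega> #>\<^bsub>?\<Gamma>\<^esub> g)" for g \<omega>
  have act: "act g \<omega> < k" "c (act g \<omega>) = c \<omega> #>\<^bsub>?\<Gamma>\<^esub> g" if "\<omega> < k" "g \<in> carrier ?\<Gamma>" for g \<omega>
    using mult_coset[OF that] c bij_betw_inv_into[OF c]
    by (auto simp: act_def bij_betw_def f_inv_into_f)
  have c_inj: "\<omega> = \<omega>'" if "c \<omega> = c \<omega>'" "\<omega> < k" "\<omega>' < k" for \<omega> \<omega>'
    using c that by (auto simp: bij_betw_def inj_on_def)
  define p where "p a \<omega> = (if \<omega> < k then act (ge m a) \<omega> else \<omega>)" for a \<omega>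
  have gg: "ge m a \<otimes>\<^bsub>?\<Gamma>\<^esub> gcls m [(a, True)] = \<one>\<^bsub>?\<Gamma>\<^esub>" "gcls m [(a, True)] \<otimes>\<^bsub>?\<Gamma>\<^esub> ge m a = \<one>\<^bsub>?\<Gamma>\<^esub>" for a
    using word_cong.cancel[of a UNIV False] word_cong.cancel[of a UNIV True]
    by (simp_all add: gcls_mult one_Gamma3 cls_eq_iff)
  have act_act: "act h (act g \<omega>) = act (g \<otimes>\<^bsub>?\<Gamma>\<^esub> h) \<omega>"
    if "\<omega> < k" "g \<in> carrier ?\<Gamma>" "h \<in> carrier ?\<Gamma>" for g h \<omega>
    by (rule c_inj) (use that in \<open>simp_all add: act mult_mult\<close>)
  have act_one: "act \<one>\<^bsub>?\<Gamma>\<^esub> \<omega> = \<omega>" if "\<omega> < k" for \<omega>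
    by (rule c_inj) (use that in \<open>simp_all add: act mult_one\<close>)
  have p_perm: "p a permutes {..<k}" for a
  proof (rule bij_imp_permutes)
    show "bij_betw (p a) {..<k} {..<k}"
      by (rule bij_betw_byWitness[where f' = "act (gcls m [(a, True)])"])
        (auto simp: p_def act act_act gc gg act_one)
  qed (simp add: p_def)
  have iv_p: "iv (p a) \<omega> = act (gcls m [(a, True)]) \<omega>" if "\<omega> < k" for a \<omega>
  proof -
    have "p a (act (gcls m [(a, True)]) \<omega>) = \<omega>"
      using that by (simp add: p_def act act_act gc gg act_one)
    then show ?thesis using permutes_inverses(2)[OF p_perm] by metis
  qed
  have wact_p: "wact p (\<lambda>a. iv (p a)) w \<omega> = act (gcls m w) \<omega>" if "\<omega> < k" for w \<omega>
    using that
  proof (induction w arbitrary: \<omega>)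
    case Nil
    then show ?case by (simp add: act_one flip: one_Gamma3)
  next
    case (Cons l w)
    obtain a e where l: "l = (a, e)" by (cases l)
    have "(if e then iv (p a) \<omega> else p a \<omega>) = act (gcls m [l]) \<omega>"
      using Cons.prems by (simp add: l p_def iv_p)
    then show ?case
      using Cons by (simp add: l act act_act gc gcls_mult)
  qed
  have pow_p: "(p a ^^ i) \<omega> = act (ge m a [^]\<^bsub>?\<Gamma>\<^esub> i) \<omega>" if "\<omega> < k" for a i \<omega>
    using wact_p[OF that, of "gen_power a i"] by (simp add: ge_pow)
  have act_fix: "act g \<omega> = \<omega> \<longleftrightarrow> h \<otimes>\<^bsub>?\<Gamma>\<^esub> g \<otimes>\<^bsub>?\<Gamma>\<^esub> inv\<^bsub>?\<Gamma>\<^esub> h \<in> H"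
    if "\<omega> < k" "c \<omega> = H #>\<^bsub>?\<Gamma>\<^esub> h" "h \<in> carrier ?\<Gamma>" "g \<in> carrier ?\<Gamma>" for g h \<omega>
  proof -
    have "act g \<omega> = \<omega> \<longleftrightarrow> c \<omega> #>\<^bsub>?\<Gamma>\<^esub> g = c \<omega>"
      using act[OF that(1,4)] c_inj that(1) by metis
    also have "\<dots> \<longleftrightarrow> H #>\<^bsub>?\<Gamma>\<^esub> (h \<otimes>\<^bsub>?\<Gamma>\<^esub> g) = H #>\<^bsub>?\<Gamma>\<^esub> h"
      using that by (simp add: coset_mult_assoc[OF HG])
    also have "\<dots> \<longleftrightarrow> H #>\<^bsub>?\<Gamma>\<^esub> (h \<otimes>\<^bsub>?\<Gamma>\<^esub> g \<otimes>\<^bsub>?\<Gamma>\<^esub> inv\<^bsub>?\<Gamma>\<^esub> h) = H"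
      using that HG coset_mult_inv1[of H "h \<otimes>\<^bsub>?\<Gamma>\<^esub> g" h] coset_mult_inv2[of H "h \<otimes>\<^bsub>?\<Gamma>\<^esub> g" h] by auto
    also have "\<dots> \<longleftrightarrow> h \<otimes>\<^bsub>?\<Gamma>\<^esub> g \<otimes>\<^bsub>?\<Gamma>\<^esub> inv\<^bsub>?\<Gamma>\<^esub> h \<in> H"
      using coset_join1[of H] coset_join2[of _ H] sub that HG by auto
    finally show ?thesis .
  qed
  have ga: "gamma_action m {..<k} p 0"
  proof
    show "0 < m" by fact
    show "p a permutes {..<k}" for a by (rule p_perm)
    show "0 \<in> {..<k}" using k by simp
    fix \<omega> assume "\<omega> \<in> {..<k}"
    then have \<omega>: "\<omega> < k" by simp
    show "(p gx ^^ 2) \<omega> = (p gy ^^ 3) \<omega>"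
      using \<omega> ge_square_cube by (simp only: pow_p)
    obtain g where g: "g \<in> carrier ?\<Gamma>" "c \<omega> = H #>\<^bsub>?\<Gamma>\<^esub> g" using ex_g[OF \<omega>] by blast
    show "((p a ^^ i) \<omega> = \<omega>) = (gord m a dvd i)" for a i
    proof
      assume "(p a ^^ i) \<omega> = \<omega>"
      then have "g \<otimes>\<^bsub>?\<Gamma>\<^esub> ge m a [^]\<^bsub>?\<Gamma>\<^esub> i \<otimes>\<^bsub>?\<Gamma>\<^esub> inv\<^bsub>?\<Gamma>\<^esub> g \<in> H"
        using act_fix[OF \<omega> g(2,1)] \<omega> gc by (simp add: pow_p)
      then show "gord m a dvd i"
        by (rule free_subgroup_conj_pow[OF m sub free g(1)])
    next
      assume "gord m a dvd i"
      then have "ge m a [^]\<^bsub>?\<Gamma>\<^esub> i = \<one>\<^bsub>?\<Gamma>\<^esub>"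
        using ge_pow_eq_one_iff[OF m] by blast
      then show "(p a ^^ i) \<omega> = \<omega>"
        using act_one[OF \<omega>] by (simp only: pow_p[OF \<omega>])
    qed
    obtain w where "g = gcls m w" using g(1) by (auto simp: carrier_Gamma3)
    then have "wact p (\<lambda>a. iv (p a)) w 0 = \<omega>"
      by (intro c_inj) (use k \<omega> gc g in \<open>simp_all add: wact_p act c_0\<close>)
    then show "\<exists>w. wact p (\<lambda>a. iv (p a)) w 0 = \<omega>" ..
  qed
  interpret ga: gamma_action m "{..<k}" p 0 by fact
  have "gcls m w \<in> ga.stab \<longleftrightarrow> gcls m w \<in> H" for w
    using act_fix[of 0 "\<one>\<^bsub>?\<Gamma>\<^esub>" "gcls m w"] k gc coset_mult_one[OF HG]
    by (simp add: ga.gcls_stab wact_p c_0)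
  moreover have "ga.stab \<subseteq> carrier ?\<Gamma>" by (auto simp: ga.stab_def)
  ultimately have "ga.stab = H"
    using HG by (auto simp: carrier_Gamma3)
  then show ?thesis using ga by blast
qed

section \<open>Labelled actions and their relabelling\<close>

definition actions :: "nat \<Rightarrow> 'b set \<Rightarrow> (gen \<Rightarrow> 'b \<Rightarrow> 'b) set" where
  "actions m A = {p. (\<forall>a. p a permutes A) \<and>
    (\<forall>a. \<forall>\<omega>\<in>A. \<forall>i. (p a ^^ i) \<omega> = \<omega> \<longleftrightarrow> gord m a dvd i) \<and>
    (\<forall>\<omega>\<in>A. (p gx ^^ 2) \<omega> = (p gy ^^ 3) \<omega>)}"

definition transitive_actions :: "nat \<Rightarrow> 'b set \<Rightarrow> 'b \<Rightarrow> (gen \<Rightarrow> 'b \<Rightarrow> 'b) set" where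
  "transitive_actions m A b = {p. gamma_action m A p b}"

abbreviation gact :: "(gen \<Rightarrow> 'b \<Rightarrow> 'b) \<Rightarrow> gen word \<Rightarrow> 'b \<Rightarrow> 'b" where
  "gact p \<equiv> wact p (\<lambda>a. iv (p a))"

lemma gamma_action_iff:
  "gamma_action m A p b \<longleftrightarrow> m > 0 \<and> p \<in> actions m A \<and> b \<in> A \<and> (\<forall>\<omega>\<in>A. \<exists>w. gact p w b = \<omega>)"
  by (auto simp: gamma_action_def actions_def)

definition conj_act :: "('b \<Rightarrow> 'c) \<Rightarrow> ('a \<Rightarrow> 'b \<Rightarrow> 'b) \<Rightarrow> 'a \<Rightarrow> 'c \<Rightarrow> 'c" where
  "conj_act \<pi> p a = \<pi> \<circ> p a \<circ> iv \<pi>"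

lemma conj_apply: "bij \<pi> \<Longrightarrow> conj_act \<pi> p a (\<pi> \<omega>) = \<pi> (p a \<omega>)"
  by (simp add: conj_act_def bij_is_inj)

lemma conj_pow: "bij \<pi> \<Longrightarrow> (conj_act \<pi> p a ^^ i) (\<pi> \<omega>) = \<pi> ((p a ^^ i) \<omega>)"
  by (induction i) (simp_all add: conj_apply)

lemma conj_permutes:
  assumes \<pi>: "bij \<pi>" and p: "p a permutes A"
  shows "conj_act \<pi> p a permutes \<pi> ` A"
proof -
  have "bij (conj_act \<pi> p a)"
    unfolding conj_act_def using \<pi> p by (intro bij_comp permutes_bij bij_imp_bij_inv)
  moreover have "conj_act \<pi> p a x = x" if "x \<notin> \<pi> ` A" for x
  proof -
    obtain \<omega> where \<omega>: "x = \<pi> \<omega>" using \<pi> by (meson bij_pointE)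
    then have "\<omega> \<notin> A" using that by auto
    then show ?thesis using p \<pi> by (simp add: \<omega> conj_apply permutes_not_in)
  qed
  ultimately show ?thesis by (auto simp: permutes_def bij_iff)
qed

lemma gact_conj:
  assumes \<pi>: "bij \<pi>" and p: "\<And>a. bij (p a)"
  shows "gact (conj_act \<pi> p) w (\<pi> \<omega>) = \<pi> (gact p w \<omega>)"
proof (induction w arbitrary: \<omega>)
  case (Cons l w)
  obtain a e where l: "l = (a, e)" by (cases l)
  have "conj_act \<pi> p a (\<pi> (iv (p a) \<omega>)) = \<pi> \<omega>"
    using p[of a] \<pi> by (simp add: conj_apply bij_is_surj surj_f_inv_f)
  moreover have "bij (conj_act \<pi> p a)"
    unfolding conj_act_def using \<pi> p by (intro bij_comp bij_imp_bij_inv)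
  ultimately have "iv (conj_act \<pi> p a) (\<pi> \<omega>) = \<pi> (iv (p a) \<omega>)"
    by (metis bij_is_inj inv_f_f)
  then show ?case using Cons \<pi> by (simp add: l conj_apply)
qed simp

lemma actions_conj: "bij \<pi> \<Longrightarrow> p \<in> actions m A \<Longrightarrow> conj_act \<pi> p \<in> actions m (\<pi> ` A)"
  by (auto simp: actions_def conj_permutes conj_pow bij_is_inj inj_eq)

lemma conj_conj_inv:
  assumes "bij \<pi>"
  shows "conj_act (iv \<pi>) (conj_act \<pi> p) = p" "conj_act \<pi> (conj_act (iv \<pi>) q) = q"
  using assms by (auto simp: conj_act_def fun_eq_iff bij_imp_bij_inv inv_inv_eq bij_is_surj bij_is_inj surj_f_inv_f)

lemma image_iv_image: "bij \<pi> \<Longrightarrow> iv \<pi> ` \<pi> ` A = A"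
  by (simp add: bij_is_inj image_image)

lemma gamma_action_conj:
  assumes \<pi>: "bij \<pi>" and p: "gamma_action m A p b"
  shows "gamma_action m (\<pi> ` A) (conj_act \<pi> p) (\<pi> b)"
proof -
  have "bij (p a)" for a using gamma_action.perm[OF p] by (rule permutes_bij)
  then show ?thesis
    using assms by (auto simp: gamma_action_iff actions_conj gact_conj)
qed

lemma stab_conj:
  assumes \<pi>: "bij \<pi>" and p: "gamma_action m A p b"
  shows "gamma_action.stab m (conj_act \<pi> p) (\<pi> b) = gamma_action.stab m p b"
proof -
  interpret p: gamma_action m A p b by fact
  interpret c: gamma_action m "\<pi> ` A" "conj_act \<pi> p" "\<pi> b" using assms by (rule gamma_action_conj)
  have "gcls m w \<in> c.stab \<longleftrightarrow> gcls m w \<in> p.stab" for w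
    unfolding c.gcls_stab p.gcls_stab
    using gact_conj[OF \<pi>, of p w b] permutes_bij[OF p.perm] \<pi> by (simp add: bij_is_inj inj_eq)
  then show ?thesis
    by (auto simp: c.stab_def p.stab_def carrier_Gamma3)
qed

text \<open>\<open>conj_act\<close> relabels by a bijection of the whole type. A bijection from
  \<open>A\<close> to \<open>B\<close> extends to one by sending \<open>B - A\<close> back to
  \<open>A - B\<close>, which has the same size, and fixing everything else.\<close>

lemma extend_to_bij:
  assumes "finite A" "finite B" "card A = card B" "a \<in> A" "b \<in> B"
  obtains \<pi> :: "'b \<Rightarrow> 'b" where "bij \<pi>" "\<pi> ` A = B" "\<pi> a = b"
proof -
  obtain f where f: "bij_betw f (A - {a}) (B - {b})"
    using assms finite_same_card_bij[of "A - {a}" "B - {b}"] by auto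
  have "card (B - A) = card (A - B)"
    using assms by (metis Int_commute card_Diff_subset_Int diff_Suc_eq_diff_pred finite_Int)
  then obtain g where g: "bij_betw g (B - A) (A - B)"
    using assms finite_same_card_bij[of "B - A" "A - B"] by auto
  define \<pi> where "\<pi> x = (if x = a then b else if x \<in> A then f x else if x \<in> B then g x else x)" for x
  have f': "bij_betw \<pi> (A - {a}) (B - {b})"
    using f by (rule bij_betw_cong[THEN iffD1, rotated]) (auto simp: \<pi>_def)
  then have "bij_betw \<pi> ((A - {a}) \<union> {a}) ((B - {b}) \<union> {b})"
    using assms by (intro bij_betw_combine) (auto simp: \<pi>_def)
  moreover have "A - {a} \<union> {a} = A" "B - {b} \<union> {b} = B" using assms by auto
  ultimately have A: "bij_betw \<pi> A B" by simp
  have "bij_betw \<pi> (B - A) (A - B)"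
    using g by (rule bij_betw_cong[THEN iffD1, rotated]) (use assms in \<open>auto simp: \<pi>_def\<close>)
  with A have "bij_betw \<pi> (A \<union> (B - A)) (B \<union> (A - B))"
    by (rule bij_betw_combine) auto
  moreover have "bij_betw \<pi> (- (A \<union> B)) (- (A \<union> B))"
    using assms by (intro bij_betw_cong[THEN iffD2, OF _ bij_betw_id]) (auto simp: \<pi>_def)
  ultimately have "bij_betw \<pi> ((A \<union> (B - A)) \<union> - (A \<union> B)) ((B \<union> (A - B)) \<union> - (A \<union> B))"
    by (rule bij_betw_combine) auto
  moreover have "(A \<union> (B - A)) \<union> - (A \<union> B) = UNIV" "(B \<union> (A - B)) \<union> - (A \<union> B) = UNIV" by auto
  ultimately have "bij \<pi>" by simp
  moreover have "\<pi> ` A = B" using A by (simp add: bij_betw_def)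
  ultimately show ?thesis using that by (simp add: \<pi>_def)
qed

lemma card_transitive_actions_cong:
  fixes A B :: "'b set"
  assumes "finite A" "finite B" "card A = card B" "a \<in> A" "b \<in> B"
  shows "card (transitive_actions m A a) = card (transitive_actions m B b)"
proof -
  obtain \<pi> where \<pi>: "bij \<pi>" "\<pi> ` A = B" "\<pi> a = b"
    using extend_to_bij[OF assms] .
  have i: "bij (iv \<pi>)" "iv \<pi> ` B = A" "iv \<pi> b = a"
    using \<pi> by (auto simp: bij_imp_bij_inv image_iv_image bij_is_inj)
  have "bij_betw (conj_act \<pi>) (transitive_actions m A a) (transitive_actions m B b)"
    by (rule bij_betw_byWitness[where f' = "conj_act (iv \<pi>)"])
      (use gamma_action_conj[OF \<pi>(1), of m A _ a] gamma_action_conj[OF i(1), of m B _ b] in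
        \<open>auto simp: conj_conj_inv[OF \<pi>(1)] \<pi> i transitive_actions_def\<close>)
  then show ?thesis by (rule bij_betw_same_card)
qed

lemma card_actions_cong:
  fixes A B :: "'b set"
  assumes "finite A" "finite B" "card A = card B"
  shows "card (actions m A) = card (actions m B)"
proof (cases "A = {}")
  case True
  then show ?thesis using assms by simp
next
  case False
  then obtain a b where "a \<in> A" "b \<in> B" using assms by (metis card_gt_0_iff ex_in_conv)
  then obtain \<pi> where \<pi>: "bij \<pi>" "\<pi> ` A = B"
    using extend_to_bij[OF assms] by metis
  have i: "bij (iv \<pi>)" "iv \<pi> ` B = A"
    using \<pi> by (auto simp: bij_imp_bij_inv image_iv_image bij_is_inj)
  have "bij_betw (conj_act \<pi>) (actions m A) (actions m B)"
    by (rule bij_betw_byWitness[where f' = "conj_act (iv \<pi>)"])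
      (use actions_conj[OF \<pi>(1), of _ m A] actions_conj[OF i(1), of _ m B] in
        \<open>auto simp: conj_conj_inv[OF \<pi>(1)] \<pi> i\<close>)
  then show ?thesis by (rule bij_betw_same_card)
qed

lemma finite_actions:
  assumes "finite A"
  shows "finite (actions m A)"
proof (rule finite_subset)
  show "actions m A \<subseteq> (\<lambda>(s, t). case_gen s t) ` ({s. s permutes A} \<times> {t. t permutes A})"
  proof
    fix p assume "p \<in> actions m A"
    then have "(p gx, p gy) \<in> {s. s permutes A} \<times> {t. t permutes A}" by (simp add: actions_def)
    moreover have "p = (\<lambda>(s, t). case_gen s t) (p gx, p gy)"
      by (auto simp: fun_eq_iff split: gen.split)
    ultimately show "p \<in> (\<lambda>(s, t). case_gen s t) ` ({s. s permutes A} \<times> {t. t permutes A})" by blast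
  qed
qed (use assms in \<open>simp add: finite_permutations\<close>)

lemma finite_transitive_actions: "finite A \<Longrightarrow> finite (transitive_actions m A b)"
  by (rule finite_subset[OF _ finite_actions]) (auto simp: transitive_actions_def gamma_action_iff)

text \<open>The orbit maps of both actions have the right cosets of the common stabiliser as their
  fibres. Matching the points that the same group elements reach is therefore an equivariant
  bijection, and it fixes \<open>b\<close>.\<close>

lemma same_stab_conj:
  assumes "finite A" and p: "gamma_action m A p b" and q: "gamma_action m A q b"
    and stab: "gamma_action.stab m p b = gamma_action.stab m q b"
  shows "\<exists>\<pi>. \<pi> permutes A - {b} \<and> q = conj_act \<pi> p"
proof -
  interpret p: gamma_action m A p b by fact
  interpret q: gamma_action m A q b by fact
  have same: "p.ea g b = p.ea h b \<longleftrightarrow> q.ea g b = q.ea h b" if "g \<in> carrier (Gamma3 m)" "h \<in> carrier (Gamma3 m)" for g h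
    using p.act_eq_iff_stab[OF that] q.act_eq_iff_stab[OF that] stab by simp
  \<comment> \<open>\<open>p.tr gx \<omega>\<close> is just one element that leads from
    \<open>b\<close> to \<omega> under \<open>p\<close>; by \<open>same\<close> every other one
    gives the same value.\<close>
  define \<pi> where "\<pi> \<omega> = (if \<omega> \<in> A then q.ea (p.tr gx \<omega>) b else \<omega>)" for \<omega>
  have \<pi>_ea: "\<pi> (p.ea g b) = q.ea g b" if "g \<in> carrier (Gamma3 m)" for g
    using same[of "p.tr gx (p.ea g b)" g] that p.act_tr p.act_closed[OF that p.w0] by (simp add: \<pi>_def)
  have "inj_on \<pi> A"
  proof (rule inj_onI)
    fix x y assume "x \<in> A" "y \<in> A" "\<pi> x = \<pi> y"
    then show "x = y"
      using same[of "p.tr gx x" "p.tr gx y"] by (simp add: \<pi>_def p.act_tr)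
  qed
  moreover have "\<pi> ` A \<subseteq> A"
    using q.act_closed q.w0 by (auto simp: \<pi>_def)
  ultimately have "bij_betw \<pi> A A"
    using assms(1) by (simp add: bij_betw_def endo_inj_surj)
  then have \<pi>: "\<pi> permutes A"
    by (rule bij_imp_permutes) (simp add: \<pi>_def)
  moreover have "\<pi> b = b"
    using \<pi>_ea[of "\<one>\<^bsub>Gamma3 m\<^esub>"] p.act_one q.act_one p.w0 by simp
  ultimately have "\<pi> permutes A - {b}"
    using permutes_superset[of \<pi> A "A - {b}"] by auto
  moreover have "q a x = conj_act \<pi> p a x" for a x
  proof -
    obtain \<omega> where x: "x = \<pi> \<omega>" using permutes_bij[OF \<pi>] by (meson bij_pointE)
    show ?thesis
    proof (cases "\<omega> \<in> A")
      case True
      let ?g = "p.tr gx \<omega> \<otimes>\<^bsub>Gamma3 m\<^esub> ge m a"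
      have "\<pi> (p a \<omega>) = \<pi> (p.ea ?g b)"
        using True p.w0 by (simp add: p.act_mult p.act_tr p.act_ge)
      also have "\<dots> = q.ea ?g b" by (rule \<pi>_ea) simp
      also have "\<dots> = q a (q.ea (p.tr gx \<omega>) b)"
        using q.w0 q.act_closed by (simp add: q.act_mult q.act_ge)
      also have "\<dots> = q a (\<pi> \<omega>)" using True by (simp add: \<pi>_def)
      finally show ?thesis by (simp add: x conj_apply permutes_bij[OF \<pi>])
    next
      case False
      then show ?thesis
        using permutes_not_in[OF p.perm] permutes_not_in[OF q.perm] permutes_not_in[OF \<pi>]
          conj_apply[OF permutes_bij[OF \<pi>], of p a \<omega>]
        by (simp add: x)
    qed
  qed
  ultimately show ?thesis by blast
qed

text \<open>The actions with a given stabiliser are the relabellings of \<open>p\<close> by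
  permutations that fix \<open>b\<close>. By transitivity different permutations give different
  actions, as they are determined by where the points \<open>gact p w b\<close> go.\<close>

lemma card_same_stab:
  assumes "finite A" and p: "gamma_action m A p b"
  shows "card {q \<in> transitive_actions m A b. gamma_action.stab m q b = gamma_action.stab m p b} = fact (card A - 1)"
proof -
  interpret p: gamma_action m A p b by fact
  have bijs: "bij \<pi>" "\<pi> ` A = A" "\<pi> b = b" if "\<pi> permutes A - {b}" for \<pi>
    using permutes_bij[OF that] permutes_image[OF permutes_subset[OF that, of A]] permutes_not_in[OF that, of b]
    by auto
  have "{q \<in> transitive_actions m A b. gamma_action.stab m q b = gamma_action.stab m p b}
      = (\<lambda>\<pi>. conj_act \<pi> p) ` {\<pi>. \<pi> permutes A - {b}}"
  proof (intro equalityI subsetI)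
    fix q assume "q \<in> {q \<in> transitive_actions m A b. gamma_action.stab m q b = gamma_action.stab m p b}"
    then show "q \<in> (\<lambda>\<pi>. conj_act \<pi> p) ` {\<pi>. \<pi> permutes A - {b}}"
      using same_stab_conj[OF assms, of q] by (auto simp: transitive_actions_def)
  next
    fix q assume "q \<in> (\<lambda>\<pi>. conj_act \<pi> p) ` {\<pi>. \<pi> permutes A - {b}}"
    then obtain \<pi> where \<pi>: "\<pi> permutes A - {b}" "q = conj_act \<pi> p" by blast
    then show "q \<in> {q \<in> transitive_actions m A b. gamma_action.stab m q b = gamma_action.stab m p b}"
      using gamma_action_conj[OF bijs(1) p, of \<pi>] stab_conj[OF bijs(1) p, of \<pi>] bijs[OF \<pi>(1)]
      by (simp add: transitive_actions_def)
  qed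
  moreover have "inj_on (\<lambda>\<pi>. conj_act \<pi> p) {\<pi>. \<pi> permutes A - {b}}"
  proof (rule inj_onI)
    fix \<pi> \<pi>' assume \<pi>: "\<pi> \<in> {\<pi>. \<pi> permutes A - {b}}" "\<pi>' \<in> {\<pi>. \<pi> permutes A - {b}}" "conj_act \<pi> p = conj_act \<pi>' p"
    have "\<pi> \<omega> = \<pi>' \<omega>" if A: "\<omega> \<in> A" for \<omega>
    proof -
      obtain w where w: "gact p w b = \<omega>" using p.transitive[OF A] by blast
      have "\<pi> (gact p w b) = gact (conj_act \<pi> p) w b" if "\<pi> permutes A - {b}" for \<pi>
        using gact_conj[of \<pi> p w b] bijs[OF that] permutes_bij[OF p.perm] by simp
      then show ?thesis using \<pi> w by (metis mem_Collect_eq)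
    qed
    moreover have "\<pi> \<omega> = \<pi>' \<omega>" if "\<omega> \<notin> A" for \<omega>
      using \<pi>(1,2) that by (simp add: permutes_not_in)
    ultimately show "\<pi> = \<pi>'" by blast
  qed
  ultimately have "card {q \<in> transitive_actions m A b. gamma_action.stab m q b = gamma_action.stab m p b}
      = card {\<pi>. \<pi> permutes A - {b}}"
    by (simp add: card_image)
  also have "\<dots> = fact (card A - 1)"
    using assms(1) p.w0 by (subst card_permutations[OF HOL.refl]) auto
  finally show ?thesis .
qed

theorem card_transitive_actions:
  assumes m: "m > 0" and k: "k > 0"
  shows "card (transitive_actions m {..<k} 0) = fact (k - 1) * card (free_subgroups m k)"
proof -
  let ?T = "transitive_actions m {..<k} (0::nat)"
  let ?S = "\<lambda>p. gamma_action.stab m p 0"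
  have T: "finite ?T" by (simp add: finite_transitive_actions)
  have "?S ` ?T = free_subgroups m k"
  proof (intro equalityI subsetI)
    fix H assume "H \<in> ?S ` ?T"
    then obtain p where p: "gamma_action m {..<k} p 0" "H = ?S p" by (auto simp: transitive_actions_def)
    interpret p: gamma_action m "{..<k}" p 0 by fact
    show "H \<in> free_subgroups m k"
      using p.subgroup_stab p.stab_free p.card_rcosets_stab by (simp add: free_subgroups_def p)
  next
    fix H assume "H \<in> free_subgroups m k"
    then show "H \<in> ?S ` ?T"
      using gamma_action_of_subgroup[OF m k, of H] by (auto simp: transitive_actions_def)
  qed
  moreover have "card ?T = (\<Sum>H\<in>?S ` ?T. card {q \<in> ?T. ?S q = H})"
    using sum.image_gen[OF T, of "\<lambda>_. 1::nat" ?S] by simp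
  moreover have "\<dots> = (\<Sum>H\<in>?S ` ?T. fact (k - 1))"
  proof (rule sum.cong[OF HOL.refl])
    fix H assume "H \<in> ?S ` ?T"
    then obtain p where "gamma_action m {..<k} p 0" "H = ?S p" by (auto simp: transitive_actions_def)
    then show "card {q \<in> ?T. ?S q = H} = fact (k - 1)"
      using card_same_stab[of "{..<k}" m p 0] by simp
  qed
  ultimately show ?thesis by simp
qed

section \<open>Decomposition of an action by the orbit of a point\<close>

definition restr :: "'b set \<Rightarrow> ('b \<Rightarrow> 'b) \<Rightarrow> 'b \<Rightarrow> 'b" where
  "restr O' f x = (if x \<in> O' then f x else x)"

lemma restr_permutes:
  assumes "f permutes A" "f ` O' = O'"
  shows "restr O' f permutes O'"
proof (rule bij_imp_permutes)
  have "inj_on (restr O' f) O'"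
    using permutes_inj[OF assms(1)] by (auto simp: restr_def inj_on_def)
  moreover have "restr O' f ` O' = O'" using assms(2) by (simp add: restr_def)
  ultimately show "bij_betw (restr O' f) O' O'" by (simp add: bij_betw_def)
qed (simp add: restr_def)

lemma restr_pow:
  assumes "f ` O' = O'" "x \<in> O'"
  shows "(restr O' f ^^ i) x = (f ^^ i) x \<and> (f ^^ i) x \<in> O'"
  by (induction i) (use assms in \<open>auto simp: restr_def\<close>)

lemma comp_pow:
  assumes q: "q permutes O'" and r: "r permutes A - O'"
  shows "x \<in> O' \<Longrightarrow> ((q \<circ> r) ^^ i) x = (q ^^ i) x"
    and "x \<notin> O' \<Longrightarrow> ((q \<circ> r) ^^ i) x = (r ^^ i) x"
proof -
  have qO: "(q ^^ i) x \<in> O'" if "x \<in> O'" for x i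
    using that by (induction i) (auto simp: permutes_in_image[OF q])
  have rO: "(r ^^ i) x \<notin> O'" if "x \<notin> O'" for x i
  proof (induction i)
    case (Suc i)
    then show ?case
      using permutes_in_image[OF r, of "(r ^^ i) x"] permutes_not_in[OF r, of "(r ^^ i) x"] by auto
  qed (use that in simp)
  show "((q \<circ> r) ^^ i) x = (q ^^ i) x" if "x \<in> O'"
    by (induction i) (use qO[OF that] permutes_not_in[OF r] in auto)
  show "((q \<circ> r) ^^ i) x = (r ^^ i) x" if "x \<notin> O'"
  proof (induction i)
    case (Suc i)
    then show ?case using rO[OF that, of "Suc i"] permutes_not_in[OF q] by simp
  qed simp
qed

lemma actions_comp:
  assumes q: "q \<in> actions m O'" and r: "r \<in> actions m (A - O')" and "O' \<subseteq> A"
  shows "(\<lambda>c. q c \<circ> r c) \<in> actions m A"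
proof -
  have p: "q c permutes O'" "r c permutes A - O'" for c
    using q r by (auto simp: actions_def)
  have "(q c \<circ> r c) permutes A" for c
    using p[of c] assms(3) by (intro permutes_compose) (auto intro: permutes_subset)
  moreover have "(((q c \<circ> r c) ^^ i) \<omega> = \<omega>) = (gord m c dvd i)" if "\<omega> \<in> A" for c \<omega> i
    using q r that comp_pow[OF p[of c], of \<omega> i] by (cases "\<omega> \<in> O'") (auto simp: actions_def)
  moreover have "((q gx \<circ> r gx) ^^ 2) \<omega> = ((q gy \<circ> r gy) ^^ 3) \<omega>" if "\<omega> \<in> A" for \<omega>
  proof (cases "\<omega> \<in> O'")
    case True
    then show ?thesis using q unfolding comp_pow(1)[OF p True] by (simp add: actions_def)
  next
    case False
    then show ?thesis using r that unfolding comp_pow(2)[OF p False] by (simp add: actions_def)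
  qed
  ultimately show ?thesis by (simp add: actions_def)
qed

lemma gact_comp:
  assumes q: "\<And>c. q c permutes O'" and r: "\<And>c. r c permutes A - O'" and "x \<in> O'"
  shows "gact (\<lambda>c. q c \<circ> r c) w x = gact q w x"
  using assms(3)
proof (induction w arbitrary: x)
  case (Cons l w)
  obtain a e where l: "l = (a, e)" by (cases l)
  have 1: "(q a \<circ> r a) y = q a y" if "y \<in> O'" for y
    using that permutes_not_in[OF r] by simp
  have in_O: "iv (q a) x \<in> O'" "q a x \<in> O'"
    using Cons.prems permutes_in_image[OF q] permutes_in_image[OF permutes_inv[OF q]] by auto
  have "bij (q a \<circ> r a)" using q r by (intro bij_comp permutes_bij) auto
  moreover have "(q a \<circ> r a) (iv (q a) x) = x"
    using 1[OF in_O(1)] permutes_inverses(1)[OF q] by simp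
  ultimately have "iv (q a \<circ> r a) x = iv (q a) x"
    by (metis bij_is_inj inv_f_f)
  then show ?case
    using Cons.IH[OF in_O(1)] Cons.IH[OF in_O(2)] 1[OF Cons.prems]
    by (cases e) (simp_all only: l wact_simps if_True if_False)
qed simp

lemma gact_restr:
  assumes "\<And>c. p c permutes A" "\<And>c. p c ` O' = O'" "x \<in> O'"
  shows "gact (\<lambda>c. restr O' (p c)) w x = gact p w x \<and> gact p w x \<in> O'"
  using assms(3)
proof (induction w arbitrary: x)
  case (Cons l w)
  obtain a e where l: "l = (a, e)" by (cases l)
  have in_O: "p a x \<in> O'" "iv (p a) x \<in> O'"
    using Cons.prems assms(2)[of a] permutes_inverses(2)[OF assms(1)] by (auto, metis imageE)
  have "restr O' (p a) (iv (p a) x) = x"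
    using in_O permutes_inverses(1)[OF assms(1)] by (simp add: restr_def)
  then have "iv (restr O' (p a)) x = iv (p a) x"
    using restr_permutes[OF assms(1,2)] by (metis permutes_inverses(2))
  then show ?case
    using Cons.IH[OF in_O(1)] Cons.IH[OF in_O(2)] restr_def[of O' "p a" x] Cons.prems
    by (cases e) (simp_all only: l wact_simps if_True if_False)
qed simp

lemma actions_restr:
  assumes p: "p \<in> actions m A" and O': "\<And>c. p c ` O' = O'" and "O' \<subseteq> A"
  shows "(\<lambda>c. restr O' (p c)) \<in> actions m O'"
proof -
  have "p c permutes A" for c using p by (simp add: actions_def)
  then have "restr O' (p c) permutes O'" for c by (rule restr_permutes[OF _ O'])
  then show ?thesis
    using assms unfolding actions_def by (auto simp: restr_pow[OF O'] simp del: funpow.simps)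
qed

text \<open>The restrictions to the orbit of \<open>a\<close> and to its complement, each extended
  by the identity, compose to the whole action. Conversely the orbit, and with it both restrictions,
  can be read off from the composite.\<close>

theorem card_actions_decomp:
  fixes A :: "nat set"
  assumes A: "finite A" and a: "a \<in> A" and m: "m > 0"
  shows "card (actions m A) = (\<Sum>O'\<in>{O'. a \<in> O' \<and> O' \<subseteq> A}. card (transitive_actions m O' a) * card (actions m (A - O')))"
proof -
  let ?I = "{O'. a \<in> O' \<and> O' \<subseteq> A}"
  let ?S = "SIGMA O' : ?I. transitive_actions m O' a \<times> actions m (A - O')"
  let ?f = "\<lambda>(O' :: nat set, q, r). (\<lambda>c. q c \<circ> r c) :: gen \<Rightarrow> nat \<Rightarrow> nat"
  have I: "finite ?I" using A by (rule finite_subset[rotated, OF finite_Pow_iff[THEN iffD2]]) auto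
  have "bij_betw ?f ?S (actions m A)"
    unfolding bij_betw_def
  proof
    have orbit: "O' = range (\<lambda>w. gact (?f (O', q, r)) w a)"
      and q_eq: "q = (\<lambda>c. restr O' (?f (O', q, r) c))" and r_eq: "r = (\<lambda>c. restr (A - O') (?f (O', q, r) c))"
      if "(O', q, r) \<in> ?S" for O' q r
    proof -
      have q: "gamma_action m O' q a" and r: "\<And>c. r c permutes A - O'"
        using that by (auto simp: transitive_actions_def actions_def)
      interpret q: gamma_action m O' q a by fact
      have eq: "gact (?f (O', q, r)) w a = gact q w a" for w
        using gact_comp[of q O' r A a w, OF q.perm r q.w0] by simp
      show "O' = range (\<lambda>w. gact (?f (O', q, r)) w a)"
        unfolding eq using q.transitive q.wact_S q.w0 by (auto simp: image_iff)
      have "q c x = restr O' (q c \<circ> r c) x" for c x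
        using permutes_not_in[OF r] permutes_not_in[OF q.perm] by (auto simp: restr_def)
      then show "q = (\<lambda>c. restr O' (?f (O', q, r) c))" by (simp add: fun_eq_iff)
      have "r c x = restr (A - O') (q c \<circ> r c) x" for c x
        using permutes_not_in[OF r] permutes_not_in[OF q.perm] permutes_in_image[OF r, of c x] by (auto simp: restr_def)
      then show "r = (\<lambda>c. restr (A - O') (?f (O', q, r) c))" by (simp add: fun_eq_iff)
    qed
    show "inj_on ?f ?S"
    proof (rule inj_onI)
      fix x y assume xy: "x \<in> ?S" "y \<in> ?S" "?f x = ?f y"
      obtain O1 q1 r1 where x: "x = (O1, q1, r1)" by (cases x)
      obtain O2 q2 r2 where y: "y = (O2, q2, r2)" by (cases y)
      note xS = xy(1)[unfolded x] and yS = xy(2)[unfolded y]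
      have e: "?f (O1, q1, r1) = ?f (O2, q2, r2)" using xy(3) unfolding x y .
      have "O1 = O2" using orbit[OF xS] orbit[OF yS] e by metis
      moreover have "q1 = q2" using q_eq[OF xS] q_eq[OF yS] e \<open>O1 = O2\<close> by metis
      moreover have "r1 = r2" using r_eq[OF xS] r_eq[OF yS] e \<open>O1 = O2\<close> by metis
      ultimately show "x = y" by (simp add: x y)
    qed
    show "?f ` ?S = actions m A"
    proof (intro equalityI subsetI)
      fix p assume "p \<in> ?f ` ?S"
      then show "p \<in> actions m A"
        by (auto simp: transitive_actions_def gamma_action_iff actions_comp)
    next
      fix p assume p: "p \<in> actions m A"
      then have perm: "p c permutes A" for c by (simp add: actions_def)
      define O' where "O' = range (\<lambda>w. gact p w a)"
      have aO: "a \<in> O'" by (auto simp: O'_def intro: range_eqI[where x = "[]"])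
      have wA: "gact p w x \<in> A" if "x \<in> A" for w x
        by (rule wact_closed[where G = UNIV])
          (use that permutes_in_image[OF perm] permutes_in_image[OF permutes_inv[OF perm]] in auto)
      then have OA: "O' \<subseteq> A" using a by (auto simp: O'_def)
      have step: "p c x \<in> O'" "iv (p c) x \<in> O'" if "x \<in> O'" for c x
      proof -
        obtain w where w: "x = gact p w a" using \<open>x \<in> O'\<close> by (auto simp: O'_def)
        have "p c x = gact p (w @ [(c, False)]) a" "iv (p c) x = gact p (w @ [(c, True)]) a"
          by (simp_all add: w)
        then show "p c x \<in> O'" "iv (p c) x \<in> O'" unfolding O'_def by blast+
      qed
      have inv_O: "p c ` O' = O'" for c
      proof
        show "O' \<subseteq> p c ` O'"
        proof
          fix x assume "x \<in> O'"
          then have "x = p c (iv (p c) x)" "iv (p c) x \<in> O'"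
            using step permutes_inverses(1)[OF perm] by auto
          then show "x \<in> p c ` O'" by blast
        qed
      qed (use step in auto)
      then have inv_co: "p c ` (A - O') = A - O'" for c
        using image_set_diff[OF permutes_inj[OF perm[of c]]] permutes_image[OF perm] by simp
      let ?q = "\<lambda>c. restr O' (p c)" and ?r = "\<lambda>c. restr (A - O') (p c)"
      have "\<exists>w. gact ?q w a = x" if "x \<in> O'" for x
        using that gact_restr[OF perm inv_O aO] by (auto simp: O'_def)
      then have "?q \<in> transitive_actions m O' a"
        using actions_restr[OF p inv_O OA] m aO by (simp add: transitive_actions_def gamma_action_iff)
      moreover have "?r \<in> actions m (A - O')"
        using actions_restr[OF p inv_co] by simp
      moreover have "p = ?f (O', ?q, ?r)"
      proof -
        have "p c x = ?q c (?r c x)" for c x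
        proof -
          consider "x \<in> O'" | "x \<in> A - O'" | "x \<notin> A" by blast
          then show ?thesis
          proof cases
            case 2
            then have "p c x \<notin> O'" using inv_co[of c] by blast
            then show ?thesis using 2 by (simp add: restr_def)
          qed (use OA permutes_not_in[OF perm] in \<open>auto simp: restr_def\<close>)
        qed
        then show ?thesis by (simp add: fun_eq_iff)
      qed
      ultimately show "p \<in> ?f ` ?S" using aO OA by (intro image_eqI[where x = "(O', ?q, ?r)"]) auto
    qed
  qed
  then have "card (actions m A) = card ?S" by (simp add: bij_betw_same_card)
  also have "\<dots> = (\<Sum>O'\<in>?I. card (transitive_actions m O' a \<times> actions m (A - O')))"
  proof (rule card_SigmaI[OF I])
    show "\<forall>O'\<in>?I. finite (transitive_actions m O' a \<times> actions m (A - O'))"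
      using A by (auto intro!: finite_transitive_actions finite_actions finite_cartesian_product intro: finite_subset)
  qed
  finally show ?thesis by (simp add: card_cartesian_product)
qed

text \<open>There are \<open>n choose j\<close> candidates for an orbit of 0 with
  \<open>Suc j\<close> points, and by relabelling only the size of the candidate matters.\<close>

lemma card_actions_rec:
  assumes m: "m > 0"
  shows "card (actions m {..<Suc n}) = (\<Sum>j\<le>n. (n choose j) * (card (transitive_actions m {..<Suc j} (0::nat)) * card (actions m {..<n - j})))"
proof -
  let ?I = "{O'. 0 \<in> O' \<and> O' \<subseteq> {..<Suc n}}"
  let ?g = "\<lambda>j. card (transitive_actions m {..<Suc j} (0::nat)) * card (actions m {..<n - j})"
  have I: "finite ?I" by (rule finite_subset[of _ "Pow {..<Suc n}"]) auto
  have eq: "card (transitive_actions m O' 0) * card (actions m ({..<Suc n} - O')) = ?g (card O' - 1)" if O: "O' \<in> ?I" for O' :: "nat set"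
  proof -
    have fin: "finite O'" using O finite_subset by blast
    have pos: "card O' > 0" using O fin by (auto simp: card_gt_0_iff)
    have le: "card O' \<le> Suc n" using O card_mono[of "{..<Suc n}" O'] by simp
    have "card (transitive_actions m O' 0) = card (transitive_actions m {..<Suc (card O' - 1)} (0::nat))"
      using O fin pos by (intro card_transitive_actions_cong) auto
    moreover have "card (actions m ({..<Suc n} - O')) = card (actions m {..<n - (card O' - 1)})"
    proof (rule card_actions_cong)
      have "card ({..<Suc n} - O') = Suc n - card O'"
        using card_Diff_subset[OF fin, of "{..<Suc n}"] O by simp
      then show "card ({..<Suc n} - O') = card {..<n - (card O' - 1)}" using pos by simp
    qed simp_all
    ultimately show ?thesis by simp
  qed
  have "card (actions m {..<Suc n}) = (\<Sum>O'\<in>?I. ?g (card O' - 1))"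
    unfolding card_actions_decomp[OF finite_lessThan lessThan_iff[THEN iffD2, OF zero_less_Suc] m]
    by (rule sum.cong) (use eq in auto)
  also have "\<dots> = (\<Sum>j\<le>n. \<Sum>O' | O' \<in> ?I \<and> card O' - 1 = j. ?g (card O' - 1))"
  proof (rule sum.group[symmetric, OF I])
    show "(\<lambda>O'. card O' - 1) ` ?I \<subseteq> {..n}"
    proof
      fix j assume "j \<in> (\<lambda>O'. card O' - 1) ` ?I"
      then obtain O' where O': "O' \<subseteq> {..<Suc n}" "j = card O' - 1" by blast
      then have "card O' \<le> Suc n" using card_mono[of "{..<Suc n}" O'] by simp
      then show "j \<in> {..n}" using O' by simp
    qed
  qed simp
  also have "\<dots> = (\<Sum>j\<le>n. (n choose j) * ?g j)"
  proof (rule sum.cong[OF HOL.refl])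
    fix j assume "j \<in> {..n}"
    have "bij_betw (insert 0) {B. B \<subseteq> {1..n} \<and> card B = j} {O'. O' \<in> ?I \<and> card O' - 1 = j}"
    proof (rule bij_betw_byWitness[where f' = "\<lambda>O'. O' - {0}"])
      show "\<forall>B\<in>{B. B \<subseteq> {1..n} \<and> card B = j}. insert 0 B - {0} = B" by auto
      show "\<forall>O'\<in>{O'. O' \<in> ?I \<and> card O' - 1 = j}. insert 0 (O' - {0}) = O'" by auto
      show "insert 0 ` {B. B \<subseteq> {1..n} \<and> card B = j} \<subseteq> {O'. O' \<in> ?I \<and> card O' - 1 = j}"
      proof
        fix O' assume "O' \<in> insert 0 ` {B. B \<subseteq> {1..n} \<and> card B = j}"
        then obtain B where B: "O' = insert 0 B" "B \<subseteq> {1..n}" "card B = j" by auto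
        then have "finite B" "0 \<notin> B" using finite_subset by auto
        then show "O' \<in> {O'. O' \<in> ?I \<and> card O' - 1 = j}" using B by auto
      qed
      show "(\<lambda>O'. O' - {0}) ` {O'. O' \<in> ?I \<and> card O' - 1 = j} \<subseteq> {B. B \<subseteq> {1..n} \<and> card B = j}"
        by (auto simp: less_Suc_eq_le)
    qed
    then have "card {O'. O' \<in> ?I \<and> card O' - 1 = j} = card {B. B \<subseteq> {1..n} \<and> card B = j}"
      by (simp add: bij_betw_same_card)
    also have "\<dots> = n choose j" using n_subsets[of "{1..n}" j] by simp
    finally show "(\<Sum>O' | O' \<in> ?I \<and> card O' - 1 = j. ?g (card O' - 1)) = (n choose j) * ?g j"
      by simp
  qed
  finally show ?thesis .
qed

section \<open>Counting actions\<close>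

text \<open>For positive \<open>c\<close>, the permutations of \<open>A\<close> all of whose cycles
  have length \<open>c\<close>.\<close>

definition semi :: "nat \<Rightarrow> 'b set \<Rightarrow> ('b \<Rightarrow> 'b) set" where
  "semi c A = {s. s permutes A \<and> (\<forall>x\<in>A. \<forall>i. (s ^^ i) x = x \<longleftrightarrow> c dvd i)}"

lemma finite_semi: "finite A \<Longrightarrow> finite (semi c A)"
  by (rule finite_subset[OF _ finite_permutations[of A]]) (auto simp: semi_def)

lemma semi_restr:
  assumes "s \<in> semi c A" "s ` O' = O'" "O' \<subseteq> A"
  shows "restr O' s \<in> semi c O'"
  using assms restr_permutes[of s A O'] by (auto simp: semi_def restr_pow)

lemma semi_comp:
  assumes q: "q \<in> semi c O'" and r: "r \<in> semi c (A - O')" and "O' \<subseteq> A"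
  shows "q \<circ> r \<in> semi c A"
proof -
  have p: "q permutes O'" "r permutes A - O'"
    using q r by (auto simp: semi_def)
  have "(q \<circ> r) permutes A"
    using p assms(3) by (intro permutes_compose) (auto intro: permutes_subset)
  moreover have "(((q \<circ> r) ^^ i) x = x) = (c dvd i)" if "x \<in> A" for x i
    using q r that comp_pow[OF p, of x i] by (cases "x \<in> O'") (auto simp: semi_def)
  ultimately show ?thesis by (simp add: semi_def)
qed

lemma semi_pow_eq:
  assumes s: "s \<in> semi c A" and a: "a \<in> A"
  shows "(s ^^ i) a = (s ^^ j) a \<longleftrightarrow> i mod c = j mod c"
proof (induction i j rule: linorder_wlog)
  case (le i j)
  have "inj (s ^^ i)" using s by (auto simp: semi_def intro: inj_fn permutes_inj)
  moreover have "(s ^^ j) a = (s ^^ i) ((s ^^ (j - i)) a)"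
    using le by (metis comp_apply funpow_add le_add_diff_inverse)
  ultimately have "(s ^^ i) a = (s ^^ j) a \<longleftrightarrow> (s ^^ (j - i)) a = a"
    by (auto simp: inj_eq)
  also have "\<dots> \<longleftrightarrow> c dvd j - i" using assms by (simp add: semi_def)
  also have "\<dots> \<longleftrightarrow> j mod c = i mod c" using le by (simp add: mod_eq_dvd_iff_nat)
  finally show ?case by auto
qed auto

lemma semi_pow_in: "s \<in> semi c A \<Longrightarrow> a \<in> A \<Longrightarrow> (s ^^ i) a \<in> A"
  by (induction i) (auto simp: semi_def permutes_in_image)

definition orbit_list :: "nat \<Rightarrow> ('b \<Rightarrow> 'b) \<Rightarrow> 'b \<Rightarrow> 'b list" where
  "orbit_list c s a = map (\<lambda>i. (s ^^ i) a) [0..<c]"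

lemma set_orbit_list:
  assumes "s \<in> semi c A" "a \<in> A" "c > 0"
  shows "set (orbit_list c s a) = range (\<lambda>i. (s ^^ i) a)"
proof
  show "range (\<lambda>i. (s ^^ i) a) \<subseteq> set (orbit_list c s a)"
  proof clarify
    fix i
    have "(s ^^ i) a = (s ^^ (i mod c)) a" using semi_pow_eq[OF assms(1,2)] by simp
    then show "(s ^^ i) a \<in> set (orbit_list c s a)" using assms(3) by (auto simp: orbit_list_def)
  qed
qed (auto simp: orbit_list_def)

lemma orbit_list_props:
  assumes "s \<in> semi c A" "a \<in> A" "c > 0"
  shows "length (orbit_list c s a) = c" "distinct (orbit_list c s a)" "set (orbit_list c s a) \<subseteq> A"
    "s ` set (orbit_list c s a) = set (orbit_list c s a)" "\<exists>ys. orbit_list c s a = a # ys"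
proof -
  show "length (orbit_list c s a) = c" by (simp add: orbit_list_def)
  show "distinct (orbit_list c s a)"
    by (auto simp: orbit_list_def distinct_map inj_on_def semi_pow_eq[OF assms(1,2)])
  show "set (orbit_list c s a) \<subseteq> A" using semi_pow_in[OF assms(1,2)] by (auto simp: orbit_list_def)
  show "s ` set (orbit_list c s a) = set (orbit_list c s a)"
    unfolding set_orbit_list[OF assms]
  proof
    show "range (\<lambda>i. (s ^^ i) a) \<subseteq> s ` range (\<lambda>i. (s ^^ i) a)"
    proof clarify
      fix i
      have "(s ^^ i) a = (s ^^ Suc (i + (c - 1))) a"
        using assms(3) by (subst semi_pow_eq[OF assms(1,2)]) simp
      then show "(s ^^ i) a \<in> s ` range (\<lambda>i. (s ^^ i) a)" by auto
    qed
    show "s ` range (\<lambda>i. (s ^^ i) a) \<subseteq> range (\<lambda>i. (s ^^ i) a)"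
      by (auto intro: range_eqI[where x = "Suc _"])
  qed
  show "\<exists>ys. orbit_list c s a = a # ys"
    using assms(3) by (auto simp: orbit_list_def upt_conv_Cons)
qed

lemma cycle_of_list_pow:
  assumes "distinct xs" "j < length xs"
  shows "(cycle_of_list xs ^^ i) (xs ! j) = xs ! ((i + j) mod length xs)"
proof -
  have "map (cycle_of_list xs ^^ i) xs ! j = rotate i xs ! j"
    using cyclic_rotation[OF assms(1), of i] by simp
  then show ?thesis using assms(2) by (simp add: nth_rotate)
qed

lemma cycle_of_list_semi:
  assumes "distinct xs" "length xs = c"
  shows "cycle_of_list xs \<in> semi c (set xs)"
proof -
  have "((cycle_of_list xs ^^ i) x = x) = (c dvd i)" if x: "x \<in> set xs" for x i
  proof -
    obtain j where j: "j < c" "x = xs ! j" using x assms(2) by (metis in_set_conv_nth)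
    have "(cycle_of_list xs ^^ i) x = x \<longleftrightarrow> xs ! ((i + j) mod c) = xs ! j"
      using cycle_of_list_pow[OF assms(1), of j i] assms(2) j by simp
    also have "\<dots> \<longleftrightarrow> (i + j) mod c = j mod c"
      using assms j by (subst nth_eq_iff_index_eq) auto
    also have "\<dots> \<longleftrightarrow> c dvd i" by (simp add: mod_eq_dvd_iff_nat)
    finally show ?thesis .
  qed
  then show ?thesis using cycle_permutes[of xs] assms(1) by (simp add: semi_def)
qed

lemma restr_orbit_list:
  assumes "s \<in> semi c A" "a \<in> A" "c > 0"
  shows "restr (set (orbit_list c s a)) s = cycle_of_list (orbit_list c s a)"
proof
  fix x
  let ?xs = "orbit_list c s a"
  note o = orbit_list_props[OF assms]
  show "restr (set ?xs) s x = cycle_of_list ?xs x"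
  proof (cases "x \<in> set ?xs")
    case True
    then obtain j where j: "j < c" "x = ?xs ! j" using o(1) by (metis in_set_conv_nth)
    have "s x = (s ^^ Suc j) a" using j by (simp add: orbit_list_def)
    also have "\<dots> = (s ^^ (Suc j mod c)) a" by (subst semi_pow_eq[OF assms(1,2)]) simp
    also have "\<dots> = ?xs ! (Suc j mod c)" using assms(3) by (simp add: orbit_list_def)
    also have "\<dots> = cycle_of_list ?xs x"
      using cycle_of_list_pow[OF o(2), of j 1] j o(1) by simp
    finally show ?thesis using True by (simp add: restr_def)
  next
    case False
    then show ?thesis by (simp add: restr_def id_outside_supp)
  qed
qed

text \<open>Removes the cycle through \<open>a\<close>. Written down from \<open>a\<close> onwards
  it is a unique list \<open>a # ys\<close>, so cycles are counted by lists
  \<open>ys\<close>.\<close>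

lemma card_semi_decomp:
  assumes A: "finite A" and a: "a \<in> A" and c: "c > 0"
  shows "card (semi c A) = (\<Sum>ys | length ys = c - 1 \<and> distinct ys \<and> set ys \<subseteq> A - {a}. card (semi c (A - set (a # ys))))"
proof -
  let ?L = "{ys. length ys = c - 1 \<and> distinct ys \<and> set ys \<subseteq> A - {a}}"
  let ?S = "SIGMA ys : ?L. semi c (A - set (a # ys))"
  let ?f = "\<lambda>(ys, r). cycle_of_list (a # ys) \<circ> r"
  have L: "distinct (a # ys)" "length (a # ys) = c" "set (a # ys) \<subseteq> A" if "ys \<in> ?L" for ys
    using that a c by auto
  have fin: "finite ?L"
    by (rule finite_subset[OF _ finite_lists_length_eq[OF A, of "c - 1"]]) auto
  have "bij_betw ?f ?S (semi c A)"
    unfolding bij_betw_def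
  proof
    have inv: "orbit_list c (?f (ys, r)) a = a # ys" "r = restr (A - set (a # ys)) (?f (ys, r))"
      if "ys \<in> ?L" "r \<in> semi c (A - set (a # ys))" for ys r
    proof -
      note L = L[OF that(1)]
      have q: "cycle_of_list (a # ys) permutes set (a # ys)" using L by (intro cycle_permutes)
      have r: "r permutes A - set (a # ys)" using that(2) by (simp add: semi_def)
      show "orbit_list c (?f (ys, r)) a = a # ys"
      proof (rule nth_equalityI)
        fix i assume "i < length (orbit_list c (?f (ys, r)) a)"
        then have i: "i < c" by (simp add: orbit_list_def)
        have "((cycle_of_list (a # ys) \<circ> r) ^^ i) a = (cycle_of_list (a # ys) ^^ i) ((a # ys) ! 0)"
          using comp_pow(1)[OF q r, of a i] by simp
        also have "\<dots> = (a # ys) ! i"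
          using cycle_of_list_pow[OF L(1), of 0 i] i unfolding L(2) using c by simp
        finally show "orbit_list c (?f (ys, r)) a ! i = (a # ys) ! i"
          using i by (simp add: orbit_list_def)
      qed (use L(2) in \<open>simp add: orbit_list_def\<close>)
      have "r x = restr (A - set (a # ys)) (cycle_of_list (a # ys) \<circ> r) x" for x
        using permutes_not_in[OF q, of "r x"] permutes_not_in[OF r, of x] permutes_in_image[OF r, of x]
        unfolding restr_def by (auto simp del: cycle_of_list.simps)
      then show "r = restr (A - set (a # ys)) (?f (ys, r))" by (simp add: fun_eq_iff)
    qed
    show "inj_on ?f ?S"
    proof (rule inj_onI)
      fix x y assume xy: "x \<in> ?S" "y \<in> ?S" "?f x = ?f y"
      obtain y1 r1 where x: "x = (y1, r1)" by (cases x)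
      obtain y2 r2 where y: "y = (y2, r2)" by (cases y)
      have 1: "y1 \<in> ?L" "r1 \<in> semi c (A - set (a # y1))" using xy(1) unfolding x by auto
      have 2: "y2 \<in> ?L" "r2 \<in> semi c (A - set (a # y2))" using xy(2) unfolding y by auto
      have e: "?f (y1, r1) = ?f (y2, r2)" using xy(3) unfolding x y .
      have "a # y1 = orbit_list c (?f (y1, r1)) a" by (rule inv(1)[OF 1, symmetric])
      also have "\<dots> = orbit_list c (?f (y2, r2)) a" by (simp only: e)
      also have "\<dots> = a # y2" by (rule inv(1)[OF 2])
      finally have "y1 = y2" by simp
      have "r1 = restr (A - set (a # y1)) (?f (y1, r1))" by (rule inv(2)[OF 1])
      also have "\<dots> = restr (A - set (a # y2)) (?f (y2, r2))"
        unfolding e unfolding \<open>y1 = y2\<close> by (rule HOL.refl)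
      also have "\<dots> = r2" by (rule inv(2)[OF 2, symmetric])
      finally have "r1 = r2" .
      note \<open>y1 = y2\<close>
      moreover note \<open>r1 = r2\<close>
      ultimately show "x = y" by (simp add: x y)
    qed
    show "?f ` ?S = semi c A"
    proof (intro equalityI subsetI)
      fix s assume "s \<in> ?f ` ?S"
      then obtain ys r where s: "s = cycle_of_list (a # ys) \<circ> r" "ys \<in> ?L" "r \<in> semi c (A - set (a # ys))"
        by auto
      show "s \<in> semi c A"
        unfolding s(1) using L[OF s(2)] s(3) by (intro semi_comp[OF cycle_of_list_semi])
    next
      fix s assume s: "s \<in> semi c A"
      note o = orbit_list_props[OF s a c]
      obtain ys where ys: "orbit_list c s a = a # ys" using o(5) by blast
      let ?O = "set (a # ys)"
      have perm: "s permutes A" using s by (simp add: semi_def)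
      have O: "s ` ?O = ?O" "?O \<subseteq> A" using o by (simp_all only: ys)
      have co: "s ` (A - ?O) = A - ?O"
        using image_set_diff[OF permutes_inj[OF perm]] permutes_image[OF perm] O by simp
      have "s x = (cycle_of_list (a # ys) \<circ> restr (A - ?O) s) x" for x
      proof -
        have cyc: "cycle_of_list (a # ys) = restr ?O s"
          using restr_orbit_list[OF s a c] unfolding ys ..
        consider "x \<in> ?O" | "x \<in> A - ?O" | "x \<notin> A" by blast
        then show ?thesis
        proof cases
          case 2
          then have "s x \<notin> ?O" using co by blast
          then show ?thesis using 2 unfolding cyc by (simp add: restr_def)
        qed (use O(2) permutes_not_in[OF perm] in \<open>unfold cyc, auto simp: restr_def\<close>)
      qed
      then have "s = ?f (ys, restr (A - ?O) s)" by (simp add: fun_eq_iff)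
      moreover have "ys \<in> ?L" using o(1-3) unfolding ys by auto
      moreover have "restr (A - ?O) s \<in> semi c (A - ?O)"
        by (rule semi_restr[OF s co]) auto
      ultimately show "s \<in> ?f ` ?S" by (intro image_eqI[where x = "(ys, restr (A - ?O) s)"]) auto
    qed
  qed
  then have "card (semi c A) = card ?S" by (simp add: bij_betw_same_card)
  also have "\<dots> = (\<Sum>ys\<in>?L. card (semi c (A - set (a # ys))))"
    by (rule card_SigmaI[OF fin]) (use A in \<open>auto intro!: finite_semi\<close>)
  finally show ?thesis .
qed

text \<open>With \<open>c * (k + 1)\<close> points, the cycle through a given one can be chosen in
  \<open>fact (c * (k + 1) - 1) / fact (c * k)\<close> ways. The missing factor
  \<open>c * (k + 1)\<close> of the factorial accounts for the growth of
  \<open>c ^ k * fact k\<close>.\<close>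

theorem card_semi:
  assumes "c > 0" "finite A" "card A = c * k"
  shows "card (semi c A) * (c ^ k * fact k) = fact (c * k)"
  using assms(2,3)
proof (induction k arbitrary: A)
  case 0
  then have "semi c A = {id}" by (auto simp: semi_def)
  then show ?case by simp
next
  case (Suc k)
  then obtain a where a: "a \<in> A" using assms(1) by fastforce
  let ?L = "{ys. length ys = c - 1 \<and> distinct ys \<and> set ys \<subseteq> A - {a}}"
  have sub: "card (semi c (A - set (a # ys))) * (c ^ k * fact k) = fact (c * k)" if "ys \<in> ?L" for ys
  proof (rule Suc.IH)
    have "distinct (a # ys)" "set (a # ys) \<subseteq> A" "length (a # ys) = c" using that a assms(1) by auto
    then have "card (A - set (a # ys)) = card A - c"
      by (metis card_Diff_subset distinct_card List.finite_set)
    then show "card (A - set (a # ys)) = c * k" using Suc.prems by simp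
  qed (use Suc.prems in simp)
  have "card ?L = \<Prod>{card (A - {a}) - (c - 1) + 1..card (A - {a})}"
    by (rule card_lists_distinct_length_eq) (use Suc.prems a assms(1) in \<open>auto simp: card_Diff_singleton\<close>)
  also have "card (A - {a}) - (c - 1) + 1 = Suc (c * k)"
    using Suc.prems a assms(1) by (simp add: card_Diff_singleton)
  also have "card (A - {a}) = c * Suc k - 1"
    using Suc.prems a by (simp add: card_Diff_singleton)
  finally have "card ?L * fact (c * k) = fact (c * Suc k - 1)"
    using fact_eq_fact_times[of "c * k" "c * Suc k - 1"] assms(1) by (simp add: mult.commute)
  moreover have "card (semi c A) * (c ^ k * fact k) = card ?L * fact (c * k)"
    unfolding card_semi_decomp[OF Suc.prems(1) a assms(1)] sum_distrib_right
    using sub by simp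
  ultimately have "card (semi c A) * (c ^ k * fact k) * (c * Suc k) = fact (c * Suc k - 1) * (c * Suc k)"
    by simp
  also have "\<dots> = fact (c * Suc k)"
    using assms(1) fact_reduce[of "c * Suc k", where ?'a = nat] by (simp add: mult.commute)
  finally show ?case by (simp add: algebra_simps)
qed

text \<open>Permutations of the same cycle type are conjugate: match one cycle with one cycle and
  continue on the complements.\<close>

lemma semi_equivariant_bij:
  assumes "c > 0" "finite A" "finite B" "card A = card B" "s \<in> semi c A" "t \<in> semi c B"
  shows "\<exists>f. bij_betw f A B \<and> (\<forall>x\<in>A. f (s x) = t (f x))"
  using assms(2-)
proof (induction "card A" arbitrary: A B s t rule: less_induct)
  case less
  show ?case
  proof (cases "A = {}")
    case True
    then show ?thesis using less.prems by (simp add: bij_betw_def)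
  next
    case False
    then have "B \<noteq> {}" using less.prems by auto
    then obtain a b where ab: "a \<in> A" "b \<in> B" using False by blast
    define P where "P = set (orbit_list c s a)"
    define Q where "Q = set (orbit_list c t b)"
    note oa = orbit_list_props[OF less.prems(4) ab(1) assms(1), folded P_def]
    note ob = orbit_list_props[OF less.prems(5) ab(2) assms(1), folded Q_def]
    have P: "P = range (\<lambda>i. (s ^^ i) a)" and Q: "Q = range (\<lambda>i. (t ^^ i) b)"
      unfolding P_def Q_def using set_orbit_list less.prems(4,5) ab assms(1) by metis+
    have card: "card P = c" "card Q = c"
      unfolding P_def Q_def using oa(1,2) ob(1,2) by (simp_all add: distinct_card)
    have perm: "s permutes A" "t permutes B" using less.prems(4,5) by (auto simp: semi_def)
    have co: "s ` (A - P) = A - P" "t ` (B - Q) = B - Q"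
      using image_set_diff[OF permutes_inj[OF perm(1)]] permutes_image[OF perm(1)] oa(4)
        image_set_diff[OF permutes_inj[OF perm(2)]] permutes_image[OF perm(2)] ob(4) by simp_all
    have fin: "finite P" "finite Q" by (simp_all add: P_def Q_def)
    have cards: "card (A - P) = card A - c" "card (B - Q) = card B - c"
      using card oa(3) ob(3) fin by (simp_all add: card_Diff_subset)
    have "card A > 0" using False less.prems(1) by (simp add: card_gt_0_iff)
    then have lt: "card (A - P) < card A" using cards assms(1) by simp
    have "\<exists>g. bij_betw g (A - P) (B - Q) \<and> (\<forall>x\<in>A - P. g (restr (A - P) s x) = restr (B - Q) t (g x))"
      by (rule less.hyps[OF lt])
        (use less.prems cards semi_restr[OF less.prems(4) co(1)] semi_restr[OF less.prems(5) co(2)] in auto)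
    then obtain g where g: "bij_betw g (A - P) (B - Q)" "\<And>x. x \<in> A - P \<Longrightarrow> g (restr (A - P) s x) = restr (B - Q) t (g x)"
      by blast
    \<comment> \<open>The exponent is determined only modulo \<open>c\<close>, but \<open>t\<close>
      has the same cycle length, so the least one serves as well as any other.\<close>
    define h where "h x = (t ^^ (LEAST i. (s ^^ i) a = x)) b" for x
    have h: "h ((s ^^ i) a) = (t ^^ i) b" for i
    proof -
      have "(s ^^ (LEAST j. (s ^^ j) a = (s ^^ i) a)) a = (s ^^ i) a" by (rule LeastI) simp
      then show ?thesis
        unfolding h_def semi_pow_eq[OF less.prems(5) ab(2)] semi_pow_eq[OF less.prems(4) ab(1)] .
    qed
    define f where "f x = (if x \<in> P then h x else g x)" for x
    have "bij_betw h P Q"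
    proof (rule bij_betw_imageI)
      show "inj_on h P"
        by (auto simp: inj_on_def P h semi_pow_eq[OF less.prems(5) ab(2)] semi_pow_eq[OF less.prems(4) ab(1)])
      show "h ` P = Q" by (auto simp: P Q h image_image)
    qed
    then have "bij_betw f P Q" by (rule bij_betw_cong[THEN iffD1, rotated]) (simp add: f_def)
    moreover have "bij_betw f (A - P) (B - Q)"
      using g(1) by (rule bij_betw_cong[THEN iffD1, rotated]) (simp add: f_def)
    ultimately have "bij_betw f (P \<union> (A - P)) (Q \<union> (B - Q))"
      by (rule bij_betw_combine) auto
    moreover have "P \<union> (A - P) = A" "Q \<union> (B - Q) = B" using oa(3) ob(3) by auto
    ultimately have "bij_betw f A B" by simp
    moreover have "f (s x) = t (f x)" if "x \<in> A" for x
    proof (cases "x \<in> P")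
      case True
      then obtain i where i: "x = (s ^^ i) a" by (auto simp: P)
      have "s x \<in> P" using True oa(4) by blast
      then show ?thesis using True h[of i] h[of "Suc i"] by (simp add: f_def i)
    next
      case False
      then have "x \<in> A - P" using that by simp
      then have "s x \<in> A - P" "g x \<in> B - Q" using co(1) g(1) by (auto simp: bij_betw_def)
      then show ?thesis using g(2)[OF \<open>x \<in> A - P\<close>] \<open>x \<in> A - P\<close> by (simp add: f_def restr_def)
    qed
    ultimately show ?thesis by blast
  qed
qed

section \<open>Roots of permutations with equal cycle lengths\<close>

definition roots :: "nat \<Rightarrow> nat \<Rightarrow> 'b set \<Rightarrow> ('b \<Rightarrow> 'b) \<Rightarrow> ('b \<Rightarrow> 'b) set" where
  "roots q m A \<rho> = {s \<in> semi (q * m) A. s ^^ q = \<rho>}"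

lemma conj_roots:
  assumes \<pi>: "\<pi> permutes A" and \<rho>: "\<pi> \<circ> \<rho> = \<rho>' \<circ> \<pi>" and s: "s \<in> roots q m A \<rho>"
  shows "\<pi> \<circ> s \<circ> iv \<pi> \<in> roots q m A \<rho>'"
proof -
  have pow: "((\<pi> \<circ> s \<circ> iv \<pi>) ^^ i) = \<pi> \<circ> (s ^^ i) \<circ> iv \<pi>" for i
    by (induction i) (auto simp: fun_eq_iff permutes_inverses[OF \<pi>])
  have "s permutes A" using s by (simp add: roots_def semi_def)
  then have "(\<pi> \<circ> s \<circ> iv \<pi>) permutes A" using \<pi> by (intro permutes_compose permutes_inv)
  moreover have "(((\<pi> \<circ> s \<circ> iv \<pi>) ^^ i) x = x) = (q * m dvd i)" if "x \<in> A" for x i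
  proof -
    have x': "iv \<pi> x \<in> A" using that permutes_in_image[OF permutes_inv[OF \<pi>]] by simp
    have "((\<pi> \<circ> s \<circ> iv \<pi>) ^^ i) x = x \<longleftrightarrow> (s ^^ i) (iv \<pi> x) = iv \<pi> x"
      unfolding pow by (metis comp_apply permutes_inverses[OF \<pi>])
    then show ?thesis using s x' by (simp add: roots_def semi_def)
  qed
  moreover have "\<pi> \<circ> (s ^^ q) \<circ> iv \<pi> = \<rho>'"
    using s \<rho> by (simp add: roots_def fun_eq_iff permutes_inverses[OF \<pi>])
  ultimately show ?thesis unfolding roots_def semi_def by (simp add: pow)
qed

text \<open>A bijection that carries \<rho> to \<rho>' carries the roots of the one to the roots of
  the other by conjugation.\<close>

lemma card_roots_cong:
  assumes m: "m > 0" and A: "finite A" and \<rho>: "\<rho> \<in> semi m A" "\<rho>' \<in> semi m A"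
  shows "card (roots q m A \<rho>) = card (roots q m A \<rho>')"
proof -
  obtain f where f: "bij_betw f A A" "\<And>x. x \<in> A \<Longrightarrow> f (\<rho> x) = \<rho>' (f x)"
    using semi_equivariant_bij[OF m A A HOL.refl \<rho>] by blast
  define \<pi> where "\<pi> = restr A f"
  have "bij_betw \<pi> A A"
    using f(1) by (rule bij_betw_cong[THEN iffD1, rotated]) (simp add: \<pi>_def restr_def)
  then have \<pi>: "\<pi> permutes A" by (rule bij_imp_permutes) (simp add: \<pi>_def restr_def)
  have perm: "\<rho> permutes A" "\<rho>' permutes A" using \<rho> by (auto simp: semi_def)
  have "\<pi> (\<rho> x) = \<rho>' (\<pi> x)" for x
    using f(2)[of x] permutes_not_in[OF perm(1)] permutes_not_in[OF perm(2)] permutes_in_image[OF perm(1), of x]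
    by (cases "x \<in> A") (auto simp: \<pi>_def restr_def)
  then have c: "\<pi> \<circ> \<rho> = \<rho>' \<circ> \<pi>" by (simp add: fun_eq_iff)
  then have c': "iv \<pi> \<circ> \<rho>' = \<rho> \<circ> iv \<pi>"
    by (metis comp_apply permutes_inverses[OF \<pi>] ext)
  have iv: "iv (iv \<pi>) = \<pi>" using permutes_bij[OF \<pi>] by (rule inv_inv_eq)
  have "bij_betw (\<lambda>s. \<pi> \<circ> s \<circ> iv \<pi>) (roots q m A \<rho>) (roots q m A \<rho>')"
  proof (rule bij_betw_byWitness[where f' = "\<lambda>s. iv \<pi> \<circ> s \<circ> \<pi>"])
    show "(\<lambda>s. iv \<pi> \<circ> s \<circ> \<pi>) ` roots q m A \<rho>' \<subseteq> roots q m A \<rho>"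
      using conj_roots[OF permutes_inv[OF \<pi>] c'] unfolding iv by blast
  qed (use conj_roots[OF \<pi> c] in \<open>auto simp: fun_eq_iff permutes_inverses[OF \<pi>]\<close>)
  then show ?thesis by (rule bij_betw_same_card)
qed

lemma permutes_pow: "s permutes A \<Longrightarrow> (s ^^ i) permutes A"
proof (induction i)
  case (Suc i)
  then show ?case using permutes_compose[of "s ^^ i" A s] by (simp only: funpow.simps)
qed (simp add: permutes_id)

lemma semi_power:
  assumes "q > 0" "s \<in> semi (q * m) A"
  shows "s ^^ q \<in> semi m A"
proof -
  have "((s ^^ q) ^^ i) x = x \<longleftrightarrow> m dvd i" if "x \<in> A" for x i
  proof -
    have "((s ^^ q) ^^ i) x = x \<longleftrightarrow> q * m dvd q * i"
      using assms(2) that by (simp add: semi_def funpow_mult)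
    then show ?thesis using assms(1) by simp
  qed
  then show ?thesis using assms(2) permutes_pow by (auto simp: semi_def)
qed

lemma card_semi_roots:
  assumes m: "m > 0" and q: "q > 0" and A: "finite A" and \<rho>: "\<rho> \<in> semi m A"
  shows "card (semi (q * m) A) = card (semi m A) * card (roots q m A \<rho>)"
proof -
  have "card (semi (q * m) A) = (\<Sum>\<rho>'\<in>semi m A. card {s \<in> semi (q * m) A. s ^^ q = \<rho>'})"
  proof -
    have "(\<lambda>s. s ^^ q) ` semi (q * m) A \<subseteq> semi m A" using semi_power[OF q] by blast
    from sum.group[OF finite_semi[OF A] finite_semi[OF A] this, of "\<lambda>_. 1::nat"] show ?thesis by simp
  qed
  also have "\<dots> = (\<Sum>\<rho>'\<in>semi m A. card (roots q m A \<rho>))"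
    using card_roots_cong[OF m A _ \<rho>] by (intro sum.cong) (auto simp: roots_def)
  finally show ?thesis by simp
qed

text \<open>An action is a common value \<rho> of \<open>x^2\<close> and \<open>y^3\<close> with a
  square root and a cube root of it. By \<open>card_semi_roots\<close> the number of
  \<open>q\<close>-th roots is the quotient of the sizes of \<open>semi (q * m) A\<close> and
  \<open>semi m A\<close>; the statement is cleared of these denominators.\<close>

theorem card_actions_semi:
  assumes m: "m > 0" and A: "finite A"
  shows "card (actions m A) * card (semi m A) = card (semi (2 * m) A) * card (semi (3 * m) A)"
proof (cases "semi m A = {}")
  case True
  then have "semi (2 * m) A = {}" using semi_power[of 2 _ m A] by auto
  then show ?thesis using True by simp
next
  case False
  then obtain \<rho> where \<rho>: "\<rho> \<in> semi m A" by blast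
  let ?S = "SIGMA \<rho> : semi m A. roots 2 m A \<rho> \<times> roots 3 m A \<rho>"
  have fin: "finite (roots q m A \<rho>')" for q \<rho>'
    by (rule finite_subset[OF _ finite_semi[OF A]]) (auto simp: roots_def)
  have "bij_betw (\<lambda>p. (p gx ^^ 2, p gx, p gy)) (actions m A) ?S"
  proof (rule bij_betw_byWitness[where f' = "\<lambda>(\<rho>, s, t). case_gen s t"])
    show "\<forall>p\<in>actions m A. (case (p gx ^^ 2, p gx, p gy) of (\<rho>, s, t) \<Rightarrow> case_gen s t) = p"
      by (auto simp: fun_eq_iff split: gen.split)
    show "\<forall>x\<in>?S. (\<lambda>p. (p gx ^^ 2, p gx, p gy)) (case x of (\<rho>, s, t) \<Rightarrow> case_gen s t) = x"
      by (auto simp: roots_def)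
    show "(\<lambda>p. (p gx ^^ 2, p gx, p gy)) ` actions m A \<subseteq> ?S"
    proof clarify
      fix p assume p: "p \<in> actions m A"
      have g: "gord m gx = 2 * m" "gord m gy = 3 * m" by (simp_all add: gord_def)
      have s: "p gx \<in> semi (2 * m) A" "p gy \<in> semi (3 * m) A"
        using p unfolding actions_def semi_def g[symmetric] by blast+
      have perm: "p c permutes A" for c using p by (simp add: actions_def)
      have "(p gx ^^ 2) x = (p gy ^^ 3) x" for x
        using p permutes_not_in[OF permutes_pow[OF perm], of x]
        by (cases "x \<in> A") (simp_all add: actions_def del: funpow.simps)
      then have "p gy ^^ 3 = p gx ^^ 2" by (simp add: fun_eq_iff)
      then show "p gx ^^ 2 \<in> semi m A \<and> (p gx, p gy) \<in> roots 2 m A (p gx ^^ 2) \<times> roots 3 m A (p gx ^^ 2)"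
        using s semi_power[of 2 "p gx" m A] by (simp add: roots_def)
    qed
    show "(\<lambda>(\<rho>, s, t). case_gen s t) ` ?S \<subseteq> actions m A"
    proof clarify
      fix \<rho> s t assume "s \<in> roots 2 m A \<rho>" "t \<in> roots 3 m A \<rho>"
      then have s: "s \<in> semi (2 * m) A" and t: "t \<in> semi (3 * m) A" and e: "s ^^ 2 = t ^^ 3"
        by (auto simp: roots_def)
      have "case_gen s t a permutes A" for a using s t by (cases a) (auto simp: semi_def)
      moreover have "((case_gen s t a ^^ i) x = x) = (gord m a dvd i)" if "x \<in> A" for a x i
        using s t that by (cases a) (auto simp: semi_def gord_def)
      ultimately show "case_gen s t \<in> actions m A" using e by (simp add: actions_def)
    qed
  qed
  then have "card (actions m A) = card ?S" by (rule bij_betw_same_card)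
  also have "\<dots> = (\<Sum>\<rho>'\<in>semi m A. card (roots 2 m A \<rho>' \<times> roots 3 m A \<rho>'))"
    by (rule card_SigmaI[OF finite_semi[OF A]]) (simp add: fin)
  also have "\<dots> = (\<Sum>\<rho>'\<in>semi m A. card (roots 2 m A \<rho>) * card (roots 3 m A \<rho>))"
    by (rule sum.cong[OF HOL.refl])
      (simp add: card_cartesian_product card_roots_cong[OF m A _ \<rho>, of _ 2] card_roots_cong[OF m A _ \<rho>, of _ 3])
  finally show ?thesis
    using card_semi_roots[OF m _ A \<rho>, of 2] card_semi_roots[OF m _ A \<rho>, of 3] by simp
qed

text \<open>\<open>6 * m * l\<close> points split into \<open>3 * l\<close> cycles of
  \<open>x\<close>, \<open>2 * l\<close> cycles of \<open>y\<close> and \<open>6 * l\<close> cycles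
  of \<open>x^2\<close>. In the quotient the powers combine to \<open>m ^ l\<close> over
  \<open>72 ^ l\<close>.\<close>

theorem card_actions_formula:
  assumes m: "m > 0"
  shows "card (actions m {..<6 * m * l}) * ((2 * m) ^ (3 * l) * fact (3 * l) * ((3 * m) ^ (2 * l) * fact (2 * l)))
    = fact (6 * m * l) * (m ^ (6 * l) * fact (6 * l))"
proof -
  let ?A = "{..<6 * m * l}"
  have 1: "card (semi m ?A) * (m ^ (6 * l) * fact (6 * l)) = fact (6 * m * l)"
    using card_semi[of m ?A "6 * l"] m by (simp add: ac_simps)
  have 2: "card (semi (2 * m) ?A) * ((2 * m) ^ (3 * l) * fact (3 * l)) = fact (6 * m * l)"
    using card_semi[of "2 * m" ?A "3 * l"] m by (simp add: ac_simps)
  have 3: "card (semi (3 * m) ?A) * ((3 * m) ^ (2 * l) * fact (2 * l)) = fact (6 * m * l)"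
    using card_semi[of "3 * m" ?A "2 * l"] m by (simp add: ac_simps)
  let ?D = "(2 * m) ^ (3 * l) * fact (3 * l) * ((3 * m) ^ (2 * l) * fact (2 * l))"
  have "fact (6 * m * l) * (card (actions m ?A) * ?D)
    = card (actions m ?A) * card (semi m ?A) * (m ^ (6 * l) * fact (6 * l)) * ?D"
    unfolding 1[symmetric] by (simp only: ac_simps)
  also have "\<dots> = (card (semi (2 * m) ?A) * ((2 * m) ^ (3 * l) * fact (3 * l))) *
      (card (semi (3 * m) ?A) * ((3 * m) ^ (2 * l) * fact (2 * l))) * (m ^ (6 * l) * fact (6 * l))"
    unfolding card_actions_semi[OF m finite_lessThan] by (simp only: ac_simps)
  also have "\<dots> = fact (6 * m * l) * (fact (6 * m * l) * (m ^ (6 * l) * fact (6 * l)))"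
    unfolding 2 3 by (simp only: ac_simps)
  finally show ?thesis by (simp only: mult_cancel1 fact_nonzero) simp
qed

text \<open>The points are a disjoint union of cycles of length \<open>2 * m\<close>, and also one
  of cycles of length \<open>3 * m\<close>. For this reason only orbits of size
  \<open>6 * m * i\<close> contribute to the recurrence.\<close>

lemma transitive_action_dvd:
  assumes m: "m > 0" and p: "gamma_action m {..<k} p 0"
  shows "6 * m dvd k"
proof -
  interpret gamma_action m "{..<k}" p 0 by fact
  have dvd: "c dvd n" if "finite A" "card A = n" "s \<in> semi c A" "c > 0" for s :: "nat \<Rightarrow> nat" and A n c
    using that
  proof (induction n arbitrary: A s rule: less_induct)
    case (less n)
    show ?case
    proof (cases "A = {}")
      case False
      then obtain a where a: "a \<in> A" by blast
      let ?P = "set (orbit_list c s a)"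
      note o = orbit_list_props[OF less.prems(3) a less.prems(4)]
      have perm: "s permutes A" using less.prems(3) by (simp add: semi_def)
      have card: "card ?P = c" using o(1,2) by (simp add: distinct_card)
      then have d: "card (A - ?P) = n - c" using o(3) less.prems(2) by (simp add: card_Diff_subset)
      have le: "c \<le> n" using card_mono[OF less.prems(1) o(3)] card less.prems(2) by simp
      have "s ` (A - ?P) = A - ?P"
        using image_set_diff[OF permutes_inj[OF perm]] permutes_image[OF perm] o(4) by simp
      then have "restr (A - ?P) s \<in> semi c (A - ?P)" by (intro semi_restr[OF less.prems(3)]) auto
      then have "c dvd n - c" using less.IH[of "n - c" "A - ?P"] less.prems le d by simp
      then show ?thesis using le by (simp add: dvd_diff_nat dvd_minus_self)
    qed (use less.prems in simp)
  qed
  have "p a \<in> semi (gord m a) {..<k}" for a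
    using perm semireg by (simp add: semi_def)
  then have "gord m a dvd k" for a
    using dvd[of "{..<k}" k "p a" "gord m a"] gord_pos[of a] by simp
  from this[of gx] this[of gy] have "2 * m dvd k" "3 * m dvd k"
    by (simp_all add: gord_def)
  then obtain u v where "k = 2 * m * u" "k = 3 * m * v" unfolding dvd_def by blast
  then have "2 * u = 3 * v" using m by simp
  then have "\<exists>w. u = 3 * w" by presburger
  then show ?thesis using \<open>k = 2 * m * u\<close> by auto
qed

section \<open>The Riccati equation\<close>

lemma free_subgroup_number_eq: "free_subgroup_number m l = card (free_subgroups m (6 * m * l))"
  by (simp add: free_subgroup_number_def free_subgroups_def)

lemma free_subgroups_dvd:
  assumes "m > 0" "k > 0" "H \<in> free_subgroups m k"
  shows "6 * m dvd k"
  using gamma_action_of_subgroup[OF assms] transitive_action_dvd[OF assms(1)] by blast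

definition hom_coeff :: "nat \<Rightarrow> nat \<Rightarrow> real" where
  "hom_coeff m l = real (card (actions m {..<6 * m * l})) / fact (6 * m * l)"

text \<open>Division by factorials absorbs the binomials of \<open>card_actions_rec\<close> and the
  factor \<open>fact (k - 1)\<close> of \<open>card_transitive_actions\<close>, which leaves a plain
  convolution.\<close>

lemma hom_coeff_conv:
  assumes m: "m > 0" and l: "l > 0"
  shows "6 * real m * real l * hom_coeff m l = (\<Sum>i=1..l. real (free_subgroup_number m i) * hom_coeff m (l - i))"
proof -
  define u where "u n = real (card (actions m {..<n})) / fact n" for n
  define \<phi> where "\<phi> k = real (card (free_subgroups m k))" for k
  define N where "N = 6 * m * l"
  obtain n where n: "N = Suc n" using m l by (cases N) (auto simp: N_def)
  have "real (card (actions m {..<Suc n})) = (\<Sum>j\<le>n. real (n choose j) * (fact j * \<phi> (Suc j) * real (card (actions m {..<n - j}))))"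
    unfolding card_actions_rec[OF m] using card_transitive_actions[OF m] by (simp add: \<phi>_def)
  also have "\<dots> = (\<Sum>j\<le>n. fact n * (\<phi> (Suc j) * u (n - j)))"
  proof (rule sum.cong[OF HOL.refl])
    fix j assume "j \<in> {..n}"
    then have "real (n choose j) = fact n / (fact j * fact (n - j))" by (simp add: binomial_fact)
    then show "real (n choose j) * (fact j * \<phi> (Suc j) * real (card (actions m {..<n - j}))) = fact n * (\<phi> (Suc j) * u (n - j))"
      by (simp add: u_def)
  qed
  finally have "real (card (actions m {..<Suc n})) = fact n * (\<Sum>j\<le>n. \<phi> (Suc j) * u (n - j))"
    by (simp only: sum_distrib_left)
  then have "real N * u N = (\<Sum>j\<le>n. \<phi> (Suc j) * u (n - j))"
    unfolding n u_def[of "Suc n"] by simp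
  also have "\<dots> = (\<Sum>k=1..N. \<phi> k * u (N - k))"
    by (rule sum.reindex_bij_witness[where i = "\<lambda>k. k - 1" and j = Suc]) (auto simp: n)
  also have "\<dots> = (\<Sum>k\<in>(\<lambda>i. 6 * m * i) ` {1..l}. \<phi> k * u (N - k))"
  proof (rule sum.mono_neutral_right)
    show "(\<lambda>i. 6 * m * i) ` {1..l} \<subseteq> {1..N}" using m by (auto simp: N_def)
    show "\<forall>k\<in>{1..N} - (\<lambda>i. 6 * m * i) ` {1..l}. \<phi> k * u (N - k) = 0"
    proof
      fix k assume k: "k \<in> {1..N} - (\<lambda>i. 6 * m * i) ` {1..l}"
      have "\<not> 6 * m dvd k"
      proof
        assume "6 * m dvd k"
        then obtain i where i: "k = 6 * m * i" ..
        then have "i \<in> {1..l}" using k m by (auto simp: N_def Suc_le_eq)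
        then show False using k i by blast
      qed
      then have "free_subgroups m k = {}" using free_subgroups_dvd[OF m, of k] k by auto
      then show "\<phi> k * u (N - k) = 0" by (simp add: \<phi>_def)
    qed
  qed simp
  also have "\<dots> = (\<Sum>i=1..l. \<phi> (6 * m * i) * u (N - 6 * m * i))"
    by (subst sum.reindex) (use m in \<open>auto simp: inj_on_def\<close>)
  also have "\<dots> = (\<Sum>i=1..l. real (free_subgroup_number m i) * hom_coeff m (l - i))"
    by (rule sum.cong) (auto simp: \<phi>_def u_def N_def hom_coeff_def free_subgroup_number_eq diff_mult_distrib2)
  finally show ?thesis by (simp add: u_def N_def hom_coeff_def)
qed

lemma hom_coeff_0: "hom_coeff m 0 = 1"
proof -
  have "actions m {} = {\<lambda>_. id :: nat \<Rightarrow> nat}"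
    by (auto simp: actions_def permutes_empty)
  then show ?thesis by (simp add: hom_coeff_def)
qed

lemma hom_coeff_formula:
  assumes m: "m > 0"
  shows "hom_coeff m l = (m ^ (6 * l) * fact (6 * l)) / ((2 * m) ^ (3 * l) * fact (3 * l) * ((3 * m) ^ (2 * l) * fact (2 * l)))"
proof -
  have "real (card (actions m {..<6 * m * l}) * ((2 * m) ^ (3 * l) * fact (3 * l) * ((3 * m) ^ (2 * l) * fact (2 * l))))
    = real (fact (6 * m * l) * (m ^ (6 * l) * fact (6 * l)))"
    unfolding card_actions_formula[OF m] ..
  then show ?thesis
    using m by (simp add: hom_coeff_def field_simps)
qed

text \<open>The quadratic is \<open>(6 l + 1) (6 l + 5)\<close>. Among the new factors of
  \<open>fact (6 * Suc l)\<close>, those with remainders 2, 4 and 6 cancel against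
  \<open>fact (3 * Suc l)\<close>, and \<open>6 l + 3\<close> against the factor
  \<open>2 l + 1\<close> of \<open>fact (2 * Suc l)\<close>.\<close>

lemma hom_coeff_Suc:
  assumes m: "m > 0"
  shows "6 * (real l + 1) * hom_coeff m (Suc l) = m * (36 * real l ^ 2 + 36 * real l + 5) * hom_coeff m l"
proof -
  define x where "x = real l"
  define \<mu> where "\<mu> = real m"
  have pos: "x \<ge> 0" "\<mu> > 0" using m by (auto simp: x_def \<mu>_def)
  define D where "D = (2 * \<mu>) ^ (3 * l) * fact (3 * l) * ((3 * \<mu>) ^ (2 * l) * fact (2 * l))"
  define E where "E = \<mu> ^ (6 * l) * fact (6 * l)"
  have f6: "(fact (6 * Suc l) :: real) = fact (6 * l) * ((6 * x + 1) * (6 * x + 2) * (6 * x + 3) * (6 * x + 4) * (6 * x + 5) * (6 * x + 6))"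
    by (simp add: x_def numeral_eq_Suc algebra_simps del: fact_Suc) (simp add: algebra_simps)
  have f3: "(fact (3 * Suc l) :: real) = fact (3 * l) * ((3 * x + 1) * (3 * x + 2) * (3 * x + 3))"
    by (simp add: x_def numeral_eq_Suc algebra_simps del: fact_Suc) (simp add: algebra_simps)
  have f2: "(fact (2 * Suc l) :: real) = fact (2 * l) * ((2 * x + 1) * (2 * x + 2))"
    by (simp add: x_def numeral_eq_Suc algebra_simps del: fact_Suc) (simp add: algebra_simps)
  have D: "D \<noteq> 0" using pos by (simp add: D_def)
  have "hom_coeff m l = E / D"
    using hom_coeff_formula[OF m, of l] by (simp add: E_def D_def \<mu>_def)
  define n where "n = \<mu> ^ 6 * ((6 * x + 1) * (6 * x + 2) * (6 * x + 3) * (6 * x + 4) * (6 * x + 5) * (6 * x + 6))"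
  define d where "d = (2 * \<mu>) ^ 3 * (3 * \<mu>) ^ 2 * (((3 * x + 1) * (3 * x + 2) * (3 * x + 3)) * ((2 * x + 1) * (2 * x + 2)))"
  define c where "c = \<mu> * (36 * x ^ 2 + 36 * x + 5)"
  have Suc_eq: "hom_coeff m (Suc l) = (E * n) / (D * d)"
  proof -
    have "\<mu> ^ (6 * Suc l) = \<mu> ^ 6 * \<mu> ^ (6 * l)" "(2 * \<mu>) ^ (3 * Suc l) = (2 * \<mu>) ^ 3 * (2 * \<mu>) ^ (3 * l)"
      "(3 * \<mu>) ^ (2 * Suc l) = (3 * \<mu>) ^ 2 * (3 * \<mu>) ^ (2 * l)"
      by (simp_all only: mult_Suc_right power_add)
    then show ?thesis
      unfolding hom_coeff_formula[OF m] E_def D_def n_def d_def f6 f3 f2 \<mu>_def[symmetric] of_nat_mult of_nat_power of_nat_numeral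
      by (simp only: ac_simps)
  qed
  have nd: "6 * (x + 1) * n = c * d" unfolding n_def d_def c_def by algebra
  have d: "d \<noteq> 0"
    unfolding d_def using pos by (simp add: add_nonneg_eq_0_iff)
  have "6 * (x + 1) * hom_coeff m (Suc l) = (E * (6 * (x + 1) * n)) / (D * d)"
    unfolding Suc_eq by simp
  also have "\<dots> = c * (E / D)" unfolding nd using d by simp
  also have "\<dots> = \<mu> * (36 * x ^ 2 + 36 * x + 5) * hom_coeff m l" using \<open>hom_coeff m l = E / D\<close> by (simp add: c_def)
  finally have "6 * (x + 1) * hom_coeff m (Suc l) = \<mu> * (36 * x ^ 2 + 36 * x + 5) * hom_coeff m l" .
  then show ?thesis by (simp add: x_def \<mu>_def)
qed

text \<open>\<open>FA\<close> makes \<open>F\<close> the logarithmic derivative of \<open>A\<close>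
  up to the factor \<open>6 m z\<close>, so the linear equation \<open>ode\<close> for
  \<open>A\<close> becomes quadratic in \<open>F\<close>. Real coefficients are used because those
  of \<open>A\<close> are fractions.\<close>

lemma free_subgroup_riccati_real:
  assumes m: "m > 0"
  defines "F \<equiv> Abs_fps (\<lambda>l. if l \<ge> 1 then real (free_subgroup_number m l) else 0)"
  shows "F = fps_X * (F ^ 2 + 6 * of_nat m * fps_X * fps_deriv F + 6 * of_nat m * F + 5 * of_nat m ^ 2)"
proof -
  define A where "A = Abs_fps (hom_coeff m)"
  define P where "P = fps_deriv A"
  define Q where "Q = fps_deriv (fps_X * P)"
  let ?m = "of_nat m :: real fps"
  have m_nth: "(of_nat m * G) $ n = real m * G $ n" for G :: "real fps" and n
    by (simp flip: fps_of_nat)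
  have num_nth: "(numeral k * G) $ n = numeral k * G $ n" for G :: "real fps" and n k
    by (simp add: numeral_fps_const)
  have FA: "F * A = 6 * ?m * fps_X * P"
  proof (rule fps_ext)
    fix n
    show "(F * A) $ n = (6 * ?m * fps_X * P) $ n"
    proof (cases n)
      case 0
      then show ?thesis by (simp add: F_def)
    next
      case (Suc k)
      have "(F * A) $ n = (\<Sum>i=0..n. F $ i * A $ (n - i))" by (simp add: fps_mult_nth)
      also have "\<dots> = (\<Sum>i=1..n. real (free_subgroup_number m i) * hom_coeff m (n - i))"
        by (rule sum.mono_neutral_cong_right) (auto simp: F_def A_def)
      also have "\<dots> = 6 * real m * real n * hom_coeff m n"
        using hom_coeff_conv[OF m, of n] Suc by simp
      also have "\<dots> = (6 * (?m * (fps_X * P))) $ n"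
        unfolding num_nth m_nth using Suc by (simp add: P_def A_def)
      finally show ?thesis by (simp add: mult.assoc)
    qed
  qed
  \<comment> \<open>The operator \<open>z d/dz\<close> multiplies the \<open>n\<close>-th
    coefficient by \<open>n\<close>; \<open>fps_X * P\<close> and \<open>fps_X * Q\<close> are
    \<open>A\<close> after one and two applications of it. Thus \<open>ode\<close> is
    \<open>hom_coeff_Suc\<close> for all \<open>n\<close> at once.\<close>
  have ode: "6 * P = ?m * (36 * (fps_X * Q) + 36 * (fps_X * P) + 5 * A)"
  proof (rule fps_ext)
    fix n
    have "(fps_X * P) $ n = real n * hom_coeff m n" by (cases n) (simp_all add: P_def A_def)
    moreover have "(fps_X * Q) $ n = real n * (fps_X * P) $ n" by (cases n) (simp_all add: Q_def algebra_simps)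
    ultimately have "(?m * (36 * (fps_X * Q) + 36 * (fps_X * P) + 5 * A)) $ n = m * (36 * real n ^ 2 + 36 * real n + 5) * hom_coeff m n"
      unfolding m_nth fps_add_nth num_nth by (simp add: A_def algebra_simps power2_eq_square)
    then show "(6 * P) $ n = (?m * (36 * (fps_X * Q) + 36 * (fps_X * P) + 5 * A)) $ n"
      unfolding num_nth using hom_coeff_Suc[OF m, of n] by (simp add: P_def A_def algebra_simps)
  qed
  have "fps_deriv (F * A) = fps_deriv (6 * ?m * (fps_X * P))" unfolding FA by (simp add: mult.assoc)
  then have FQ: "fps_deriv F * A + F * P = 6 * ?m * Q"
    unfolding P_def[symmetric] Q_def by (simp add: P_def algebra_simps)
  \<comment> \<open>Eliminates \<open>P\<close> and \<open>Q\<close>. The factor \<open>A\<close>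
    can then be cancelled, its constant term being 1.\<close>
  have "A * (F - fps_X * (F ^ 2 + 6 * ?m * fps_X * fps_deriv F + 6 * ?m * F + 5 * ?m ^ 2)) = 0"
    using FA ode FQ by algebra
  moreover have "A \<noteq> 0"
  proof
    assume "A = 0"
    then have "A $ 0 = 0" by simp
    then show False by (simp add: A_def hom_coeff_0)
  qed
  ultimately have "F - fps_X * (F ^ 2 + 6 * ?m * fps_X * fps_deriv F + 6 * ?m * F + 5 * ?m ^ 2) = 0"
    by (simp only: mult_eq_0_iff) blast
  then show ?thesis by (simp only: right_minus_eq)
qed

lemma free_subgroup_riccati:
  assumes m: "m > 0"
  defines "F \<equiv> Abs_fps (\<lambda>l. if l \<ge> 1 then int (free_subgroup_number m l) else 0)"
  shows "F = fps_X * (F ^ 2 + 6 * of_nat m * fps_X * fps_deriv F + 6 * of_nat m * F + 5 * of_nat m ^ 2)"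
proof (rule fps_ext)
  fix n
  define G where "G = Abs_fps (\<lambda>l. if l \<ge> 1 then real (free_subgroup_number m l) else 0)"
  have GF: "G $ i = real_of_int (F $ i)" for i by (simp add: G_def F_def)
  have GG: "(G * G) $ k = real_of_int ((F * F) $ k)" for k by (simp add: fps_mult_nth GF)
  \<comment> \<open>Sorts constants and powers of \<open>x\<close> to the front, so that each
    coefficient can be computed and compared through the embedding of the integers.\<close>
  have ring: "x * (f ^ 2 + 6 * k * x * d + 6 * k * f + 5 * k ^ 2) = x * (f * f) + 6 * (k * (x * (x * d))) + 6 * (k * (x * f)) + 5 * (k * (k * x))"
    for x f d k :: "'a :: comm_ring_1"
    by (simp add: algebra_simps power2_eq_square)
  have nths: "(of_nat m * H) $ n = int m * H $ n" "(numeral k * H) $ n = numeral k * H $ n"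
    for H :: "int fps" and n k
    by (simp_all add: numeral_fps_const flip: fps_of_nat)
  have nths': "(of_nat m * H) $ n = real m * H $ n" "(numeral k * H) $ n = numeral k * H $ n"
    for H :: "real fps" and n k
    by (simp_all add: numeral_fps_const flip: fps_of_nat)
  have "real_of_int (F $ n) = G $ n" by (simp add: GF)
  also have "\<dots> = (fps_X * (G ^ 2 + 6 * of_nat m * fps_X * fps_deriv G + 6 * of_nat m * G + 5 * of_nat m ^ 2)) $ n"
    using free_subgroup_riccati_real[OF m, folded G_def] by (rule arg_cong)
  also have "\<dots> = real_of_int ((fps_X * (F ^ 2 + 6 * of_nat m * fps_X * fps_deriv F + 6 * of_nat m * F + 5 * of_nat m ^ 2)) $ n)"
    unfolding ring fps_add_nth nths nths'
    by (cases n; cases "n - 1") (simp_all add: GG GF)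
  finally show "F $ n = (fps_X * (F ^ 2 + 6 * of_nat m * fps_X * fps_deriv F + 6 * of_nat m * F + 5 * of_nat m ^ 2)) $ n"
    by simp
qed

section \<open>The right-hand side modulo 64\<close>

text \<open>The claimed expression times \<open>z\<close>, which removes the terms with
  \<open>1/z\<close>, as a polynomial in \<open>x = z\<close>, \<open>u = m\<close> and
  \<open>P\<close> for \<Phi>. It is stated over any commutative ring, to be used for power series,
  for Laurent series and in the abstract identity.\<close>

definition rhs_poly :: "'a::comm_ring_1 \<Rightarrow> 'a \<Rightarrow> 'a \<Rightarrow> 'a" where
  "rhs_poly x u P = (x + 12 * x^2 + 5 * x^2 * u^2 + 24 * x^3 - 4 * x^3 * u + 4 * x^3 * u^2 + 34 * x^4 + 2 * x^4 * u^2 + 8 * x^5 + 16 * x^5 * u + 8 * x^6 + 16 * x^6 * u + 32 * x^7 + 48 * x^8 + 32 * x^10)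
    + (40 * x + 60 * x^2 + 12 * x^3 + 24 * x^4 + 48 * x^5) * P
    + (12 + 12 * x + 22 * x^2 + 36 * x^3 + 68 * x^4 - 32 * x^4 * u + 4 * x^4 * u^2 + 32 * x^5 + 16 * x^5 * u + 16 * x^6) * P^2
    + (28 + 52 * x + 4 * x^2 + 40 * x^3 - 16 * x^4 + 16 * x^4 * u + 32 * x^5 + 32 * x^6) * P^3
    + (35 + 24 * x + 38 * x^2 + 16 * x^2 * u + 2 * x^2 * u^2 + 40 * x^3 + 16 * x^3 * u + 24 * x^4 + 16 * x^4 * u + 32 * x^5 + 32 * x^6 + 32 * x^8) * P^4
    + (44 * x - 8 * x^2 + 16 * x^2 * u + 16 * x^3 + 32 * x^4) * P^5
    + (50 + 44 * x + 20 * x^2 - 16 * x^2 * u + 4 * x^2 * u^2 + 16 * x^3 * u + 16 * x^4) * P^6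
    + (4 + 40 * x + 16 * x^2 + 16 * x^2 * u + 32 * x^3 + 32 * x^4) * P^7"

definition rhs_poly_dx :: "'a::comm_ring_1 \<Rightarrow> 'a \<Rightarrow> 'a \<Rightarrow> 'a" where
  "rhs_poly_dx x u P = (1 + 24 * x + 10 * x * u^2 + 72 * x^2 - 12 * x^2 * u + 12 * x^2 * u^2 + 136 * x^3 + 8 * x^3 * u^2 + 40 * x^4 + 80 * x^4 * u + 48 * x^5 + 96 * x^5 * u + 224 * x^6 + 384 * x^7 + 320 * x^9)
    + (40 + 120 * x + 36 * x^2 + 96 * x^3 + 240 * x^4) * P
    + (12 + 44 * x + 108 * x^2 + 272 * x^3 - 128 * x^3 * u + 16 * x^3 * u^2 + 160 * x^4 + 80 * x^4 * u + 96 * x^5) * P^2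
    + (52 + 8 * x + 120 * x^2 - 64 * x^3 + 64 * x^3 * u + 160 * x^4 + 192 * x^5) * P^3
    + (24 + 76 * x + 32 * x * u + 4 * x * u^2 + 120 * x^2 + 48 * x^2 * u + 96 * x^3 + 64 * x^3 * u + 160 * x^4 + 192 * x^5 + 256 * x^7) * P^4
    + (44 - 16 * x + 32 * x * u + 48 * x^2 + 128 * x^3) * P^5
    + (44 + 40 * x - 32 * x * u + 8 * x * u^2 + 48 * x^2 * u + 64 * x^3) * P^6
    + (40 + 32 * x + 32 * x * u + 96 * x^2 + 128 * x^3) * P^7"

definition rhs_poly_dP :: "'a::comm_ring_1 \<Rightarrow> 'a \<Rightarrow> 'a \<Rightarrow> 'a" where
  "rhs_poly_dP x u P = (40 * x + 60 * x^2 + 12 * x^3 + 24 * x^4 + 48 * x^5)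
    + (24 + 24 * x + 44 * x^2 + 72 * x^3 + 136 * x^4 - 64 * x^4 * u + 8 * x^4 * u^2 + 64 * x^5 + 32 * x^5 * u + 32 * x^6) * P
    + (84 + 156 * x + 12 * x^2 + 120 * x^3 - 48 * x^4 + 48 * x^4 * u + 96 * x^5 + 96 * x^6) * P^2
    + (140 + 96 * x + 152 * x^2 + 64 * x^2 * u + 8 * x^2 * u^2 + 160 * x^3 + 64 * x^3 * u + 96 * x^4 + 64 * x^4 * u + 128 * x^5 + 128 * x^6 + 128 * x^8) * P^3
    + (220 * x - 40 * x^2 + 80 * x^2 * u + 80 * x^3 + 160 * x^4) * P^4
    + (300 + 264 * x + 120 * x^2 - 96 * x^2 * u + 24 * x^2 * u^2 + 96 * x^3 * u + 96 * x^4) * P^5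
    + (28 + 280 * x + 112 * x^2 + 112 * x^2 * u + 224 * x^3 + 224 * x^4) * P^6"

lemma fps_deriv_rhs_poly:
  fixes P :: "int fps"
  shows "fps_deriv (rhs_poly fps_X (of_nat m) P) = rhs_poly_dx fps_X (of_nat m) P + rhs_poly_dP fps_X (of_nat m) P * fps_deriv P"
  unfolding rhs_poly_def rhs_poly_dx_def rhs_poly_dP_def
  by (simp add: fps_deriv_power') algebra

text \<open>
  Modulo 64 everything reduces to linear combinations of \<open>1\<close>, \<open>P\<close>, \<open>H\<close>, \<open>P H\<close>, \<open>K\<close>, \<open>P K\<close>, \<open>H K\<close>;
  \<open>n\<close> and \<open>t\<close> encode \<open>u = 1 + 2 n\<close> and \<open>u\<^sup>2 = 1 + 8 t\<close>. The quotients by 64 were computed by machine.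
\<close>

lemma rhs_poly_mod_64:
  fixes x :: "'a::idom"
  assumes P: "P * P = P - x + 2 * H" and H: "H * H = H - x * P + x * x + 2 * K"
    and n: "n * n = 2 * t - n" and u: "u = 1 + 2 * n"
    and P': "P' = 1 + 2 * x + 4 * x^3 + 8 * x^7 + 16 * x^15 + 32 * x^31 + 64 * E"
  defines "V \<equiv> rhs_poly x u P" and "V' \<equiv> rhs_poly_dx x u P + rhs_poly_dP x u P * P'"
  shows "64 dvd V - x - (5 * u^2 - 6 * u + 1) * x^2 + 2 * x * V - V^2 - 6 * u * x^2 * V'"
proof -
  \<comment> \<open>A representative of \<open>V\<close> modulo 64 with degree at most one in each
    of \<open>P\<close>, \<open>H\<close>, \<open>K\<close>, \<open>n\<close> and \<open>t\<close>.
    All terms with \<open>K\<close> have coefficients divisible by 8, so in \<open>W * W\<close>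
    every term with \<open>K^2\<close> vanishes modulo 64. This is why relations for
    \<open>P * P\<close> and \<open>H * H\<close> suffice.\<close>
  define W where "W = -24 * K + 22 * H + 32 * H * K + P - 16 * P * K + 20 * P * H + 16 * x * K - 28 * x * H + 22 * x * P + 32 * x * P * K + 8 * x * P * H - 18 * x^2 + 32 *
    x^2 * K - 24 * x^2 * H + 12 * x^2 * P + 16 * x^2 * P * H - 24 * x^2 * t + 32 * x^2 * t * H - 16 * x^2 * t * P + 4 * x^3 - 16 * x^3 * t + 32 * x^3 * t
    * P - 8 * x^3 * n + 12 * x^4 - 16 * x^4 * H - 24 * x^4 * P + 32 * x^4 * P * H + 24 * x^5 + 32 * x^5 * H + 16 * x^5 * P + 32 * x^5 * n - 16 * x^6 + 32
    * x^6 * P + 16 * x^8 + 32 * x^8 * P + 32 * x^9"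
  define C1 where "C1 = 41 * K + 24 * H + 15 * H * K + 2 * P + 23 * P * K + 21 * P * H + P * H * K - 2 * x + 66 * x * K + 5 * x * H + 41 * x * H * K - 33 * x * P + 60 * x * P
    * K + 30 * x * P * H + 10 * x * P * H * K + 32 * x^2 - 28 * x^2 * K - 81 * x^2 * H + 26 * x^2 * H * K - 56 * x^2 * P + 21 * x^2 * P * K - 30 * x^2 * P
    * H + 8 * x^2 * P * H * K + x^2 * t + 22 * x^2 * t * K + 12 * x^2 * t * H + 8 * x^2 * t * H * K + x^2 * t * P + 12 * x^2 * t * P * K + 11 * x^2 * t *
    P * H + 32 * x^2 * n * K + 18 * x^2 * n * H + 16 * x^2 * n * H * K + x^2 * n * P + 24 * x^2 * n * P * K + 18 * x^2 * n * P * H + 8 * x^2 * n * P * H *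
    K + 67 * x^3 + 6 * x^3 * K + 15 * x^3 * H + 28 * x^3 * H * K + 38 * x^3 * P + 28 * x^3 * P * K + 5 * x^3 * P * H + 8 * x^3 * P * H * K - 12 * x^3 * t
    * K - 25 * x^3 * t * H - 20 * x^3 * t * P - 10 * x^3 * t * P * H - x^3 * n - 16 * x^3 * n * K - 38 * x^3 * n * H + 8 * x^3 * n * H * K - 30 * x^3 * n
    * P - 14 * x^3 * n * P * H - 5 * x^4 + 5 * x^4 * K - 10 * x^4 * H + 28 * x^4 * H * K - 7 * x^4 * P + 30 * x^4 * P * K + 8 * x^4 * P * H * K + 19 * x^4
    * t + 8 * x^4 * t * H + 14 * x^4 * t * P + 29 * x^4 * n - 8 * x^4 * n * K + 6 * x^4 * n * H + 19 * x^4 * n * P + 17 * x^5 - 54 * x^5 * K - 43 * x^5 *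
    H - 4 * x^5 * P - 12 * x^5 * P * K - 31 * x^5 * P * H - 7 * x^5 * t - 7 * x^5 * n + 6 * x^5 * n * H + 4 * x^5 * n * P + 19 * x^6 + 4 * x^6 * K + 43 *
    x^6 * H + 51 * x^6 * P + 10 * x^6 * P * H - 4 * x^6 * n - 35 * x^7 - 2 * x^7 * H - 10 * x^7 * P + 3 * x^8 + 4 * x^8 * K + 3 * x^8 * H + 2 * x^8 * P *
    H - x^9 - 2 * x^9 * H - 3 * x^9 * P + 3 * x^10"
  have V: "V = W + 64 * C1"
    unfolding V_def W_def C1_def rhs_poly_def using P H n u by algebra
  define A where "A = 1 + 32 * K + 32 * H + 10 * x + 32 * x * K + 8 * x * H - 20 * x * P - 16 * x * P * H + 16 * x * t + 32 * x * t * P + 8 * x^2 - 16 * x^2 * H + 8 * x^2 *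
    P + 32 * x^2 * P * H - 24 * x^2 * n + 16 * x^3 + 32 * x^3 * t + 32 * x^4 + 32 * x^4 * P + 32 * x^4 * n - 16 * x^5 + 32 * x^5 * P + 32 * x^6"
  define C2 where "C2 = 91 * K + 52 * H + 41 * H * K + 4 * P + 62 * P * K + 50 * P * H + 10 * P * H * K - 3 * x + 26 * x * K - 66 * x * H + 52 * x * H * K - 80 * x * P + 57 *
    x * P * K - 2 * x * P * H + 16 * x * P * H * K + x * t + 44 * x * t * K + 25 * x * t * H + 16 * x * t * H * K + x * t * P + 24 * x * t * P * K + 22 *
    x * t * P * H + 64 * x * n * K + 36 * x * n * H + 32 * x * n * H * K + 2 * x * n * P + 48 * x * n * P * K + 36 * x * n * P * H + 16 * x * n * P * H *
    K + 80 * x^2 + 73 * x^2 * K + 11 * x^2 * H + 84 * x^2 * H * K - 5 * x^2 * P + 96 * x^2 * P * K + 34 * x^2 * P * H + 24 * x^2 * P * H * K - 24 * x^2 *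
    t * K - 50 * x^2 * t * H - 39 * x^2 * t * P - 20 * x^2 * t * P * H - 2 * x^2 * n - 8 * x^2 * n * K - 62 * x^2 * n * H + 24 * x^2 * n * H * K - 59 *
    x^2 * n * P + 12 * x^2 * n * P * K - 16 * x^2 * n * P * H + 39 * x^3 + 78 * x^3 * K - 33 * x^3 * H + 112 * x^3 * H * K - 58 * x^3 * P + 132 * x^3 * P
    * K + 28 * x^3 * P * H + 32 * x^3 * P * H * K + 38 * x^3 * t + 18 * x^3 * t * H + 29 * x^3 * t * P + 57 * x^3 * n - 20 * x^3 * n * K - 10 * x^3 * n *
    H + 17 * x^3 * n * P - 4 * x^3 * n * P * H + 85 * x^4 - 212 * x^4 * K - 205 * x^4 * H - 59 * x^4 * P - 48 * x^4 * P * K - 128 * x^4 * P * H - 15 * x^4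
    * t + 8 * x^4 * n + 18 * x^4 * n * H + 16 * x^4 * n * P + 111 * x^5 + 24 * x^5 * K + 179 * x^5 * H + 211 * x^5 * P + 46 * x^5 * P * H - 9 * x^5 * n -
    139 * x^6 - 12 * x^6 * H - 47 * x^6 * P + 21 * x^7 + 32 * x^7 * K + 24 * x^7 * H + 4 * x^7 * P + 16 * x^7 * P * H - 4 * x^8 - 16 * x^8 * H - 24 * x^8
    * P + 25 * x^9"
  have A: "rhs_poly_dx x u P = A + 64 * C2"
    unfolding A_def C2_def rhs_poly_dx_def using P H n u by algebra
  define C3 where "C3 = 92 * K + 63 * H + 7 * H * K + 9 * P + 48 * P * K + 60 * P * H - 8 * x + 258 * x * K + 70 * x * H + 70 * x * H * K - 72 * x * P + 138 * x * P * K + 118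
    * x * P * H + 66 * x^2 + 52 * x^2 * K - 188 * x^2 * H + 56 * x^2 * H * K - 197 * x^2 * P + 90 * x^2 * P * K - 17 * x^2 * P * H + 48 * x^2 * t * K + 32
    * x^2 * t * H + 4 * x^2 * t * P + 24 * x^2 * t * P * K + 32 * x^2 * t * P * H + 112 * x^2 * n * K + 66 * x^2 * n * H + 56 * x^2 * n * H * K + 5 * x^2
    * n * P + 60 * x^2 * n * P * K + 54 * x^2 * n * P * H + 214 * x^3 + 90 * x^3 * K - 11 * x^3 * H + 56 * x^3 * H * K + 7 * x^3 * P + 96 * x^3 * P * K +
    24 * x^3 * P * H - 4 * x^3 * t - 48 * x^3 * t * H - 46 * x^3 * t * P - 12 * x^3 * t * P * H - 5 * x^3 * n - 36 * x^3 * n * K - 96 * x^3 * n * H - 93 *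
    x^3 * n * P + 24 * x^3 * n * P * K - 24 * x^3 * n * P * H + 68 * x^4 + 100 * x^4 * K - 36 * x^4 * H + 56 * x^4 * H * K - 50 * x^4 * P + 96 * x^4 * P *
    K + 24 * x^4 * P * H + 42 * x^4 * t + 16 * x^4 * t * P + 88 * x^4 * n + 8 * x^4 * n * H + 34 * x^4 * n * P - 8 * x^4 * n * P * H + 95 * x^5 - 84 * x^5
    * K - 146 * x^5 * H - 59 * x^5 * P - 72 * x^5 * P * H - 7 * x^5 * n + 14 * x^5 * n * P + 107 * x^6 + 56 * x^6 * H + 104 * x^6 * P + 4 * x^6 * P * H -
    49 * x^7 - 2 * x^7 * P + 4 * x^8 * H + 2 * x^8 * P + 4 * x^8 * P * H - 2 * x^9 - 2 * x^9 * P"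
  have B: "rhs_poly_dP x u P = 32 * (H + K) + 64 * C3"
    unfolding C3_def rhs_poly_dP_def using P H n u by algebra
  \<comment> \<open>\<open>P'\<close> is 1 modulo 2, hence \<open>32 * (H + K) * P'\<close> is
    congruent to \<open>32 * (H + K)\<close> modulo 64. The remainder goes into
    \<open>C4\<close>.\<close>
  define D where "D = A + 32 * (H + K)"
  define C4 where "C4 = C2 + C3 * P' + (H + K) * (x + 2 * x^3 + 4 * x^7 + 8 * x^15 + 16 * x^31 + 32 * E)"
  have V': "V' = D + 64 * C4"
    unfolding V'_def A B P' D_def C4_def by (simp add: algebra_simps)
  define C5 where "C5 = -43 * K - 13 * K^2 - 32 * K^3 - 21 * H - 9 * H * K - 39 * P * K - 56 * P * K^2 - 21 * P * H + 15 * P * H * K + 16 * P * H * K^2 - 26 * x * K + 8 * x *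
    K^2 + 27 * x * H - 5 * x * H * K + 16 * x * H * K^2 + 41 * x * P + 62 * x * P * K + 48 * x * P * K^2 - 8 * x * P * H - 86 * x * P * H * K - 32 * x * P
    * H * K^2 - 41 * x^2 - 130 * x^2 * K + 36 * x^2 * K^2 - 63 * x^2 * H - 28 * x^2 * H * K - 64 * x^2 * H * K^2 - 21 * x^2 * P - 35 * x^2 * P * K - 48 *
    x^2 * P * K^2 + 20 * x^2 * P * H - 24 * x^2 * P * H * K - x^2 * t - 22 * x^2 * t * K - 64 * x^2 * t * K^2 + 16 * x^2 * t * H + x^2 * t * P - 72 * x^2
    * t * P * K + 15 * x^2 * t * P * H + 32 * x^2 * t * P * H * K - 12 * x^2 * n * K - 12 * x^2 * n * H + x^3 - 78 * x^3 * K - 64 * x^3 * K^2 - 79 * x^3 *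
    H - 4 * x^3 * H * K + 53 * x^3 * P - 4 * x^3 * P * K - 32 * x^3 * P * K^2 + 55 * x^3 * P * H - 8 * x^3 * P * H * K - 3 * x^3 * t + 37 * x^3 * t * H +
    64 * x^3 * t * H * K + 46 * x^3 * t * P + 96 * x^3 * t * P * K - 66 * x^3 * t * P * H - 64 * x^3 * t * P * H * K - 2 * x^3 * n - 12 * x^3 * n * K + 4
    * x^3 * n * H + 8 * x^3 * n * H * K + 4 * x^3 * n * P - 4 * x^3 * n * P * K + 8 * x^3 * n * P * H - 3 * x^3 * n * t - 6 * x^3 * n * t * P - 37 * x^4 -
    7 * x^4 * K + 80 * x^4 * K^2 - 86 * x^4 * H - 56 * x^4 * H * K + 31 * x^4 * P - 72 * x^4 * P * K - 64 * x^4 * P * K^2 + 16 * x^4 * P * H + 8 * x^4 * P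
    * H * K - 37 * x^4 * t + 16 * x^4 * t * K + 10 * x^4 * t * H - 96 * x^4 * t * H * K - 12 * x^4 * t * P - 48 * x^4 * t * P * K + 4 * x^4 * t * P * H -
    9 * x^4 * t^2 - 32 * x^4 * t^2 * K - 16 * x^4 * t^2 * P + 16 * x^4 * t^2 * P * H - 4 * x^4 * n + 4 * x^4 * n * K - 4 * x^4 * n * H + 4 * x^4 * n * P +
    8 * x^4 * n * P * K - 4 * x^4 * n * P * H - 27 * x^5 - 172 * x^5 * K - 192 * x^5 * K^2 - 19 * x^5 * H - 8 * x^5 * H * K + 71 * x^5 * P + 48 * x^5 * P
    * K - 15 * x^5 * P * H - 32 * x^5 * P * H * K - 5 * x^5 * t - 16 * x^5 * t * K - 40 * x^5 * t * H - 2 * x^5 * t * P - 32 * x^5 * t * P * K + 16 * x^5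
    * t * P * H - 8 * x^5 * t^2 + 48 * x^5 * t^2 * H + 48 * x^5 * t^2 * P - 32 * x^5 * t^2 * P * H - 7 * x^5 * n + 32 * x^5 * n * K - 28 * x^5 * n * H -
    32 * x^5 * n * H * K + 2 * x^5 * n * P + 16 * x^5 * n * P * K - 16 * x^5 * n * P * H - 12 * x^5 * n * t + 8 * x^5 * n * t * H - 4 * x^5 * n * t * P -
    62 * x^6 - 164 * x^6 * K - 59 * x^6 * H - 16 * x^6 * H * K + 13 * x^6 * P + 88 * x^6 * P * K - 26 * x^6 * P * H - 96 * x^6 * P * H * K + 17 * x^6 * t
    + 96 * x^6 * t * K + 16 * x^6 * t * H - 12 * x^6 * t * P - 64 * x^6 * t * P * K + 24 * x^6 * t * P * H - 36 * x^6 * t^2 - 32 * x^6 * t^2 * H - 16 *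
    x^6 * n * K + 28 * x^6 * n * H - 28 * x^6 * n * P - 32 * x^6 * n * P * K - 8 * x^6 * n * P * H - 4 * x^6 * n * t + 8 * x^6 * n * t * P - 60 * x^7 - 96
    * x^7 * K - 32 * x^7 * H - 96 * x^7 * H * K + 36 * x^7 * P - 80 * x^7 * P * K + 16 * x^7 * P * H + 4 * x^7 * t - 192 * x^7 * t * K + 8 * x^7 * t * H +
    16 * x^7 * t * P + 16 * x^7 * t^2 + 24 * x^7 * n - 32 * x^7 * n * K + 20 * x^7 * n * H - 24 * x^7 * n * P - 8 * x^7 * n * P * H + 24 * x^7 * n * t -
    32 * x^7 * n * t * H + 16 * x^7 * n * t * P - 37 * x^8 - 60 * x^8 * K - 109 * x^8 * H - 48 * x^8 * H * K + 25 * x^8 * P + 16 * x^8 * P * K - 36 * x^8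
    * P * H - 32 * x^8 * P * H * K + 64 * x^8 * t * H + 64 * x^8 * t * P - 64 * x^8 * t * P * H - 12 * x^8 * n + 8 * x^8 * n * H + 4 * x^8 * n * P + 16 *
    x^8 * n * t - 32 * x^8 * n * t * P + 8 * x^9 - 32 * x^9 * K - 32 * x^9 * H - 96 * x^9 * H * K + 31 * x^9 * P - 112 * x^9 * P * K - 12 * x^9 * P * H -
    104 * x^9 * t - 64 * x^9 * t * H - 16 * x^9 * n + 16 * x^9 * n * H + 32 * x^9 * n * P - 32 * x^9 * n * P * H - 43 * x^10 - 224 * x^10 * K - 32 * x^10
    * H + 10 * x^10 * P - 64 * x^10 * P * K - 24 * x^10 * P * H + 12 * x^10 * t + 16 * x^10 * t * H + 48 * x^10 * t * P - 32 * x^10 * t * P * H - 8 * x^10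
    * n - 32 * x^10 * n * H - 16 * x^10 * n * P - 28 * x^11 - 32 * x^11 * K + 56 * x^11 * H + 32 * x^11 * P - 48 * x^11 * P * H + 16 * x^11 * t - 96 *
    x^11 * t * H - 16 * x^11 * t * P + 20 * x^11 * n - 24 * x^11 * n * P - 110 * x^12 - 128 * x^12 * K - 40 * x^12 * H + 24 * x^12 * P - 32 * x^12 * P * H
    + 48 * x^12 * t - 32 * x^12 * t * P + 8 * x^12 * n - 32 * x^13 + 40 * x^13 * P - 64 * x^13 * P * H - 16 * x^13 * n - 32 * x^13 * n * P - 64 * x^14 -
    96 * x^14 * H - 48 * x^14 * P - 32 * x^14 * n + 48 * x^15 - 32 * x^15 * P - 4 * x^16 - 32 * x^16 * H - 32 * x^16 * P - 32 * x^17 * P - 16 * x^18"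
  \<comment> \<open>The equation is verified on the representatives \<open>W\<close> and
    \<open>D\<close>; passing back to \<open>V\<close> and \<open>V'\<close> changes it by a
    multiple of 64.\<close>
  have "W - x - (5 * u^2 - 6 * u + 1) * x^2 + 2 * x * W - W * W - 6 * u * x^2 * D = 64 * C5"
    unfolding W_def D_def A_def C5_def using P H n u by algebra
  then have "V - x - (5 * u^2 - 6 * u + 1) * x^2 + 2 * x * V - V^2 - 6 * u * x^2 * V'
    = 64 * (C5 + C1 + 2 * x * C1 - 2 * W * C1 - 64 * C1 * C1 - 6 * u * x^2 * C4)"
    using V V' by algebra
  then show ?thesis by (rule dvdI)
qed

section \<open>Squares of power series modulo 2 and the relations of \<Phi>\<close>

lemma fps_compose_X2_nth:
  fixes f :: "'a::comm_ring_1 fps"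
  shows "(f oo fps_X ^ 2) $ n = (if even n then f $ (n div 2) else 0)"
proof -
  have "(f oo fps_X ^ 2) $ n = (\<Sum>i=0..n. f $ i * (if n = 2 * i then 1 else 0))"
    by (simp add: fps_compose_nth power_mult[symmetric])
  also have "\<dots> = (if even n then f $ (n div 2) else 0)"
  proof (cases "even n")
    case True
    then have "(n = 2 * i) = (i = n div 2)" for i by auto
    then show ?thesis using True by (simp add: mult_delta_right)
  next
    case False
    then have "n \<noteq> 2 * i" for i by auto
    then show ?thesis using False by simp
  qed
  finally show ?thesis .
qed

text \<open>In a coefficient of the square the terms for \<open>i\<close> and \<open>n - i\<close>
  pair up. For even \<open>n\<close> there remains the square of the middle coefficient, which has
  the parity of that coefficient.\<close>

lemma fps_square_frobenius:
  fixes f :: "int fps"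
  shows "\<exists>g. f * f = (f oo fps_X ^ 2) + 2 * g"
proof -
  have "even ((f * f) $ n - (f oo fps_X ^ 2) $ n)" for n
  proof -
    let ?g = "\<lambda>i. f $ i * f $ (n - i)"
    have "(f * f) $ n = sum ?g {0..n}" by (simp add: fps_mult_nth)
    also have "\<dots> = sum ?g {i. 2 * i < n} + sum ?g {i. 2 * i > n \<and> i \<le> n} + sum ?g {i. 2 * i = n}"
    proof -
      have "{0..n} = ({i. 2 * i < n} \<union> {i. 2 * i > n \<and> i \<le> n}) \<union> {i. 2 * i = n}" by auto
      moreover have fin: "finite {i. 2 * i < n}" "finite {i. 2 * i > n \<and> i \<le> n}" "finite {i. 2 * i = n}"
        by (auto intro: finite_subset[of _ "{..n}"])
      moreover have "sum ?g (({i. 2 * i < n} \<union> {i. 2 * i > n \<and> i \<le> n}) \<union> {i. 2 * i = n})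
        = sum ?g {i. 2 * i < n} + sum ?g {i. 2 * i > n \<and> i \<le> n} + sum ?g {i. 2 * i = n}"
        using fin by (subst sum.union_disjoint; (subst sum.union_disjoint)?) auto
      ultimately show ?thesis by simp
    qed
    also have "sum ?g {i. 2 * i > n \<and> i \<le> n} = sum ?g {i. 2 * i < n}"
      by (rule sum.reindex_bij_witness[where i = "\<lambda>i. n - i" and j = "\<lambda>i. n - i"]) auto
    also have "sum ?g {i. 2 * i = n} = (if even n then f $ (n div 2) * f $ (n div 2) else 0)"
    proof (cases "even n")
      case True
      then have "{i. 2 * i = n} = {n div 2}" by auto
      moreover have "n - n div 2 = n div 2" using True by auto
      ultimately show ?thesis using True by simp
    next
      case False
      then have "{i. 2 * i = n} = {}" by auto
      then show ?thesis using False by simp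
    qed
    finally have 1: "(f * f) $ n = 2 * sum ?g {i. 2 * i < n} + (if even n then f $ (n div 2) * f $ (n div 2) else 0)"
      by simp
    show ?thesis unfolding 1 fps_compose_X2_nth by simp
  qed
  then have "\<exists>g. \<forall>n. (f * f) $ n - (f oo fps_X ^ 2) $ n = 2 * g n"
    unfolding dvd_def by metis
  then obtain g where g: "\<And>n. (f * f) $ n - (f oo fps_X ^ 2) $ n = 2 * g n" by blast
  have "f * f = (f oo fps_X ^ 2) + 2 * Abs_fps g"
  proof (rule fps_ext)
    fix n show "(f * f) $ n = ((f oo fps_X ^ 2) + 2 * Abs_fps g) $ n"
      using g[of n] by (simp add: numeral_fps_const)
  qed
  then show ?thesis ..
qed

definition Phi_fps :: "int fps" where
  "Phi_fps = Abs_fps (\<lambda>k. if \<exists>n. k = 2 ^ n then 1 else 0)"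

lemma Phi_fps_nth_0: "Phi_fps $ 0 = 0"
  by (simp add: Phi_fps_def)

lemma Phi_fps_compose: "Phi_fps oo fps_X ^ 2 = Phi_fps - fps_X"
proof (rule fps_ext)
  fix n
  show "(Phi_fps oo fps_X ^ 2) $ n = (Phi_fps - fps_X) $ n"
  proof (cases "even n")
    case True
    then obtain k where k: "n = 2 * k" ..
    have "(\<exists>j. n = 2 ^ j) \<longleftrightarrow> (\<exists>j. k = 2 ^ j)"
    proof
      assume "\<exists>j. n = 2 ^ j"
      then obtain j where "n = 2 ^ j" ..
      then show "\<exists>j. k = 2 ^ j" using k by (cases j) auto
    next
      assume "\<exists>j. k = 2 ^ j"
      then obtain j where "n = 2 ^ Suc j" using k by auto
      then show "\<exists>j. n = 2 ^ j" ..
    qed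
    then show ?thesis by (simp add: fps_compose_X2_nth k Phi_fps_def fps_X_nth)
  next
    case False
    then have "(\<exists>j. n = 2 ^ j) \<longleftrightarrow> n = 1"
      by (metis even_numeral even_power power_0 not_gr_zero)
    then show ?thesis using False by (simp add: fps_compose_X2_nth Phi_fps_def fps_X_nth)
  qed
qed

text \<open>The first relation is the congruence for the square of \<Phi>. Replacing
  \<open>z\<close> by \<open>z^2\<close> in it and halving determines \<open>H(z^2)\<close> exactly,
  and the congruence for the square of \<open>H\<close> then gives the second.\<close>

lemma Phi_fps_relations:
  obtains H K where "Phi_fps * Phi_fps = Phi_fps - fps_X + 2 * H"
    and "H * H = H - fps_X * Phi_fps + fps_X * fps_X + 2 * K"
proof -
  let ?s = "\<lambda>f :: int fps. f oo fps_X ^ 2"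
  have mult: "?s (f * g) = ?s f * ?s g" for f g by (rule fps_compose_mult_distrib) simp
  obtain H where H: "Phi_fps * Phi_fps = Phi_fps - fps_X + 2 * H"
    using fps_square_frobenius[of Phi_fps] unfolding Phi_fps_compose by blast
  have "?s (Phi_fps * Phi_fps) = ?s (Phi_fps - fps_X + 2 * H)" unfolding H ..
  then have "(Phi_fps - fps_X) * (Phi_fps - fps_X) = Phi_fps - fps_X - fps_X ^ 2 + 2 * ?s H"
    by (simp add: mult fps_compose_add_distrib fps_compose_sub_distrib Phi_fps_compose)
  then have "2 * ?s H = 2 * (H - fps_X * Phi_fps + fps_X * fps_X)"
    using H by algebra
  then have "?s H = H - fps_X * Phi_fps + fps_X * fps_X"
    by (metis mult_cancel_left zero_neq_numeral)
  then obtain K where "H * H = H - fps_X * Phi_fps + fps_X * fps_X + 2 * K"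
    using fps_square_frobenius[of H] by metis
  with H show ?thesis by (rule that)
qed

text \<open>The derivative is the sum of \<open>2^n z^(2^n - 1)\<close>, and from
  \<open>n = 6\<close> on its terms are divisible by 64.\<close>

lemma fps_deriv_Phi:
  obtains E where "fps_deriv Phi_fps = 1 + 2 * fps_X + 4 * fps_X^3 + 8 * fps_X^7 + 16 * fps_X^15 + 32 * fps_X^31 + 64 * E"
proof -
  let ?Q = "1 + 2 * fps_X + 4 * fps_X^3 + 8 * fps_X^7 + 16 * fps_X^15 + 32 * fps_X^31 :: int fps"
  have "64 dvd (fps_deriv Phi_fps - ?Q) $ k" for k
  proof -
    have Q: "?Q $ k = (if k = 0 then 1 else 0) + (if k = 1 then 2 else 0) + (if k = 3 then 4 else 0)
        + (if k = 7 then 8 else 0) + (if k = 15 then 16 else 0) + (if k = 31 then 32 else 0)"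
      by (simp add: numeral_fps_const fps_X_nth)
    show ?thesis
    proof (cases "\<exists>n. k + 1 = 2 ^ n")
      case True
      then obtain n where n: "k = 2 ^ n - 1" by (metis add_diff_cancel_right')
      have d: "fps_deriv Phi_fps $ k = 2 ^ n"
        using n by (auto simp: Phi_fps_def)
      show ?thesis
      proof (cases "n < 6")
        case True
        then have "n \<in> {0, 1, 2, 3, 4, 5}" by auto
        then show ?thesis unfolding fps_sub_nth d unfolding Q unfolding n by (elim insertE emptyE) simp_all
      next
        case False
        \<comment> \<open>Puts \<open>k\<close> at 63 or more, beyond all exponents of
          \<open>?Q\<close>.\<close>
        then have ge: "(2::nat) ^ 6 \<le> 2 ^ n" by (intro power_increasing) auto
        have "(2::int) ^ 6 dvd 2 ^ n" using False by (intro le_imp_power_dvd) simp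
        moreover have "?Q $ k = 0" unfolding Q using n ge by auto
        ultimately show ?thesis unfolding fps_sub_nth d by simp
      qed
    next
      case False
      have "fps_deriv Phi_fps $ k = 0" using False by (simp add: Phi_fps_def)
      moreover have "k \<noteq> 2 ^ n - 1" for n using False by auto
      from this[of 0] this[of 1] this[of 2] this[of 3] this[of 4] this[of 5]
      have "?Q $ k = 0" unfolding Q by simp
      ultimately show ?thesis by simp
    qed
  qed
  then obtain e where e: "\<And>k. (fps_deriv Phi_fps - ?Q) $ k = 64 * e k"
    unfolding dvd_def by metis
  have "fps_deriv Phi_fps = ?Q + 64 * Abs_fps e"
  proof (rule fps_ext)
    fix k
    have "(64 * Abs_fps e) $ k = 64 * e k" by (simp add: numeral_fps_const)
    then show "fps_deriv Phi_fps $ k = (?Q + 64 * Abs_fps e) $ k"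
      using e[of k] unfolding fps_add_nth fps_sub_nth by linarith
  qed
  then show ?thesis by (rule that)
qed

text \<open>The difference \<open>D\<close> satisfies a linear equation modulo 64 whose right-hand
  side at \<open>n\<close> involves only earlier coefficients of \<open>D\<close>:
  \<open>V + W\<close> has no constant term, and \<open>fps_X * (fps_X * fps_deriv D)\<close> takes
  its coefficient from \<open>n - 1\<close>.\<close>

lemma riccati_unique_mod_64:
  fixes V W :: "int fps"
  assumes V: "64 dvd V - fps_X - c * fps_X^2 + 2 * fps_X * V - V^2 - 6 * of_nat m * fps_X^2 * fps_deriv V"
    and W: "W - fps_X - c * fps_X^2 + 2 * fps_X * W - W^2 - 6 * of_nat m * fps_X^2 * fps_deriv W = 0"
    and 0: "V $ 0 = 0" "W $ 0 = 0"
  shows "64 dvd (V - W) $ n"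
proof (induction n rule: less_induct)
  case (less n)
  define D where "D = V - W"
  obtain C where C: "V - fps_X - c * fps_X^2 + 2 * fps_X * V - V^2 - 6 * of_nat m * fps_X^2 * fps_deriv V = 64 * C"
    using V by (auto elim: dvdE)
  have "fps_deriv V = fps_deriv W + fps_deriv D" by (simp add: D_def)
  then have "D = 64 * C - 2 * (fps_X * D) + (V + W) * D + 6 * (of_nat m * (fps_X * (fps_X * fps_deriv D)))"
    using C W D_def by algebra
  then have "D $ n = (64 * C - 2 * (fps_X * D) + (V + W) * D + 6 * (of_nat m * (fps_X * (fps_X * fps_deriv D)))) $ n"
    by (rule arg_cong)
  then have "D $ n = 64 * C $ n - 2 * (fps_X * D) $ n + ((V + W) * D) $ n + 6 * (int m * (fps_X * (fps_X * fps_deriv D)) $ n)"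
    by (simp add: numeral_fps_const flip: fps_of_nat)
  moreover have "64 dvd (fps_X * D) $ n"
    using less[of "n - 1"] by (auto simp: D_def[symmetric])
  moreover have "64 dvd (fps_X * (fps_X * fps_deriv D)) $ n"
    using less[of "n - 1"] by (cases n; cases "n - 1") (auto simp: D_def[symmetric])
  moreover have "64 dvd ((V + W) * D) $ n"
    unfolding fps_mult_nth
  proof (rule dvd_sum)
    fix i assume "i \<in> {0..n}"
    then show "64 dvd (V + W) $ i * D $ (n - i)"
      using less[of "n - i"] 0 by (cases "i = 0") (auto simp: D_def[symmetric])
  qed
  ultimately have "64 dvd D $ n"
    by (metis dvd_add dvd_diff dvd_mult dvd_triv_left)
  then show ?case by (simp add: D_def)
qed

section \<open>Passage to Laurent series and conclusion\<close>

lemma Phi_eq: "Phi = fps_to_fls Phi_fps"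
  by (simp add: Phi_def Phi_fps_def)

lemma fps_to_fls_rhs_poly:
  "fps_to_fls (rhs_poly fps_X (of_nat m) Phi_fps) = rhs_poly fls_X (of_nat m) Phi"
  unfolding rhs_poly_def Phi_eq
  by (simp add: fls_times_fps_to_fls fps_to_fls_power)

lemma rhs_poly_shift:
  fixes z :: "'a::idom"
  assumes "z * w = 1"
  shows "w * rhs_poly z u P =
     (32 * z^9 + 48 * z^7 + 32 * z^6 + (16 * u + 8) * z^5 + (16 * u + 8) * z^4
        + (2 * u^2 + 34) * z^3 + (4 * u^2 - 4 * u + 24) * z^2 + (5 * u^2 + 12) * z + 1
      + (48 * z^4 + 24 * z^3 + 12 * z^2 + 60 * z + 40) * P
      + (16 * z^5 + (16 * u + 32) * z^4 + (4 * u^2 - 32 * u + 68) * z^3 + 36 * z^2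
          + 22 * z + 12 + 12 * w) * P^2
      + (32 * z^5 + 32 * z^4 + (16 * u - 16) * z^3 + 40 * z^2 + 4 * z + 52 + 28 * w) * P^3
      + (32 * z^7 + 32 * z^5 + 32 * z^4 + (16 * u + 24) * z^3 + (16 * u + 40) * z^2
          + (2 * u^2 + 16 * u + 38) * z + 24 + 35 * w) * P^4
      + (32 * z^3 + 16 * z^2 + (16 * u - 8) * z + 44) * P^5
      + (16 * z^3 + 16 * u * z^2 + (4 * u^2 - 16 * u + 20) * z + 44 + 50 * w) * P^6
      + (32 * z^3 + 32 * z^2 + (16 * u + 16) * z + 40 + 4 * w) * P^7)"
  unfolding rhs_poly_def using assms by algebra

theorem theorem20:
  fixes m :: nat
  assumes "m > 0" and "odd m"
  shows "let z = (fls_X :: int fls); z_inv = (fls_X_inv :: int fls); \<mu> = (of_nat m :: int fls) in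
    fls_cong (free_subgroup_series m)
     (32 * z^9 + 48 * z^7 + 32 * z^6 + (16 * \<mu> + 8) * z^5 + (16 * \<mu> + 8) * z^4
        + (2 * \<mu>^2 + 34) * z^3 + (4 * \<mu>^2 - 4 * \<mu> + 24) * z^2 + (5 * \<mu>^2 + 12) * z + 1
      + (48 * z^4 + 24 * z^3 + 12 * z^2 + 60 * z + 40) * Phi
      + (16 * z^5 + (16 * \<mu> + 32) * z^4 + (4 * \<mu>^2 - 32 * \<mu> + 68) * z^3 + 36 * z^2
          + 22 * z + 12 + 12 * z_inv) * Phi^2
      + (32 * z^5 + 32 * z^4 + (16 * \<mu> - 16) * z^3 + 40 * z^2 + 4 * z + 52 + 28 * z_inv) * Phi^3
      + (32 * z^7 + 32 * z^5 + 32 * z^4 + (16 * \<mu> + 24) * z^3 + (16 * \<mu> + 40) * z^2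
          + (2 * \<mu>^2 + 16 * \<mu> + 38) * z + 24 + 35 * z_inv) * Phi^4
      + (32 * z^3 + 16 * z^2 + (16 * \<mu> - 8) * z + 44) * Phi^5
      + (16 * z^3 + 16 * \<mu> * z^2 + (4 * \<mu>^2 - 16 * \<mu> + 20) * z + 44 + 50 * z_inv) * Phi^6
      + (32 * z^3 + 32 * z^2 + (16 * \<mu> + 16) * z + 40 + 4 * z_inv) * Phi^7)
     64"
proof -
  define F where "F = Abs_fps (\<lambda>l. if l \<ge> 1 then int (free_subgroup_number m l) else 0)"
  \<comment> \<open>The left-hand side times \<open>z\<close>, to be compared with
    \<open>rhs_poly\<close>.\<close>
  define W where "W = fps_X + fps_X * F"
  define V where "V = rhs_poly fps_X (of_nat m) Phi_fps"
  define n where "n = int m div 2"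
  \<comment> \<open>A triangular number: for \<open>m = 1 + 2 n\<close> it gives
    \<open>m^2 = 1 + 8 t\<close>.\<close>
  define t where "t = n * (n + 1) div 2"
  have n: "int m = 1 + 2 * n" using assms(2) by (simp add: n_def odd_iff_mod_2_eq_one) presburger
  have t: "n * n = 2 * t - n" by (simp add: t_def algebra_simps)
  obtain H K where HK: "Phi_fps * Phi_fps = Phi_fps - fps_X + 2 * H"
    "H * H = H - fps_X * Phi_fps + fps_X * fps_X + 2 * K"
    by (rule Phi_fps_relations)
  obtain E where E: "fps_deriv Phi_fps = 1 + 2 * fps_X + 4 * fps_X^3 + 8 * fps_X^7 + 16 * fps_X^15 + 32 * fps_X^31 + 64 * E"
    by (rule fps_deriv_Phi)
  have n': "of_nat m = 1 + 2 * (of_int n :: int fps)"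
    using n by (metis of_int_1 of_int_add of_int_mult of_int_numeral of_int_of_nat_eq)
  have t': "(of_int n :: int fps) * of_int n = 2 * of_int t - of_int n"
    using t by (metis of_int_diff of_int_mult of_int_numeral)
  have V: "64 dvd V - fps_X - (5 * of_nat m ^ 2 - 6 * of_nat m + 1) * fps_X^2 + 2 * fps_X * V - V^2
      - 6 * of_nat m * fps_X^2 * fps_deriv V"
    unfolding V_def fps_deriv_rhs_poly by (rule rhs_poly_mod_64[OF HK t' n' E])
  have "fps_deriv W = 1 + F + fps_X * fps_deriv F" by (simp add: W_def)
  \<comment> \<open>The Riccati equation times \<open>z\<close>, rewritten with
    \<open>F = W / z - 1\<close>. The coefficient of \<open>fps_X^2\<close> collects
    \<open>5 m^2\<close> from the constant term, \<open>- 6 m\<close> from the linear terms and 1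
    from the square of \<open>W - z\<close>.\<close>
  then have W: "W - fps_X - (5 * of_nat m ^ 2 - 6 * of_nat m + 1) * fps_X^2 + 2 * fps_X * W - W^2
      - 6 * of_nat m * fps_X^2 * fps_deriv W = 0"
    using free_subgroup_riccati[OF assms(1), folded F_def] W_def by algebra
  have "V $ 0 = 0"
    by (simp add: V_def rhs_poly_def Phi_fps_nth_0 fps_power_zeroth)
  then have cong: "64 dvd (V - W) $ k" for k
    using riccati_unique_mod_64[OF V W] by (simp add: W_def)
  have inv: "fls_X * fls_X_inv = (1 :: int fls)"
    by (simp add: fls_X_times_conv_shift fls_eq_iff)
  then have inv': "fls_X_inv * fls_X = (1 :: int fls)" by (simp only: mult.commute)
  have lhs: "free_subgroup_series m = fls_X_inv * fps_to_fls W"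
  proof -
    have "fls_X_inv * fps_to_fls W = (fls_X_inv * fls_X) * (1 + fps_to_fls F)"
      by (simp add: W_def fls_times_fps_to_fls algebra_simps)
    then show ?thesis unfolding inv' by (simp add: free_subgroup_series_def F_def)
  qed
  define \<mu> where "\<mu> = (of_nat m :: int fls)"
  have "fls_cong (free_subgroup_series m) (fls_X_inv * rhs_poly fls_X \<mu> Phi) 64"
    unfolding fls_cong_def lhs \<mu>_def fps_to_fls_rhs_poly[symmetric] V_def[symmetric]
  proof
    fix k
    have "W $ j mod 64 = V $ j mod 64" for j
      using cong[of j] by (simp add: mod_eq_dvd_iff[symmetric])
    then show "fls_nth (fls_X_inv * fps_to_fls W) k mod 64 = fls_nth (fls_X_inv * fps_to_fls V) k mod 64"
      by (simp add: fls_X_inv_times_conv_shift)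
  qed
  then show ?thesis
    unfolding Let_def rhs_poly_shift[OF inv] \<mu>_def .
qed

end
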